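(* Let $p$ be a prime and let $G$ be a locally compact abelian $p$-group with $\mathrm{rank}_p(G)<\infty$. Then $G\in\mathfrak E_{<\infty}$. Moreover, writing $G\cong\mathbb Z_p^{n_1}\times\mathbb Q_p^{n_2}\times\mathbb Z(p^\infty)^{n_3}\times F_p$ (topologically) with $n_1,n_2,n_3\in\mathbb N$ and $F_p$ a finite $p$-group, one has $G\in\mathfrak E_0$ if and only if $n_2=0$.
   Context: For a topological group $G$, $\mathrm{End}(G)$ is the set of continuous endomorphisms of $G$. For a locally compact group $G$ with left Haar measure $\mu$, let $\mathcal C(G)$ be the family of compact neighborhoods of the identity. For $\phi\in\mathrm{End}(G)$, $U\in\mathcal C(G)$ and $n\ge 1$ put $C_n(\phi,U)=U\cap\phi^{-1}(U)\cap\dots\cap\phi^{-n+1}(U)$, $H_{top}(\phi,U)=\limsup_{n\to\infty}\frac{-\log\mu(C_n(\phi,U))}{n}$, and $h_{top}(\phi)=\sup\{H_{top}(\phi,U)\mid U\in\mathcal C(G)\}\in[0,\infty]$. $\mathfrak E_0$ is the class of locally compact groups $G$ such that $h_{top}(\phi)=0$ for every $\phi\in\mathrm{End}(G)$; $\mathfrak E_{<\infty}$ is the class of those with $h_{top}(\phi)<\infty$ for every $\phi\in\mathrm{End}(G)$. A locally compact abelian $p$-group is a locally compact abelian group $G$ in which $p^nx\to 0$ for every $x\in G$; it is a $\mathbb Z_p$-module. Let $\mathrm{rk}_{\mathbb Z_p}(G)$ be its $\mathbb Z_p$-rank and $r_p(G)=\dim_{\mathbb Z/p\mathbb Z}\{x\in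 G\mid px=0\}$ its $p$-rank; when both are finite, $\mathrm{rank}_p(G)=\mathrm{rk}_{\mathbb Z_p}(G)+r_p(G)$, and $\mathrm{rank}_p(G)<\infty$ means that both are finite. It is a known theorem that a locally compact abelian $p$-group $G$ has $\mathrm{rank}_p(G)<\infty$ if and only if it is topologically isomorphic to $\mathbb Z_p^{n_1}\times\mathbb Q_p^{n_2}\times\mathbb Z(p^\infty)^{n_3}\times F_p$ for some $n_1,n_2,n_3\in\mathbb N$ and a finite $p$-group $F_p$, where $\mathbb Z_p$ and $\mathbb Q_p$ carry the $p$-adic topology and the Prüfer group $\mathbb Z(p^\infty)$ is discrete. *)

theory Defs
  imports "HOL-Analysis.Analysis" "HOL-Algebra.Product_Groups" "HOL-Algebra.FiniteProduct"
begin

section \<open>Locally compact groups\<close>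

text \<open>Topological groups are HOL-Algebra groups with a topology on the carrier. As usual in the
  theory of locally compact groups, the Hausdorff property is part of local compactness.\<close>

locale topological_group = group G for G :: "('a, 'm) monoid_scheme" (structure) +
  fixes T :: "'a topology"
  assumes topspace_eq: "topspace T = carrier G"
    and continuous_mult: "continuous_map (prod_topology T T) T (\<lambda>(x, y). x \<otimes> y)"
    and continuous_inv: "continuous_map T T (\<lambda>x. inv x)"

locale locally_compact_group = topological_group +
  assumes Hausdorff: "Hausdorff_space T"
    and locally_compact: "locally_compact_space T"

definition continuous_end :: "('a, 'm) monoid_scheme \<Rightarrow> 'a topology \<Rightarrow> ('a \<Rightarrow> 'a) set" where
  "continuous_end G T = {\<phi> \<in> hom G G. continuous_map T T \<phi>}"

definition topologically_isomorphic ::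
  "('a, 'm) monoid_scheme \<Rightarrow> 'a topology \<Rightarrow> ('b, 'n) monoid_scheme \<Rightarrow> 'b topology \<Rightarrow> bool" where
  "topologically_isomorphic G T H S \<longleftrightarrow> (\<exists>f. f \<in> iso G H \<and> homeomorphic_map T S f)"

section \<open>Haar measure and topological entropy\<close>

definition left_haar_measure ::
  "('a, 'm) monoid_scheme \<Rightarrow> 'a topology \<Rightarrow> 'a measure \<Rightarrow> bool" where
  "left_haar_measure G T \<mu> \<longleftrightarrow>
     sets \<mu> = sets (sigma (topspace T) {U. openin T U}) \<and>
     emeasure \<mu> (space \<mu>) \<noteq> 0 \<and>
     (\<forall>K. compactin T K \<longrightarrow> emeasure \<mu> K < \<infinity>) \<and>
     (\<forall>A \<in> sets \<mu>. emeasure \<mu> A = (INF U \<in> {U. openin T U \<and> A \<subseteq> U}. emeasure \<mu> U)) \<and>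
     (\<forall>U. openin T U \<longrightarrow> emeasure \<mu> U = (SUP K \<in> {K. compactin T K \<and> K \<subseteq> U}. emeasure \<mu> K)) \<and>
     (\<forall>g \<in> carrier G. \<forall>A \<in> sets \<mu>. emeasure \<mu> (g <#\<^bsub>G\<^esub> A) = emeasure \<mu> A)"

text \<open>A left Haar measure exists on every locally compact group and is unique up to a positive
  factor, on which the entropy below does not depend; so any one may be chosen.\<close>

definition haar :: "('a, 'm) monoid_scheme \<Rightarrow> 'a topology \<Rightarrow> 'a measure" where
  "haar G T = (SOME \<mu>. left_haar_measure G T \<mu>)"

definition compact_nhds :: "('a, 'm) monoid_scheme \<Rightarrow> 'a topology \<Rightarrow> 'a set set" where
  "compact_nhds G T = {U. compactin T U \<and> \<one>\<^bsub>G\<^esub> \<in> T interior_of U}"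

definition cotrajectory ::
  "('a, 'm) monoid_scheme \<Rightarrow> ('a \<Rightarrow> 'a) \<Rightarrow> 'a set \<Rightarrow> nat \<Rightarrow> 'a set" where
  "cotrajectory G \<phi> U n = {x \<in> carrier G. \<forall>k<n. (\<phi> ^^ k) x \<in> U}"

text \<open>For \<open>n \<ge> 1\<close> the cotrajectory of a compact neighbourhood is again a compact neighbourhood, so its
  Haar measure is a positive real number.\<close>

definition H_top ::
  "('a, 'm) monoid_scheme \<Rightarrow> 'a topology \<Rightarrow> ('a \<Rightarrow> 'a) \<Rightarrow> 'a set \<Rightarrow> ereal" where
  "H_top G T \<phi> U =
     limsup (\<lambda>n. ereal (- ln (measure (haar G T) (cotrajectory G \<phi> U n)) / real n))"

definition h_top :: "('a, 'm) monoid_scheme \<Rightarrow> 'a topology \<Rightarrow> ('a \<Rightarrow> 'a) \<Rightarrow> ereal" where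
  "h_top G T \<phi> = (SUP U \<in> compact_nhds G T. H_top G T \<phi> U)"

definition class_E_0 :: "('a, 'm) monoid_scheme \<Rightarrow> 'a topology \<Rightarrow> bool" where
  "class_E_0 G T \<longleftrightarrow>
     locally_compact_group G T \<and> (\<forall>\<phi> \<in> continuous_end G T. h_top G T \<phi> = 0)"

definition class_E_finite :: "('a, 'm) monoid_scheme \<Rightarrow> 'a topology \<Rightarrow> bool" where
  "class_E_finite G T \<longleftrightarrow>
     locally_compact_group G T \<and> (\<forall>\<phi> \<in> continuous_end G T. h_top G T \<phi> < \<infinity>)"

section \<open>The \<open>p\<close>-adic groups and the Pruefer group\<close>

definition padic_abs :: "nat \<Rightarrow> rat \<Rightarrow> real" where
  "padic_abs p q = (if q = 0 then 0 else
     real p powi (int (multiplicity (int p) (snd (quotient_of q)))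
                - int (multiplicity (int p) (fst (quotient_of q)))))"

definition padic_cauchy_group :: "nat \<Rightarrow> rat set \<Rightarrow> (nat \<Rightarrow> rat) monoid" where
  "padic_cauchy_group p R =
     \<lparr>carrier = {s. range s \<subseteq> R \<and>
        (\<forall>e>0. \<exists>N. \<forall>m\<ge>N. \<forall>n\<ge>N. padic_abs p (s m - s n) < e)},
      monoid.mult = (\<lambda>s t n. s n + t n),
      one = (\<lambda>n. 0)\<rparr>"

definition padic_null :: "nat \<Rightarrow> rat set \<Rightarrow> (nat \<Rightarrow> rat) set" where
  "padic_null p R =
     {s \<in> carrier (padic_cauchy_group p R). (\<lambda>n. padic_abs p (s n)) \<longlonglongrightarrow> 0}"

text \<open>The completion of a subgroup \<open>R\<close> of the rationals with respect to the \<open>p\<close>-adic absolute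
  value: Cauchy sequences modulo null sequences, with the distance
  \<open>d([s], [t]) = lim |s n - t n|\<^sub>p\<close>.\<close>

definition padic_completion :: "nat \<Rightarrow> rat set \<Rightarrow> (nat \<Rightarrow> rat) set monoid" where
  "padic_completion p R = padic_cauchy_group p R Mod padic_null p R"

definition padic_dist :: "nat \<Rightarrow> (nat \<Rightarrow> rat) set \<Rightarrow> (nat \<Rightarrow> rat) set \<Rightarrow> real" where
  "padic_dist p A B =
     (THE d. \<forall>s \<in> A. \<forall>t \<in> B. (\<lambda>n. padic_abs p (s n - t n)) \<longlonglongrightarrow> d)"

definition padic_topology :: "nat \<Rightarrow> rat set \<Rightarrow> (nat \<Rightarrow> rat) set topology" where
  "padic_topology p R =
     Metric_space.mtopology (carrier (padic_completion p R)) (padic_dist p)"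

abbreviation Zp :: "nat \<Rightarrow> (nat \<Rightarrow> rat) set monoid" where
  "Zp p \<equiv> padic_completion p \<int>"

abbreviation Zp_top :: "nat \<Rightarrow> (nat \<Rightarrow> rat) set topology" where
  "Zp_top p \<equiv> padic_topology p \<int>"

abbreviation Qp :: "nat \<Rightarrow> (nat \<Rightarrow> rat) set monoid" where
  "Qp p \<equiv> padic_completion p UNIV"

abbreviation Qp_top :: "nat \<Rightarrow> (nat \<Rightarrow> rat) set topology" where
  "Qp_top p \<equiv> padic_topology p UNIV"

text \<open>The Pruefer group, as the group of complex roots of unity of \<open>p\<close>-power order.\<close>

definition pruefer :: "nat \<Rightarrow> complex monoid" where
  "pruefer p = \<lparr>carrier = {z. \<exists>n. z ^ (p ^ n) = 1}, monoid.mult = (*), one = 1\<rparr>"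

abbreviation pruefer_top :: "nat \<Rightarrow> complex topology" where
  "pruefer_top p \<equiv> discrete_topology (carrier (pruefer p))"

definition finite_p_group :: "nat \<Rightarrow> ('b, 'n) monoid_scheme \<Rightarrow> bool" where
  "finite_p_group p F \<longleftrightarrow> group F \<and> finite (carrier F) \<and> (\<exists>k. order F = p ^ k)"

text \<open>\<open>\<int>\<^sub>p\<^sup>n\<^sup>1 \<times> \<rat>\<^sub>p\<^sup>n\<^sup>2 \<times> \<int>(p\<^sup>\<infinity>)\<^sup>n\<^sup>3 \<times> F\<close>\<close>

definition model_group :: "nat \<Rightarrow> nat \<Rightarrow> nat \<Rightarrow> nat \<Rightarrow> ('b, 'n) monoid_scheme \<Rightarrow>
    ((nat \<Rightarrow> (nat \<Rightarrow> rat) set) \<times> (nat \<Rightarrow> (nat \<Rightarrow> rat) set) \<times> (nat \<Rightarrow> complex) \<times> 'b) monoid" where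
  "model_group p n1 n2 n3 F =
     product_group {..<n1} (\<lambda>_. Zp p) \<times>\<times> product_group {..<n2} (\<lambda>_. Qp p) \<times>\<times>
     product_group {..<n3} (\<lambda>_. pruefer p) \<times>\<times> F"

definition model_top :: "nat \<Rightarrow> nat \<Rightarrow> nat \<Rightarrow> nat \<Rightarrow> ('b, 'n) monoid_scheme \<Rightarrow>
    ((nat \<Rightarrow> (nat \<Rightarrow> rat) set) \<times> (nat \<Rightarrow> (nat \<Rightarrow> rat) set) \<times> (nat \<Rightarrow> complex) \<times> 'b) topology" where
  "model_top p n1 n2 n3 F =
     prod_topology (product_topology (\<lambda>_. Zp_top p) {..<n1})
      (prod_topology (product_topology (\<lambda>_. Qp_top p) {..<n2})
       (prod_topology (product_topology (\<lambda>_. pruefer_top p) {..<n3})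
         (discrete_topology (carrier F))))"

section \<open>Locally compact abelian \<open>p\<close>-groups and their ranks\<close>

locale lca_p_group = locally_compact_group + comm_group G +
  fixes p :: nat
  assumes pow_tendsto_one:
    "x \<in> carrier G \<Longrightarrow> limitin T (\<lambda>n. x [^] (p ^ n)) \<one> sequentially"

text \<open>The scalar action of \<open>\<int>\<^sub>p\<close> extends the one of \<open>\<int>\<close> by continuity: if the integers
  \<open>s n\<close> (here integral rationals) converge to \<open>a\<close>, then \<open>a \<cdot> x\<close> is the limit of \<open>x [^] s n\<close>.\<close>

definition Zp_action ::
  "('a, 'm) monoid_scheme \<Rightarrow> 'a topology \<Rightarrow> (nat \<Rightarrow> rat) set \<Rightarrow> 'a \<Rightarrow> 'a" where
  "Zp_action G T a x =
     (THE y. \<forall>s \<in> a. limitin T (\<lambda>n. x [^]\<^bsub>G\<^esub> \<lfloor>s n\<rfloor>) y sequentially)"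

text \<open>Linear independence in a multiplicatively written module with scalars \<open>K\<close>, zero scalar
  \<open>z\<close> and scalar action \<open>act\<close>. The rank is the supremum of the sizes of the finite independent
  subsets of the submodule \<open>V\<close>; over a field this is the dimension.\<close>

definition independent_over ::
  "('a, 'm) monoid_scheme \<Rightarrow> 'k set \<Rightarrow> 'k \<Rightarrow> ('k \<Rightarrow> 'a \<Rightarrow> 'a) \<Rightarrow> 'a set \<Rightarrow> bool" where
  "independent_over G K z act S \<longleftrightarrow>
     (\<forall>A c. finite A \<and> A \<subseteq> S \<and> c \<in> A \<rightarrow> K \<and> (\<Otimes>\<^bsub>G\<^esub>x\<in>A. act (c x) x) = \<one>\<^bsub>G\<^esub>
        \<longrightarrow> (\<forall>x\<in>A. c x = z))"

definition rank_over ::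
  "('a, 'm) monoid_scheme \<Rightarrow> 'k set \<Rightarrow> 'k \<Rightarrow> ('k \<Rightarrow> 'a \<Rightarrow> 'a) \<Rightarrow> 'a set \<Rightarrow> enat" where
  "rank_over G K z act V =
     (SUP S \<in> {S. finite S \<and> S \<subseteq> V \<and> independent_over G K z act S}. enat (card S))"

definition rk_Zp :: "nat \<Rightarrow> ('a, 'm) monoid_scheme \<Rightarrow> 'a topology \<Rightarrow> enat" where
  "rk_Zp p G T =
     rank_over G (carrier (Zp p)) \<one>\<^bsub>Zp p\<^esub> (Zp_action G T) (carrier G)"

text \<open>The field \<open>\<int>/p\<int>\<close> is represented by the residues \<open>0, \<dots>, p - 1\<close>.\<close>

definition r_p :: "nat \<Rightarrow> ('a, 'm) monoid_scheme \<Rightarrow> enat" where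
  "r_p p G =
     rank_over G {0..<p} 0 (\<lambda>k x. x [^]\<^bsub>G\<^esub> k) {x \<in> carrier G. x [^]\<^bsub>G\<^esub> p = \<one>\<^bsub>G\<^esub>}"

definition rank_p :: "nat \<Rightarrow> ('a, 'm) monoid_scheme \<Rightarrow> 'a topology \<Rightarrow> enat" where
  "rank_p p G T = rk_Zp p G T + r_p p G"

end

theory Submission
  imports Defs "HOL-Algebra.Multiplicative_Group"
begin

text \<open>Write \<open>L\<^bsup>q\<^esup>\<close> for the set of \<open>q\<close>-th powers of elements of \<open>L\<close>; the group operation is multiplicative.

  Everything rests on one fact about a locally compact abelian \<open>p\<close>-group \<open>G\<close> of finite rank: there
  are compact open subgroups \<open>L\<close>, and for each of them the subgroups \<open>L\<^bsup>p^j\<^esup>\<close> are open and form a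
  neighbourhood base of the identity.  A Baire category argument makes the maps \<open>x \<mapsto> x\<^bsup>p^m\<^esup>\<close>
  equicontinuous, so they tend to the identity uniformly on compact sets
  (\<open>prime_powers_uniformly_small\<close>).  This makes every cyclic subgroup relatively compact, and a compact
  neighbourhood then generates a compact open subgroup (\<open>ex_compact_open_subgroup\<close>).  Finite \<open>p\<close>-rank
  says that \<open>G\<close> has finitely many elements of order \<open>p\<close>; finite \<open>\<int>\<^sub>p\<close>-rank says that a torsion-free
  compact subgroup \<open>U\<close> has finite index over \<open>U\<^sup>p\<close> (\<open>torsion_free_finitely_covered\<close>), since elements that
  are independent modulo \<open>U\<^sup>p\<close> are independent over \<open>\<int>\<^sub>p\<close>.  Both together give \<open>open_prime_pows\<close>.

  The filtration \<open>L\<^bsup>p^j\<^esup>\<close> yields a Haar measure by counting cosets (\<open>ex_left_haar_measure\<close>).  For the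
  entropy, let \<open>\<phi>\<close> be an endomorphism.  If \<open>\<phi> (L)\<close> is covered by \<open>N\<close> cosets of \<open>L\<close>, then
  \<open>\<phi> (L\<^bsup>p^j\<^esup>) = \<phi> (L)\<^bsup>p^j\<^esup>\<close> is covered by \<open>N\<close> cosets of \<open>L\<^bsup>p^j\<^esup>\<close>, for the same \<open>N\<close>, and so
  \<open>h\<^sub>t\<^sub>o\<^sub>p (\<phi>) \<le> ln N\<close> (\<open>h_top_le\<close>, \<open>finite_entropy\<close>).

  In the model, \<open>n\<^sub>2\<close> is read off from divisibility.  If \<open>n\<^sub>2 = 0\<close>, then \<open>G/G\<^sup>p\<close> is finite and the elements
  with \<open>p\<^sup>j\<close>-th roots for all \<open>j\<close> are torsion.  By compactness \<open>G = L \<cdot> D\<close>, where \<open>D\<close> consists of these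
  elements, so \<open>\<phi> (L)\<close> is covered by finitely many torsion translates of \<open>L\<close>.  They disappear
  after passing to \<open>p\<^sup>j\<close>-th powers: \<open>L\<^bsup>p^j\<^esup>\<close> is \<open>\<phi>\<close>-invariant for large \<open>j\<close>, and the entropy vanishes
  (\<open>class_E_0I\<close>).  If \<open>n\<^sub>2 > 0\<close>, the factor \<open>\<rat>\<^sub>p\<^bsup>n2\<^esup>\<close> is a uniquely \<open>p\<close>-divisible topological direct
  factor of \<open>G\<close>.  Projecting to it and dividing by \<open>p\<close> is a continuous endomorphism, because \<open>p\<close>-th powers of
  small open subgroups are open; it expands by at least \<open>p\<close>, so its entropy is at least \<open>ln p\<close>
  (\<open>positive_entropy\<close>, \<open>not_class_E_0I\<close>).\<close>

no_notation subset_mset (infix \<open><#\<close> 50)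

lemma set_mult_memI: "a \<in> A \<Longrightarrow> b \<in> B \<Longrightarrow> x = a \<otimes>\<^bsub>G\<^esub> b \<Longrightarrow> x \<in> A <#>\<^bsub>G\<^esub> B"
  by (auto simp: set_mult_def)

section \<open>Neighbourhoods in topological groups\<close>

context topological_group
begin

lemma open_subset_carrier: "openin T U \<Longrightarrow> U \<subseteq> carrier G"
  using openin_subset topspace_eq by blast

lemma compact_subset_carrier: "compactin T K \<Longrightarrow> K \<subseteq> carrier G"
  using compactin_subset_topspace topspace_eq by blast

lemma continuous_map_mult:
  assumes "continuous_map X T f" "continuous_map X T g"
  shows "continuous_map X T (\<lambda>x. f x \<otimes> g x)"
proof -
  have "continuous_map X (prod_topology T T) (\<lambda>x. (f x, g x))"
    using assms by (simp add: continuous_map_pairwise comp_def)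
  from continuous_map_compose[OF this continuous_mult] show ?thesis
    by (simp add: comp_def)
qed

lemma continuous_map_minv:
  assumes "continuous_map X T f"
  shows "continuous_map X T (\<lambda>x. inv (f x))"
  using continuous_map_compose[OF assms continuous_inv] by (simp add: comp_def)

lemma continuous_map_power:
  assumes "continuous_map X T f"
  shows "continuous_map X T (\<lambda>x. f x [^] (n::nat))"
proof (induction n)
  case 0
  then show ?case by (simp add: topspace_eq)
next
  case (Suc n)
  then show ?case using continuous_map_mult[OF Suc assms] by simp
qed

lemma continuous_map_constI: "g \<in> carrier G \<Longrightarrow> continuous_map X T (\<lambda>x. g)"
  by (simp add: topspace_eq)

lemma l_coset_eq_image: "g <# A = (\<lambda>x. g \<otimes> x) ` A"
  by (auto simp: l_coset_def)

lemma mem_l_coset_iff: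
  assumes "g \<in> carrier G" "A \<subseteq> carrier G" "x \<in> carrier G"
  shows "x \<in> g <# A \<longleftrightarrow> inv g \<otimes> x \<in> A"
proof
  assume "x \<in> g <# A"
  then obtain a where "a \<in> A" "x = g \<otimes> a" by (auto simp: l_coset_def)
  then show "inv g \<otimes> x \<in> A"
    using assms by (auto simp: m_assoc[symmetric] subset_iff)
next
  assume "inv g \<otimes> x \<in> A"
  moreover have "x = g \<otimes> (inv g \<otimes> x)"
    using assms by (simp add: m_assoc[symmetric])
  ultimately show "x \<in> g <# A" by (auto simp: l_coset_def)
qed

lemma open_l_coset:
  assumes "openin T U" "g \<in> carrier G"
  shows "openin T (g <# U)"
proof -
  have "continuous_map T T (\<lambda>x. inv g \<otimes> x)"
    using assms by (intro continuous_map_mult continuous_map_constI) auto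
  from openin_continuous_map_preimage[OF this assms(1)]
  have "openin T {x \<in> carrier G. inv g \<otimes> x \<in> U}" by (simp add: topspace_eq)
  moreover have "{x \<in> carrier G. inv g \<otimes> x \<in> U} = g <# U"
  proof (rule Set.set_eqI)
    fix x
    show "x \<in> {x \<in> carrier G. inv g \<otimes> x \<in> U} \<longleftrightarrow> x \<in> g <# U"
      using mem_l_coset_iff[of g U x] assms(2) open_subset_carrier[OF assms(1)]
        subsetD[OF l_coset_subset_G[of U g], of x] by auto
  qed
  ultimately show ?thesis by simp
qed

lemma compact_l_coset:
  assumes "compactin T K" "g \<in> carrier G"
  shows "compactin T (g <# K)"
proof -
  have "continuous_map T T (\<lambda>x. g \<otimes> x)"
    using assms by (intro continuous_map_mult continuous_map_constI) auto
  from image_compactin[OF assms(1) this] show ?thesis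
    by (simp add: l_coset_eq_image)
qed

lemma compact_set_mult:
  assumes "compactin T A" "compactin T B"
  shows "compactin T (A <#> B)"
proof -
  have "compactin (prod_topology T T) (A \<times> B)"
    using assms by (simp add: compactin_Times)
  from image_compactin[OF this continuous_mult]
  have "compactin T ((\<lambda>(x, y). x \<otimes> y) ` (A \<times> B))" .
  moreover have "(\<lambda>(x, y). x \<otimes> y) ` (A \<times> B) = A <#> B"
    unfolding set_mult_def by auto
  ultimately show ?thesis by simp
qed

lemma compact_powers:
  assumes "compactin T A"
  shows "compactin T ((\<lambda>x. x [^] (n::nat)) ` A)"
  using image_compactin[OF assms continuous_map_power[of T "\<lambda>x. x"]] by simp

lemma nbhd_div:
  assumes "openin T W" "\<one> \<in> W"
  obtains V where "openin T V" "\<one> \<in> V"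
    "\<And>x y. x \<in> V \<Longrightarrow> y \<in> V \<Longrightarrow> x \<otimes> y \<in> W \<and> x \<otimes> inv y \<in> W"
proof -
  have f: "continuous_map (prod_topology T T) T (\<lambda>z. fst z \<otimes> snd z)"
    using continuous_mult by (simp add: case_prod_unfold)
  have g: "continuous_map (prod_topology T T) T (\<lambda>z. fst z \<otimes> inv (snd z))"
    by (intro continuous_map_mult continuous_map_minv continuous_map_fst continuous_map_snd)
  let ?P = "{z \<in> topspace (prod_topology T T). fst z \<otimes> snd z \<in> W}"
  let ?Q = "{z \<in> topspace (prod_topology T T). fst z \<otimes> inv (snd z) \<in> W}"
  have o: "openin (prod_topology T T) (?P \<inter> ?Q)"
    using openin_continuous_map_preimage[OF f assms(1)]
      openin_continuous_map_preimage[OF g assms(1)] by blast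
  have "(\<one>, \<one>) \<in> ?P \<inter> ?Q" using assms by (auto simp: topspace_eq)
  from iffD1[OF openin_prod_topology_alt o, rule_format, OF this]
  obtain A B where AB: "openin T A" "openin T B" "\<one> \<in> A" "\<one> \<in> B" "A \<times> B \<subseteq> ?P \<inter> ?Q"
    by (elim exE conjE)
  show thesis
  proof (rule that[of "A \<inter> B"])
    show "openin T (A \<inter> B)" "\<one> \<in> A \<inter> B" using AB by auto
  next
    fix x y assume "x \<in> A \<inter> B" "y \<in> A \<inter> B"
    then have "(x, y) \<in> ?P \<inter> ?Q" using AB(5) by blast
    then show "x \<otimes> y \<in> W \<and> x \<otimes> inv y \<in> W" by simp
  qed
qed

lemma open_subgroupI:
  assumes H: "subgroup H G" and V: "openin T V" "\<one> \<in> V" "V \<subseteq> H"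
  shows "openin T H"
proof -
  have "H = (\<Union>h\<in>H. h <# V)"
  proof
    show "H \<subseteq> (\<Union>h\<in>H. h <# V)"
    proof
      fix h assume "h \<in> H"
      then have "h = h \<otimes> \<one>" using subgroup.mem_carrier[OF H] by simp
      then show "h \<in> (\<Union>h\<in>H. h <# V)"
        using V(2) \<open>h \<in> H\<close> unfolding l_coset_def by blast
    qed
    show "(\<Union>h\<in>H. h <# V) \<subseteq> H"
      using V(3) subgroup.m_closed[OF H] by (auto simp: l_coset_def)
  qed
  moreover have "openin T (\<Union>h\<in>H. h <# V)"
    using V(1) open_l_coset subgroup.mem_carrier[OF H] by blast
  ultimately show ?thesis by simp
qed

text \<open>The complement of a subgroup is a union of cosets; this makes open subgroups closed.\<close>

lemma open_subgroup_closed: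
  assumes H: "subgroup H G" and "openin T H"
  shows "closedin T H"
proof -
  have "carrier G - H = (\<Union>g\<in>carrier G - H. g <# H)"
  proof
    show "carrier G - H \<subseteq> (\<Union>g\<in>carrier G - H. g <# H)"
    proof
      fix g assume g: "g \<in> carrier G - H"
      then have "g = g \<otimes> \<one>" by simp
      then show "g \<in> (\<Union>g\<in>carrier G - H. g <# H)"
        using subgroup.one_closed[OF H] g unfolding l_coset_def by blast
    qed
    show "(\<Union>g\<in>carrier G - H. g <# H) \<subseteq> carrier G - H"
    proof clarify
      fix x g assume g: "g \<in> carrier G" "g \<notin> H" "x \<in> g <# H"
      then obtain h where h: "h \<in> H" "x = g \<otimes> h" by (auto simp: l_coset_def)
      have hc: "h \<in> carrier G" using subgroup.mem_carrier[OF H] h by blast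
      have "x \<notin> H"
      proof
        assume "x \<in> H"
        then have "x \<otimes> inv h \<in> H"
          using h H by (simp add: subgroup.m_closed subgroup.m_inv_closed)
        then show False using g h hc by (simp add: m_assoc)
      qed
      then show "x \<in> carrier G - H" using g h hc by simp
    qed
  qed
  moreover have "openin T (\<Union>g\<in>carrier G - H. g <# H)"
    using assms(2) open_l_coset by blast
  ultimately have "openin T (topspace T - H)" by (simp add: topspace_eq)
  then show ?thesis
    using subgroup.subset[OF H] by (simp add: closedin_def topspace_eq)
qed

lemma compact_finite_cover:
  assumes "compactin T K" "openin T V" "\<one> \<in> V"
  obtains F where "finite F" "F \<subseteq> K" "K \<subseteq> F <#> V"
proof -
  have Kc: "K \<subseteq> carrier G" using assms compact_subset_carrier by blast
  have "K \<subseteq> (\<Union>g\<in>K. g <# V)"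
  proof
    fix g assume "g \<in> K"
    then have "g = g \<otimes> \<one>" using Kc by auto
    then show "g \<in> (\<Union>g\<in>K. g <# V)"
      using assms(3) \<open>g \<in> K\<close> unfolding l_coset_def by blast
  qed
  moreover have "\<forall>U\<in>(\<lambda>g. g <# V) ` K. openin T U"
    using assms(2) open_l_coset Kc by blast
  ultimately have "\<exists>\<F>. finite \<F> \<and> \<F> \<subseteq> (\<lambda>g. g <# V) ` K \<and> K \<subseteq> \<Union>\<F>"
    using assms(1) unfolding compactin_def by blast
  then obtain \<F> where \<F>: "finite \<F>" "\<F> \<subseteq> (\<lambda>g. g <# V) ` K" "K \<subseteq> \<Union>\<F>"
    by blast
  then obtain F where F: "F \<subseteq> K" "finite F" "\<F> = (\<lambda>g. g <# V) ` F"
    using finite_subset_image[OF \<F>(1,2)] by blast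
  then have "K \<subseteq> F <#> V" using \<F>(3) by (auto simp: set_mult_def l_coset_def)
  with F that show thesis by blast
qed

end

section \<open>Compact open subgroups of locally compact abelian p-groups\<close>

locale prime_lca_p_group = lca_p_group +
  assumes prime_p: "prime p"
begin

lemma p_gt_1: "1 < p"
  using prime_p prime_gt_1_nat by blast

text \<open>Baire category: some closed set \<open>{x. \<forall>m\<ge>n. x\<^bsup>p^m\<^esup> \<in> C}\<close> has an interior point, and quotients
  of points near it fill a neighbourhood of the identity.\<close>

lemma prime_power_maps_equicontinuous:
  assumes "openin T W" "\<one> \<in> W"
  obtains V n where "openin T V" "\<one> \<in> V" "\<And>m x. m \<ge> n \<Longrightarrow> x \<in> V \<Longrightarrow> x [^] (p ^ m) \<in> W"
proof -
  obtain V0 where V0: "openin T V0" "\<one> \<in> V0"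
    "\<And>x y. x \<in> V0 \<Longrightarrow> y \<in> V0 \<Longrightarrow> x \<otimes> y \<in> W \<and> x \<otimes> inv y \<in> W"
    using nbhd_div assms by metis
  have reg: "regular_space T"
    using locally_compact_Hausdorff_imp_regular_space locally_compact Hausdorff by blast
  then have "neighbourhood_base_of (closedin T) T"
    by (simp add: neighbourhood_base_of_closedin)
  then obtain U C where C: "openin T U" "closedin T C" "\<one> \<in> U" "U \<subseteq> C" "C \<subseteq> V0"
    using V0 unfolding neighbourhood_base_of_def neighbourhood_base_at_def
    by (metis one_closed topspace_eq)
  define E where "E n = (\<Inter>m\<in>{n..}. {x \<in> topspace T. x [^] (p ^ m) \<in> C})" for n :: nat
  have E: "closedin T (E n)" for n
    unfolding E_def
  proof (intro closedin_INT)
    fix m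
    have "continuous_map T T (\<lambda>x. x [^] (p ^ m))"
      using continuous_map_power[of T "\<lambda>x. x"] by simp
    from closedin_continuous_map_preimage[OF this C(2)]
    show "closedin T {x \<in> topspace T. x [^] (p ^ m) \<in> C}" .
  qed auto
  have UE: "\<Union>(range E) = carrier G"
  proof
    show "\<Union>(range E) \<subseteq> carrier G" by (auto simp: E_def topspace_eq)
    show "carrier G \<subseteq> \<Union>(range E)"
    proof
      fix x assume x: "x \<in> carrier G"
      have "eventually (\<lambda>m. x [^] (p ^ m) \<in> U) sequentially"
        using pow_tendsto_one[OF x] C unfolding limitin_def by blast
      then obtain n where "\<forall>m\<ge>n. x [^] (p ^ m) \<in> U"
        unfolding eventually_sequentially by blast
      then have "x \<in> E n" using x C(4) by (auto simp: E_def topspace_eq)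
      then show "x \<in> \<Union>(range E)" by blast
    qed
  qed
  have "\<exists>n. T interior_of (E n) \<noteq> {}"
  proof (rule ccontr)
    assume "\<not> ?thesis"
    then have "T interior_of \<Union>(range E) = {}"
      using E reg locally_compact by (intro Baire_category_alt) auto
    moreover have "T interior_of (carrier G) = carrier G"
      using topspace_eq interior_of_topspace by metis
    ultimately show False unfolding UE using one_closed by blast
  qed
  then obtain n x0 where x0: "x0 \<in> T interior_of (E n)" by blast
  have x0E: "x0 \<in> E n" by (rule subsetD[OF interior_of_subset x0])
  then have x0c: "x0 \<in> carrier G" by (auto simp: E_def topspace_eq)
  show thesis
  proof (rule that[of "inv x0 <# (T interior_of (E n))" n])
    show "openin T (inv x0 <# (T interior_of (E n)))"
      by (intro open_l_coset) (auto simp: x0c)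
    have "\<one> = inv x0 \<otimes> x0" using x0c by simp
    then show "\<one> \<in> inv x0 <# (T interior_of (E n))"
      using x0 unfolding l_coset_def by blast
  next
    fix m x assume m: "m \<ge> n" and "x \<in> inv x0 <# (T interior_of (E n))"
    then obtain y where y': "y \<in> T interior_of (E n)" "x = inv x0 \<otimes> y"
      unfolding l_coset_def by blast
    have y: "y \<in> E n" "x = inv x0 \<otimes> y"
      using subsetD[OF interior_of_subset y'(1)] y'(2) by simp_all
    have yc: "y \<in> carrier G" using y(1) by (auto simp: E_def topspace_eq)
    have "x [^] (p ^ m) = y [^] (p ^ m) \<otimes> inv (x0 [^] (p ^ m))"
      using y x0c yc by (simp add: nat_pow_distrib nat_pow_inv m_comm)
    moreover have "y [^] (p ^ m) \<in> C" "x0 [^] (p ^ m) \<in> C"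
      using m y(1) x0E by (auto simp: E_def)
    ultimately show "x [^] (p ^ m) \<in> W" using V0(3) C(5) by auto
  qed
qed

text \<open>Pointwise convergence of an equicontinuous family is uniform on compact sets.\<close>

lemma prime_powers_uniformly_small:
  assumes "compactin T K" "openin T W" "\<one> \<in> W"
  shows "\<exists>n. \<forall>m\<ge>n. \<forall>x\<in>K. x [^] (p ^ m) \<in> W"
proof -
  obtain W' where W': "openin T W'" "\<one> \<in> W'"
    "\<And>x y. x \<in> W' \<Longrightarrow> y \<in> W' \<Longrightarrow> x \<otimes> y \<in> W \<and> x \<otimes> inv y \<in> W"
    using nbhd_div assms by metis
  obtain V n where V: "openin T V" "\<one> \<in> V"
    "\<And>m x. m \<ge> n \<Longrightarrow> x \<in> V \<Longrightarrow> x [^] (p ^ m) \<in> W'"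
    using prime_power_maps_equicontinuous[OF W'(1,2)] by blast
  obtain F where F: "finite F" "F \<subseteq> K" "K \<subseteq> F <#> V"
    using compact_finite_cover[OF assms(1) V(1,2)] by blast
  have Kc: "K \<subseteq> carrier G" and Vc: "V \<subseteq> carrier G"
    using assms(1) V(1) compact_subset_carrier open_subset_carrier by auto
  have "eventually (\<lambda>m. \<forall>f\<in>F. f [^] (p ^ m) \<in> W') sequentially"
  proof (rule eventually_ball_finite[OF F(1)], rule)
    fix f assume "f \<in> F"
    then have "f \<in> carrier G" using F(2) Kc by blast
    then show "eventually (\<lambda>m. f [^] (p ^ m) \<in> W') sequentially"
      using pow_tendsto_one W' unfolding limitin_def by blast
  qed
  then obtain n' where n': "\<And>m f. m \<ge> n' \<Longrightarrow> f \<in> F \<Longrightarrow> f [^] (p ^ m) \<in> W'"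
    unfolding eventually_sequentially by blast
  show ?thesis
  proof (intro exI allI impI ballI)
    fix m x assume m: "m \<ge> max n n'" and x: "x \<in> K"
    obtain f v where fv: "f \<in> F" "v \<in> V" "x = f \<otimes> v"
      using F(3) x unfolding set_mult_def by blast
    then have "x [^] (p ^ m) = f [^] (p ^ m) \<otimes> v [^] (p ^ m)"
      using F(2) Kc Vc by (auto intro: nat_pow_distrib)
    then show "x [^] (p ^ m) \<in> W"
      using W'(3) n' V(3) fv m by simp
  qed
qed

text \<open>Every element is compact. For \<open>x\<close> close to the identity all powers stay in a given compact
  neighbourhood \<open>K\<close>: writing \<open>k = a + p\<^sup>m b\<close> with \<open>a < p\<^sup>m\<close>, the power \<open>x\<^sup>a\<close> is small by the
  choice of \<open>x\<close>, and \<open>(x\<^sup>b)\<^bsup>p^m\<^esup>\<close> is small because \<open>x\<^sup>b \<in> K\<close> by induction and \<open>p\<^sup>m\<close>-th powers of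
  elements of \<open>K\<close> are uniformly small.  Any element gets close to the identity after taking a
  \<open>p\<^sup>m\<close>-th power, and this changes the cyclic group by finitely many translates.\<close>

lemma nat_powers_in_compact:
  assumes x: "x \<in> carrier G"
  shows "\<exists>C. compactin T C \<and> (\<forall>k::nat. x [^] k \<in> C)"
proof -
  obtain U K where K: "openin T U" "compactin T K" "\<one> \<in> U" "U \<subseteq> K"
    using locally_compact unfolding locally_compact_space_def by (metis one_closed topspace_eq)
  have Kc: "K \<subseteq> carrier G" using K(2) compact_subset_carrier by blast
  obtain V where V: "openin T V" "\<one> \<in> V"
    "\<And>x y. x \<in> V \<Longrightarrow> y \<in> V \<Longrightarrow> x \<otimes> y \<in> U \<and> x \<otimes> inv y \<in> U"
    using nbhd_div K(1,3) by metis
  obtain n where n: "\<forall>m\<ge>n. \<forall>x\<in>K. x [^] (p ^ m) \<in> V"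
    using prime_powers_uniformly_small[OF K(2) V(1,2)] by blast
  \<comment> \<open>\<open>Suc n\<close> makes \<open>q > 1\<close>, so that \<open>k div q < k\<close> in the induction below.\<close>
  define q where "q = p ^ Suc n"
  have q: "q > 1" using p_gt_1 unfolding q_def by (intro one_less_power) auto
  have qV: "y [^] q \<in> V" if "y \<in> K" for y
    using n[rule_format, of "Suc n", OF _ that] unfolding q_def by simp
  define V1 where "V1 = (\<Inter>k\<in>{..<q}. {y \<in> topspace T. y [^] k \<in> V})"
  have "openin T V1"
    unfolding V1_def
  proof (intro openin_INT2)
    fix k :: nat
    have "continuous_map T T (\<lambda>x. x [^] k)"
      using continuous_map_power[of T "\<lambda>x. x" k] by simp
    from openin_continuous_map_preimage[OF this V(1)]
    show "openin T {y \<in> topspace T. y [^] k \<in> V}" .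
  qed (use q in auto)
  moreover have "\<one> \<in> V1" using V(2) by (auto simp: V1_def topspace_eq)
  ultimately have "eventually (\<lambda>m. x [^] (p ^ m) \<in> V1) sequentially"
    using pow_tendsto_one[OF x] unfolding limitin_def by blast
  then obtain M where M: "x [^] (p ^ M) \<in> V1"
    unfolding eventually_sequentially by blast
  have V1K: "y [^] k \<in> K" if y: "y \<in> V1" for y and k :: nat
  proof (induction k rule: less_induct)
    case (less k)
    have yc: "y \<in> carrier G" using y q by (auto simp: V1_def topspace_eq)
    show ?case
    proof (cases "k < q")
      case True
      then have "y [^] k \<in> V" using y by (auto simp: V1_def)
      then have "y [^] k \<otimes> \<one> \<in> U" using V(2,3) by blast
      then show ?thesis using K(4) yc by auto
    next
      case False
      let ?a = "k mod q" and ?b = "k div q"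
      have "?b < k" using q False by (intro div_less_dividend) auto
      then have "(y [^] ?b) [^] q \<in> V" using less qV by blast
      moreover have "y [^] ?a \<in> V" using y q by (auto simp: V1_def)
      moreover have "y [^] k = y [^] ?a \<otimes> (y [^] ?b) [^] q"
        using yc by (simp add: nat_pow_pow nat_pow_mult mult.commute)
      ultimately show ?thesis using V(3) K(4) by auto
    qed
  qed
  have "compactin T (((\<lambda>a. x [^] a) ` {..<p ^ M}) <#> K)"
    using x by (intro compact_set_mult K finite_imp_compactin) (auto simp: topspace_eq)
  moreover have "x [^] k \<in> ((\<lambda>a. x [^] a) ` {..<p ^ M}) <#> K" for k :: nat
  proof -
    have "x [^] k = x [^] (k mod p ^ M) \<otimes> (x [^] (p ^ M)) [^] (k div p ^ M)"
      using x by (simp add: nat_pow_pow nat_pow_mult)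
    moreover have "k mod p ^ M < p ^ M" using p_gt_1 by simp
    ultimately show ?thesis using V1K[OF M] unfolding set_mult_def by blast
  qed
  ultimately show ?thesis by blast
qed

text \<open>In an abelian group the cyclic subgroups of the elements of \<open>F\<close> can be multiplied one after the
  other, and products of relatively compact sets are relatively compact.\<close>

lemma finite_subset_in_compact_subgroup:
  assumes "finite F" "F \<subseteq> carrier G"
  shows "\<exists>C H. compactin T C \<and> subgroup H G \<and> F \<subseteq> H \<and> H \<subseteq> C"
  using assms
proof (induction rule: finite_induct)
  case empty
  have "compactin T {\<one>}" by (simp add: topspace_eq)
  then show ?case using triv_subgroup by blast
next
  case (insert x F)
  then obtain C H where CH: "compactin T C" "subgroup H G" "F \<subseteq> H" "H \<subseteq> C" by auto
  have x: "x \<in> carrier G" using insert by auto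
  obtain D where D: "compactin T D" "\<And>k::nat. x [^] k \<in> D"
    using nat_powers_in_compact[OF x] by blast
  have Dc: "D \<subseteq> carrier G" using D compact_subset_carrier by blast
  define D' where "D' = D \<union> (\<lambda>y. inv y) ` D"
  have D': "compactin T D'"
    unfolding D'_def using D(1) image_compactin[OF D(1) continuous_inv] by (intro compactin_Un)
  have xD': "x [^] k \<in> D'" for k :: int
  proof (cases k)
    case (nonneg n)
    then show ?thesis using D(2) by (simp add: D'_def int_pow_int)
  next
    case (neg n)
    have "x [^] k = inv (x [^] Suc n)"
      unfolding neg int_pow_neg[OF x] int_pow_int ..
    then show ?thesis using D(2)[of "Suc n"] by (simp add: D'_def del: nat_pow_Suc)
  qed
  define Z where "Z = generate G {x}"
  have Z: "Z = range (\<lambda>k::int. x [^] k)"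
    using generate_pow[OF x] unfolding Z_def by auto
  have subg: "subgroup (Z <#> H) G"
    unfolding Z_def by (intro mult_subgroups generate_is_subgroup CH) (simp add: x)
  have "Z \<subseteq> D'" using xD' Z by auto
  then have "Z <#> H \<subseteq> D' <#> C" using CH(4) unfolding set_mult_def by blast
  moreover have "compactin T (D' <#> C)" using compact_set_mult D' CH(1) by blast
  moreover have "insert x F \<subseteq> Z <#> H"
  proof -
    have "x = x [^] (1::int) \<otimes> \<one>" using x by (simp add: int_pow_1)
    then have "x \<in> Z <#> H"
      using subgroup.one_closed[OF CH(2)] unfolding Z set_mult_def by blast
    moreover have "f \<in> Z <#> H" if "f \<in> F" for f
    proof -
      have "f = x [^] (0::int) \<otimes> f" using that insert.prems by auto
      then show ?thesis using that CH(3) unfolding Z set_mult_def by blast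
    qed
    ultimately show ?thesis by auto
  qed
  ultimately show ?case using subg by blast
qed

text \<open>If \<open>K\<close> is a symmetric compact neighbourhood then \<open>K \<cdot> K \<subseteq> F \<cdot> K\<close> for a finite set \<open>F\<close>, so
  \<open>\<langle>F\<rangle> \<cdot> K\<close> is a subgroup.\<close>

lemma ex_compact_open_subgroup:
  "\<exists>L. subgroup L G \<and> compactin T L \<and> openin T L"
proof -
  obtain U K0 where K0: "openin T U" "compactin T K0" "\<one> \<in> U" "U \<subseteq> K0"
    using locally_compact unfolding locally_compact_space_def by (metis one_closed topspace_eq)
  define K where "K = K0 \<union> (\<lambda>y. inv y) ` K0"
  have K: "compactin T K"
    unfolding K_def using K0(2) image_compactin[OF K0(2) continuous_inv] by (intro compactin_Un)
  have Kc: "K \<subseteq> carrier G" using K compact_subset_carrier by blast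
  have K0c: "K0 \<subseteq> carrier G" using K0 compact_subset_carrier by blast
  have UK: "U \<subseteq> K" using K0 K_def by auto
  have Kinv: "inv y \<in> K" if "y \<in> K" for y
    using that K0c by (auto simp: K_def)
  obtain F where F: "finite F" "F \<subseteq> K <#> K" "K <#> K \<subseteq> F <#> U"
    using compact_finite_cover[OF compact_set_mult[OF K K] K0(1,3)] by blast
  have "F \<subseteq> carrier G" using F(2) setmult_subset_G[OF Kc Kc] by blast
  then obtain C H where CH: "compactin T C" "subgroup H G" "F \<subseteq> H" "H \<subseteq> C"
    using finite_subset_in_compact_subgroup F(1) by blast
  have Hc: "H \<subseteq> carrier G" using subgroup.subset CH(2) by blast
  define L where "L = H <#> K"
  have Lc: "L \<subseteq> carrier G" unfolding L_def using setmult_subset_G Hc Kc by blast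
  have KL: "k \<in> L" if "k \<in> K" for k
  proof -
    have "k = \<one> \<otimes> k" using that Kc by auto
    then show ?thesis using that subgroup.one_closed[OF CH(2)]
      unfolding L_def set_mult_def by blast
  qed
  have L: "subgroup L G"
  proof (rule subgroupI[OF Lc])
    show "L \<noteq> {}" using KL UK K0(3) by blast
  next
    fix a assume "a \<in> L"
    then obtain h k where a: "h \<in> H" "k \<in> K" "a = h \<otimes> k" unfolding L_def set_mult_def by blast
    then have "inv a = inv h \<otimes> inv k" using Hc Kc inv_mult by blast
    then show "inv a \<in> L"
      using a Kinv subgroup.m_inv_closed[OF CH(2)] unfolding L_def set_mult_def by blast
  next
    fix a b assume "a \<in> L" "b \<in> L"
    then obtain h k h' k' where ab: "h \<in> H" "k \<in> K" "a = h \<otimes> k" "h' \<in> H" "k' \<in> K" "b = h' \<otimes> k'"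
      unfolding L_def set_mult_def by blast
    have "k \<otimes> k' \<in> F <#> U" using ab F(3) unfolding set_mult_def by blast
    then obtain f u where fu: "f \<in> F" "u \<in> K" "k \<otimes> k' = f \<otimes> u"
      using UK unfolding set_mult_def by blast
    have c: "h \<in> carrier G" "h' \<in> carrier G" "k \<in> carrier G" "k' \<in> carrier G" "f \<in> carrier G"
      "u \<in> carrier G" using ab fu Hc Kc CH(3) by auto
    have "a \<otimes> b = (h \<otimes> h') \<otimes> (k \<otimes> k')" using c ab by (simp add: m_ac)
    also have "\<dots> = (h \<otimes> h' \<otimes> f) \<otimes> u" using c by (simp add: fu(3) m_assoc)
    finally have "a \<otimes> b = (h \<otimes> h' \<otimes> f) \<otimes> u" .
    moreover have "h \<otimes> h' \<otimes> f \<in> H"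
      by (intro subgroup.m_closed[OF CH(2)] ab subsetD[OF CH(3)] fu)
    ultimately show "a \<otimes> b \<in> L"
      unfolding L_def using fu(2) by (intro set_mult_memI)
  qed
  have Lo: "openin T L"
    using open_subgroupI[OF L K0(1,3)] UK KL by blast
  have "L \<subseteq> C <#> K" using CH(4) unfolding L_def set_mult_def by blast
  then have "compactin T L"
    by (rule closed_compactin[OF compact_set_mult[OF CH(1) K] _ open_subgroup_closed[OF L Lo]])
  then show ?thesis using L Lo by blast
qed

end

section \<open>The p-adic absolute value and the completions\<close>

lemma padic_abs_0 [simp]: "padic_abs p 0 = 0"
  by (simp add: padic_abs_def)

context
  fixes p :: nat
  assumes p: "prime p"
begin

lemma prime_elem_int_p: "prime_elem (int p)"
  using p by simp

lemma padic_abs_fraction: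
  assumes "a \<noteq> 0" "b \<noteq> 0"
  shows "padic_abs p (of_int a / of_int b) =
    real p powi (int (multiplicity (int p) b) - int (multiplicity (int p) a))"
proof -
  define q :: rat where "q = of_int a / of_int b"
  obtain n d where nd: "quotient_of q = (n, d)" by force
  have d: "d > 0" using quotient_of_denom_pos[OF nd] .
  have q: "q = of_int n / of_int d" using quotient_of_div[OF nd] .
  have n: "n \<noteq> 0" using q assms by (auto simp: q_def)
  have "of_int (n * b) = (of_int (a * d) :: rat)"
    using q assms d by (simp add: q_def field_simps)
  then have "n * b = a * d" by (simp only: of_int_eq_iff)
  then have "multiplicity (int p) (n * b) = multiplicity (int p) (a * d)" by simp
  then have "multiplicity (int p) n + multiplicity (int p) b =
      multiplicity (int p) a + multiplicity (int p) d"
    using prime_elem_int_p n assms d by (simp add: prime_elem_multiplicity_mult_distrib)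
  moreover have "q \<noteq> 0" using q n d by simp
  ultimately show ?thesis
    using nd unfolding q_def[symmetric] padic_abs_def by (auto intro: arg_cong[of _ _ "(powi) (real p)"])
qed

lemma padic_abs_pos: "q \<noteq> 0 \<Longrightarrow> padic_abs p q > 0"
  using prime_gt_0_nat[OF p] by (auto simp: padic_abs_def intro: zero_less_power_int)

lemma padic_abs_nonneg: "padic_abs p q \<ge> 0"
  using padic_abs_pos[of q] by (cases "q = 0") auto

lemma rat_common_denominator:
  obtains a b d where "d > 0" "(q::rat) = of_int a / of_int d" "(r::rat) = of_int b / of_int d"
proof -
  obtain n d where nd: "quotient_of q = (n, d)" by force
  obtain n' d' where nd': "quotient_of r = (n', d')" by force
  have "d > 0" "d' > 0" "q = of_int n / of_int d" "r = of_int n' / of_int d'"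
    using nd nd' quotient_of_denom_pos quotient_of_div by auto
  then show thesis
    by (intro that[of "d * d'" "n * d'" "n' * d"]) (auto simp: field_simps)
qed

lemma padic_abs_minus: "padic_abs p (- q) = padic_abs p q"
proof (cases "q = 0")
  case False
  obtain a b d where d: "d > 0" "q = of_int a / of_int d" "q = of_int b / (of_int d :: rat)"
    using rat_common_denominator .
  then have "- q = of_int (- a) / of_int d" by simp
  moreover have "a \<noteq> 0" using d False by auto
  ultimately show ?thesis
    using padic_abs_fraction[of a d] padic_abs_fraction[of "- a" d] d
    by simp (metis dvd_minus_iff multiplicity_cong)
qed simp

lemma padic_abs_minus_commute: "padic_abs p (q - r) = padic_abs p (r - q)"
  using padic_abs_minus[of "q - r"] by simp

lemma padic_abs_ultrametric: "padic_abs p (q + r) \<le> max (padic_abs p q) (padic_abs p r)"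
proof (cases "q = 0 \<or> r = 0 \<or> q + r = 0")
  case True
  then show ?thesis using padic_abs_nonneg by (auto simp: le_max_iff_disj)
next
  case False
  obtain a b d where d: "d > 0" "q = of_int a / of_int d" "r = of_int b / (of_int d :: rat)"
    using rat_common_denominator .
  have s: "q + r = of_int (a + b) / of_int d" using d by (simp add: add_divide_distrib)
  have nz: "a \<noteq> 0" "b \<noteq> 0" "a + b \<noteq> 0" "d \<noteq> 0"
    using False d s by auto
  let ?m = "multiplicity (int p)"
  have "int p ^ min (?m a) (?m b) dvd a + b"
    by (intro dvd_add) (meson min.cobounded1 min.cobounded2 multiplicity_dvd')+
  then have "min (?m a) (?m b) \<le> ?m (a + b)"
    using nz prime_elem_int_p by (subst (asm) power_dvd_iff_le_multiplicity) auto
  then have "int (?m d) - int (?m (a + b)) \<le> max (int (?m d) - int (?m a)) (int (?m d) - int (?m b))"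
    by linarith
  then have "real p powi (int (?m d) - int (?m (a + b))) \<le>
      real p powi (max (int (?m d) - int (?m a)) (int (?m d) - int (?m b)))"
    using prime_ge_1_nat[OF p] by (intro power_int_increasing) auto
  then show ?thesis
    using padic_abs_fraction[OF nz(1,4), folded d(2)] padic_abs_fraction[OF nz(2,4), folded d(3)]
      padic_abs_fraction[OF nz(3,4), folded s]
    by (auto simp: max_def split: if_splits)
qed

lemma padic_abs_triangle: "padic_abs p (q + r) \<le> padic_abs p q + padic_abs p r"
  using padic_abs_ultrametric[of q r] padic_abs_nonneg[of q] padic_abs_nonneg[of r] by linarith

lemma padic_abs_divide_p: "padic_abs p (q / of_nat p) = real p * padic_abs p q"
proof (cases "q = 0")
  case False
  obtain a b d where d: "d > 0" "q = of_int a / of_int d" "q = of_int b / (of_int d :: rat)"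
    using rat_common_denominator .
  have p0: "p \<noteq> 0" using prime_gt_0_nat[OF p] by simp
  have "a \<noteq> 0" using d False by auto
  moreover have "q / of_nat p = of_int a / of_int (d * int p)" using d by simp
  moreover have "multiplicity (int p) (d * int p) = multiplicity (int p) d + 1"
    using prime_elem_int_p d p0 by (simp add: prime_elem_multiplicity_mult_distrib)
  ultimately have "padic_abs p (q / of_nat p) =
      real p powi (1 + (int (multiplicity (int p) d) - int (multiplicity (int p) a)))"
    using padic_abs_fraction[of a "d * int p"] d p0 by (simp add: algebra_simps)
  also have "\<dots> = real p * padic_abs p q"
    using padic_abs_fraction[of a d] d \<open>a \<noteq> 0\<close> p0 by (simp add: power_int_add)
  finally show ?thesis .
qed simp

lemma padic_abs_int_le_iff: "padic_abs p (of_int z) \<le> 1 / real p ^ j \<longleftrightarrow> int p ^ j dvd z"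
proof (cases "z = 0")
  case False
  have p1: "real p > 1" using prime_gt_1_nat[OF p] by simp
  have "padic_abs p (of_int z) = real p powi (- int (multiplicity (int p) z))"
    using padic_abs_fraction[of z 1] False by simp
  also have "\<dots> \<le> real p powi (- int j) \<longleftrightarrow> j \<le> multiplicity (int p) z"
    using power_int_increasing[of "- int (multiplicity (int p) z)" "- int j" "real p"]
      power_int_strict_increasing[of "- int j" "- int (multiplicity (int p) z)" "real p"] p1
    by (cases "j \<le> multiplicity (int p) z") auto
  also have "real p powi (- int j) = 1 / real p ^ j"
    by (simp add: power_int_minus field_simps)
  also have "j \<le> multiplicity (int p) z \<longleftrightarrow> int p ^ j dvd z"
    using False prime_elem_int_p by (subst power_dvd_iff_le_multiplicity) auto
  finally show ?thesis .
qed simp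

lemma ex_small_prime_power: "e > 0 \<Longrightarrow> \<exists>j. 1 / real p ^ j < e"
  using real_arch_pow_inv[of e "1 / real p"] prime_gt_1_nat[OF p] by (auto simp: power_divide)

end

text \<open>The completions of \<open>\<int>\<close> and \<open>\<rat>\<close> are treated together; \<open>cls s\<close> is the point represented by the
  Cauchy sequence \<open>s\<close>.\<close>

locale padic_group =
  fixes p :: nat and R :: "rat set"
  assumes p: "prime p"
    and zero_in_R: "0 \<in> R"
    and diff_in_R: "\<And>x y. x \<in> R \<Longrightarrow> y \<in> R \<Longrightarrow> x - y \<in> R"
begin

abbreviation "Cau \<equiv> padic_cauchy_group p R"
abbreviation "Nul \<equiv> padic_null p R"
abbreviation "Com \<equiv> padic_completion p R"

lemma Cau_carrier: "s \<in> carrier Cau \<longleftrightarrow> range s \<subseteq> R \<and>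
   (\<forall>e>0. \<exists>N. \<forall>m\<ge>N. \<forall>n\<ge>N. padic_abs p (s m - s n) < e)"
  by (simp add: padic_cauchy_group_def)

lemma Cau_mult: "s \<otimes>\<^bsub>Cau\<^esub> t = (\<lambda>n. s n + t n)"
  by (simp add: padic_cauchy_group_def)

lemma Cau_one: "\<one>\<^bsub>Cau\<^esub> = (\<lambda>n. 0)"
  by (simp add: padic_cauchy_group_def)

lemma const_in_Cau: "x \<in> R \<Longrightarrow> (\<lambda>n. x) \<in> carrier Cau"
  by (auto simp: Cau_carrier padic_abs_def)

lemma diff_in_Cau:
  assumes "s \<in> carrier Cau" "t \<in> carrier Cau"
  shows "(\<lambda>n. s n - t n) \<in> carrier Cau"
  unfolding Cau_carrier
proof (intro conjI allI impI)
  show "range (\<lambda>n. s n - t n) \<subseteq> R" using assms diff_in_R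
    by (auto simp: Cau_carrier image_subset_iff)
next
  fix e :: real assume "e > 0"
  then obtain N N' where N: "\<forall>m\<ge>N. \<forall>n\<ge>N. padic_abs p (s m - s n) < e"
    "\<forall>m\<ge>N'. \<forall>n\<ge>N'. padic_abs p (t m - t n) < e"
    using assms unfolding Cau_carrier by meson
  have le: "padic_abs p (s m - t m - (s n - t n)) \<le>
      max (padic_abs p (s m - s n)) (padic_abs p (t m - t n))" for m n
    using padic_abs_ultrametric[OF p, of "s m - s n" "t n - t m"] padic_abs_minus_commute[OF p]
    by (simp add: algebra_simps)
  have "padic_abs p (s m - t m - (s n - t n)) < e"
    if "m \<ge> max N N'" "n \<ge> max N N'" for m n
    using that N by (intro le_less_trans[OF le]) auto
  then show "\<exists>N. \<forall>m\<ge>N. \<forall>n\<ge>N. padic_abs p (s m - t m - (s n - t n)) < e" by blast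
qed

lemma Cau_comm_group: "comm_group Cau"
proof (rule comm_groupI)
  fix s t assume st: "s \<in> carrier Cau" "t \<in> carrier Cau"
  have "(\<lambda>n. 0 - t n) \<in> carrier Cau"
    using diff_in_Cau[OF const_in_Cau[OF zero_in_R] st(2)] .
  from diff_in_Cau[OF st(1) this] show "s \<otimes>\<^bsub>Cau\<^esub> t \<in> carrier Cau"
    by (simp add: Cau_mult)
next
  fix s assume s: "s \<in> carrier Cau"
  have "(\<lambda>n. 0 - s n) \<in> carrier Cau"
    using diff_in_Cau[OF const_in_Cau[OF zero_in_R] s] .
  then show "\<exists>t\<in>carrier Cau. t \<otimes>\<^bsub>Cau\<^esub> s = \<one>\<^bsub>Cau\<^esub>"
    by (intro bexI[of _ "\<lambda>n. 0 - s n"]) (simp_all add: Cau_mult Cau_one)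
qed (use const_in_Cau[OF zero_in_R] in \<open>auto simp: Cau_mult Cau_one add_ac\<close>)

lemma Cau_inv:
  assumes "s \<in> carrier Cau"
  shows "inv\<^bsub>Cau\<^esub> s = (\<lambda>n. - s n)"
proof -
  interpret comm_group Cau by (rule Cau_comm_group)
  have "(\<lambda>n. 0 - s n) \<in> carrier Cau"
    using diff_in_Cau[OF const_in_Cau[OF zero_in_R] assms] .
  then show ?thesis
    by (intro inv_equality) (use assms in \<open>auto simp: Cau_mult Cau_one\<close>)
qed

lemma Nul_iff: "s \<in> Nul \<longleftrightarrow> s \<in> carrier Cau \<and> (\<lambda>n. padic_abs p (s n)) \<longlonglongrightarrow> 0"
  by (simp add: padic_null_def)

lemma null_diff:
  assumes "(\<lambda>n. padic_abs p (s n)) \<longlonglongrightarrow> 0" "(\<lambda>n. padic_abs p (t n)) \<longlonglongrightarrow> 0"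
  shows "(\<lambda>n. padic_abs p (s n - t n)) \<longlonglongrightarrow> 0"
proof (rule tendsto_sandwich[of "\<lambda>_. 0" _ _ "\<lambda>n. padic_abs p (s n) + padic_abs p (t n)"])
  show "\<forall>\<^sub>F n in sequentially. padic_abs p (s n - t n) \<le> padic_abs p (s n) + padic_abs p (t n)"
    using padic_abs_triangle[OF p, of "s n" "- t n" for n] padic_abs_minus[OF p] by simp
  show "(\<lambda>n. padic_abs p (s n) + padic_abs p (t n)) \<longlonglongrightarrow> 0"
    using tendsto_add[OF assms] by simp
qed (use padic_abs_nonneg[OF p] in auto)

lemma Nul_subgroup: "subgroup Nul Cau"
proof -
  interpret comm_group Cau by (rule Cau_comm_group)
  have z: "(\<lambda>n. 0) \<in> Nul" using one_closed by (simp add: Nul_iff Cau_one)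
  show ?thesis
  proof (rule subgroupI)
    show "Nul \<noteq> {}" using z by blast
    show "Nul \<subseteq> carrier Cau" by (auto simp: Nul_iff)
    show "inv\<^bsub>Cau\<^esub> s \<in> Nul" if "s \<in> Nul" for s
      using that inv_closed[of s] by (simp add: Nul_iff Cau_inv padic_abs_minus[OF p])
    show "s \<otimes>\<^bsub>Cau\<^esub> t \<in> Nul" if "s \<in> Nul" "t \<in> Nul" for s t
      using that m_closed[of s t] null_diff[of s "\<lambda>n. - t n"]
      by (simp add: Nul_iff Cau_mult padic_abs_minus[OF p])
  qed
qed

lemma Nul_normal: "normal Nul Cau"
  using comm_group.subgroup_imp_normal[OF Cau_comm_group Nul_subgroup] .

lemma Com_comm_group: "comm_group Com"
  unfolding padic_completion_def
  using comm_group.abelian_FactGroup[OF Cau_comm_group Nul_subgroup] .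

definition cls :: "(nat \<Rightarrow> rat) \<Rightarrow> (nat \<Rightarrow> rat) set" where
  "cls s = Nul #>\<^bsub>Cau\<^esub> s"

lemma mem_cls_iff:
  assumes "s \<in> carrier Cau"
  shows "t \<in> cls s \<longleftrightarrow> t \<in> carrier Cau \<and> (\<lambda>n. padic_abs p (t n - s n)) \<longlonglongrightarrow> 0"
proof
  assume "t \<in> cls s"
  then obtain h where h: "h \<in> Nul" "t = (\<lambda>n. h n + s n)"
    by (auto simp: cls_def r_coset_def Cau_mult)
  then have "h \<in> carrier Cau" by (simp add: Nul_iff)
  then have "t \<in> carrier Cau"
    using comm_group.axioms(1)[OF Cau_comm_group] h assms monoid.m_closed[of Cau h s]
    by (simp add: Cau_mult comm_monoid_def)
  then show "t \<in> carrier Cau \<and> (\<lambda>n. padic_abs p (t n - s n)) \<longlonglongrightarrow> 0"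
    using h by (simp add: Nul_iff)
next
  assume t: "t \<in> carrier Cau \<and> (\<lambda>n. padic_abs p (t n - s n)) \<longlonglongrightarrow> 0"
  then have "(\<lambda>n. t n - s n) \<in> Nul" using diff_in_Cau assms by (simp add: Nul_iff)
  then show "t \<in> cls s"
    unfolding cls_def r_coset_def by (force simp: Cau_mult)
qed

lemma mem_cls_self: "s \<in> carrier Cau \<Longrightarrow> s \<in> cls s"
  by (simp add: mem_cls_iff)

lemma carrier_Com: "carrier Com = cls ` carrier Cau"
  by (auto simp: padic_completion_def FactGroup_def RCOSETS_def cls_def)

lemma cls_in_Com: "s \<in> carrier Cau \<Longrightarrow> cls s \<in> carrier Com"
  by (simp add: carrier_Com)

lemma Com_cases:
  assumes "A \<in> carrier Com"
  obtains s where "s \<in> carrier Cau" "A = cls s"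
  using assms carrier_Com by auto

lemma one_Com: "\<one>\<^bsub>Com\<^esub> = cls (\<lambda>n. 0)"
proof -
  interpret comm_group Cau by (rule Cau_comm_group)
  have "Nul #>\<^bsub>Cau\<^esub> \<one>\<^bsub>Cau\<^esub> = Nul"
    using coset_mult_one Nul_subgroup subgroup.subset by blast
  then show ?thesis by (simp add: padic_completion_def cls_def Cau_one)
qed

lemma mult_Com:
  assumes "s \<in> carrier Cau" "t \<in> carrier Cau"
  shows "cls s \<otimes>\<^bsub>Com\<^esub> cls t = cls (\<lambda>n. s n + t n)"
  using normal.rcos_sum[OF Nul_normal assms]
  by (simp add: padic_completion_def cls_def Cau_mult)

lemma cls_eqI:
  assumes "s \<in> carrier Cau" "t \<in> cls s"
  shows "cls t = cls s"
  using comm_group.axioms(2)[OF Cau_comm_group] assms Nul_subgroup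
    group.repr_independence[of Cau t Nul s]
  by (simp add: cls_def)

lemma cls_eq_iff:
  assumes "s \<in> carrier Cau" "t \<in> carrier Cau"
  shows "cls t = cls s \<longleftrightarrow> (\<lambda>n. padic_abs p (t n - s n)) \<longlonglongrightarrow> 0"
  using assms mem_cls_iff[OF assms(1), of t] cls_eqI[OF assms(1), of t] mem_cls_self[OF assms(2)]
  by blast

lemma cls_eventually_eq:
  assumes "s \<in> carrier Cau" "t \<in> carrier Cau" "eventually (\<lambda>n. t n = s n) sequentially"
  shows "cls t = cls s"
  unfolding cls_eq_iff[OF assms(1,2)]
  using assms(3) by (intro tendsto_eventually) (auto elim!: eventually_mono)

lemma mult_nat_in_Cau: "s \<in> carrier Cau \<Longrightarrow> (\<lambda>n. of_nat k * s n) \<in> carrier Cau"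
proof (induction k)
  case 0
  then show ?case using const_in_Cau[OF zero_in_R] by simp
next
  case (Suc k)
  interpret comm_group Cau by (rule Cau_comm_group)
  from Suc m_closed[of s "\<lambda>n. of_nat k * s n"] show ?case
    by (simp add: Cau_mult algebra_simps)
qed

lemma pow_Com:
  assumes "s \<in> carrier Cau"
  shows "cls s [^]\<^bsub>Com\<^esub> (k::nat) = cls (\<lambda>n. of_nat k * s n)"
proof (induction k)
  case 0
  then show ?case by (simp add: one_Com)
next
  case (Suc k)
  then show ?case
    using mult_Com[OF mult_nat_in_Cau[OF assms, of k] assms] by (simp add: algebra_simps)
qed

end

lemma padic_group_int: "prime p \<Longrightarrow> padic_group p \<int>"
  by unfold_locales auto

lemma padic_group_rat: "prime p \<Longrightarrow> padic_group p UNIV"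
  by unfold_locales auto

text \<open>\<open>k\<close> is the residue modulo \<open>p\<close> of a late member of a sequence of integers representing \<open>A\<close>;
  all later members have the same residue.\<close>

lemma Zp_decomposition:
  assumes p: "prime p" and A: "A \<in> carrier (Zp p)"
  shows "\<exists>k<p. \<exists>B\<in>carrier (Zp p).
    A = padic_group.cls p \<int> (\<lambda>n. of_nat k) \<otimes>\<^bsub>Zp p\<^esub> (B [^]\<^bsub>Zp p\<^esub> p)"
proof -
  interpret padic_group p \<int> using padic_group_int[OF p] .
  obtain s where s: "s \<in> carrier Cau" "A = cls s" using A Com_cases by metis
  have p0: "p > 0" using prime_gt_0_nat[OF p] .
  have sZ: "s n \<in> \<int>" for n using s(1) by (auto simp: Cau_carrier)
  obtain N where N: "\<And>m n. m \<ge> N \<Longrightarrow> n \<ge> N \<Longrightarrow> padic_abs p (s m - s n) < 1 / real p ^ 1"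
    using s(1) p0 unfolding Cau_carrier by (metis divide_pos_pos of_nat_0_less_iff power_one_right zero_less_one)
  define k where "k = nat (\<lfloor>s N\<rfloor> mod int p)"
  have k: "int k = \<lfloor>s N\<rfloor> mod int p" using p0 by (simp add: k_def)
  have kp: "k < p" using p0 by (simp add: k_def nat_less_iff)
  have dv: "int p dvd \<lfloor>s n\<rfloor> - int k" if "n \<ge> N" for n
  proof -
    have "padic_abs p (of_int (\<lfloor>s n\<rfloor> - \<lfloor>s N\<rfloor>)) \<le> 1 / real p ^ 1"
      using N[OF that order_refl] sZ by (simp add: less_imp_le)
    then have "int p dvd \<lfloor>s n\<rfloor> - \<lfloor>s N\<rfloor>"
      using padic_abs_int_le_iff[OF p, of "\<lfloor>s n\<rfloor> - \<lfloor>s N\<rfloor>" 1]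
      by (simp only: power_one_right)
    moreover have "int p dvd \<lfloor>s N\<rfloor> - int k" unfolding k by simp
    ultimately have "int p dvd (\<lfloor>s n\<rfloor> - \<lfloor>s N\<rfloor>) + (\<lfloor>s N\<rfloor> - int k)" by (rule dvd_add)
    then show ?thesis by simp
  qed
  define t where "t n = (if n < N then 0 else (s n - of_nat k) / of_nat p)" for n
  have t: "t \<in> carrier Cau"
    unfolding Cau_carrier
  proof (intro conjI allI impI subsetI)
    fix x assume "x \<in> range t"
    then obtain n where x: "x = t n" by blast
    show "x \<in> \<int>"
    proof (cases "n < N")
      case False
      then obtain c where c: "\<lfloor>s n\<rfloor> - int k = int p * c" using dv[of n] by auto
      have "s n - of_nat k = of_int (\<lfloor>s n\<rfloor> - int k)" using sZ[of n] by simp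
      then have "s n - of_nat k = of_nat p * of_int c" unfolding c by simp
      then have "x = of_int c" using False p0 by (simp add: x t_def)
      then show ?thesis by simp
    qed (simp add: x t_def)
  next
    fix e :: real assume "e > 0"
    then have "e / real p > 0" using p0 by simp
    then obtain N' where N': "\<And>m n. m \<ge> N' \<Longrightarrow> n \<ge> N' \<Longrightarrow> padic_abs p (s m - s n) < e / real p"
      using s(1) unfolding Cau_carrier by meson
    have "padic_abs p (t m - t n) < e" if "m \<ge> max N N'" "n \<ge> max N N'" for m n
    proof -
      have "t m - t n = (s m - s n) / of_nat p"
        using that by (simp add: t_def diff_divide_distrib)
      then have "padic_abs p (t m - t n) = real p * padic_abs p (s m - s n)"
        using padic_abs_divide_p[OF p] by simp
      then show ?thesis
        using N'[of m n] that p0 by (simp add: pos_less_divide_eq mult.commute)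
    qed
    then show "\<exists>N. \<forall>m\<ge>N. \<forall>n\<ge>N. padic_abs p (t m - t n) < e" by blast
  qed
  have kc: "(\<lambda>n. of_nat k) \<in> carrier Cau" by (intro const_in_Cau) simp
  have pt: "(\<lambda>n. of_nat p * t n) \<in> carrier Cau" by (rule mult_nat_in_Cau[OF t])
  have "cls s = cls (\<lambda>n. of_nat k + of_nat p * t n)"
  proof (rule cls_eventually_eq)
    show "\<forall>\<^sub>F n in sequentially. s n = of_nat k + of_nat p * t n"
      using eventually_ge_at_top[of N] by eventually_elim (use p0 in \<open>simp add: t_def\<close>)
    show "(\<lambda>n. of_nat k + of_nat p * t n) \<in> carrier Cau"
      using monoid.m_closed[of Cau, OF _ kc pt] Cau_comm_group
      by (simp add: Cau_mult comm_group_def comm_monoid_def)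
  qed (rule s)
  then have "A = cls (\<lambda>n. of_nat k) \<otimes>\<^bsub>Com\<^esub> (cls t [^]\<^bsub>Com\<^esub> p)"
    using s(2) pow_Com[OF t] mult_Com[OF kc pt] by simp
  then show ?thesis using kp cls_in_Com[OF t] by blast
qed

text \<open>A \<open>p\<^sup>j\<close>-th multiple has absolute value at most \<open>p\<^sup>-\<^sup>j\<close>.\<close>

lemma Zp_no_divisible_elements:
  assumes p: "prime p" and A: "A \<in> carrier (Zp p)"
    and div: "\<And>j. \<exists>B\<in>carrier (Zp p). A = B [^]\<^bsub>Zp p\<^esub> (p ^ j)"
  shows "A = \<one>\<^bsub>Zp p\<^esub>"
proof -
  interpret padic_group p \<int> using padic_group_int[OF p] .
  obtain s where s: "s \<in> carrier Cau" "A = cls s" using A Com_cases by metis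
  have "(\<lambda>n. padic_abs p (s n)) \<longlonglongrightarrow> 0"
    unfolding lim_sequentially
  proof (intro allI impI)
    fix e :: real assume "e > 0"
    then obtain j where j: "1 / real p ^ j < e" using ex_small_prime_power[OF p] by blast
    obtain t where t: "t \<in> carrier Cau" "A = cls t [^]\<^bsub>Com\<^esub> (p ^ j)"
      using div[of j] Com_cases by metis
    then have "cls s = cls (\<lambda>n. of_nat (p ^ j) * t n)" using s pow_Com[OF t(1)] by simp
    then have "(\<lambda>n. padic_abs p (s n - of_nat (p ^ j) * t n)) \<longlonglongrightarrow> 0"
      using cls_eq_iff[OF mult_nat_in_Cau[OF t(1), of "p ^ j"] s(1)] by (simp only:)
    then obtain N where N: "\<And>n. n \<ge> N \<Longrightarrow> padic_abs p (s n - of_nat (p ^ j) * t n) < e"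
      using \<open>e > 0\<close> padic_abs_nonneg[OF p] unfolding lim_sequentially dist_real_def
      by (metis abs_of_nonneg diff_zero)
    have "padic_abs p (s n) < e" if "n \<ge> N" for n
    proof -
      have "t n \<in> \<int>" using t(1) by (auto simp: Cau_carrier)
      then obtain z where "t n = of_int z" by (auto elim: Ints_cases)
      then have eq: "of_nat (p ^ j) * t n = of_int (int p ^ j * z)" by simp
      have "padic_abs p (of_nat (p ^ j) * t n) \<le> 1 / real p ^ j"
        unfolding eq padic_abs_int_le_iff[OF p] by simp
      then have "padic_abs p (of_nat (p ^ j) * t n) < e" using j by simp
      then show ?thesis
        using padic_abs_ultrametric[OF p, of "s n - of_nat (p ^ j) * t n" "of_nat (p ^ j) * t n"]
          N[OF that] by simp
    qed
    then show "\<exists>N. \<forall>n\<ge>N. dist (padic_abs p (s n)) 0 < e"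
      using padic_abs_nonneg[OF p] by (auto simp: dist_real_def)
  qed
  then have "cls s = cls (\<lambda>n. 0)"
    using cls_eq_iff[OF const_in_Cau[OF zero_in_R] s(1)] by simp
  then show ?thesis using s one_Com by simp
qed

lemma Qp_divisible:
  assumes p: "prime p" and A: "A \<in> carrier (Qp p)"
  shows "\<exists>B\<in>carrier (Qp p). B [^]\<^bsub>Qp p\<^esub> p = A"
proof -
  interpret padic_group p UNIV using padic_group_rat[OF p] .
  have p0: "p > 0" using prime_gt_0_nat[OF p] .
  obtain s where s: "s \<in> carrier Cau" "A = cls s" using A Com_cases by metis
  have t: "(\<lambda>n. s n / of_nat p) \<in> carrier Cau"
    unfolding Cau_carrier
  proof (intro conjI allI impI)
    fix e :: real assume "e > 0"
    then have "e / real p > 0" using p0 by simp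
    then obtain N where N: "\<And>m n. m \<ge> N \<Longrightarrow> n \<ge> N \<Longrightarrow> padic_abs p (s m - s n) < e / real p"
      using s(1) unfolding Cau_carrier by meson
    have "padic_abs p (s m / of_nat p - s n / of_nat p) < e" if "m \<ge> N" "n \<ge> N" for m n
      using N[OF that] p0 padic_abs_divide_p[OF p, of "s m - s n"]
      by (simp add: field_simps)
    then show "\<exists>N. \<forall>m\<ge>N. \<forall>n\<ge>N. padic_abs p (s m / of_nat p - s n / of_nat p) < e" by blast
  qed simp
  have "cls (\<lambda>n. s n / of_nat p) [^]\<^bsub>Com\<^esub> p = A"
    using pow_Com[OF t] s p0 by simp
  then show ?thesis using cls_in_Com[OF t] by blast
qed

lemma Qp_torsion_free:
  assumes p: "prime p" and A: "A \<in> carrier (Qp p)" and "A [^]\<^bsub>Qp p\<^esub> p = \<one>\<^bsub>Qp p\<^esub>"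
  shows "A = \<one>\<^bsub>Qp p\<^esub>"
proof -
  interpret padic_group p UNIV using padic_group_rat[OF p] .
  have p0: "p > 0" using prime_gt_0_nat[OF p] .
  obtain s where s: "s \<in> carrier Cau" "A = cls s" using A Com_cases by metis
  have "cls (\<lambda>n. of_nat p * s n) = cls (\<lambda>n. 0)"
    using assms(3) s pow_Com[OF s(1)] one_Com by simp
  then have "(\<lambda>n. padic_abs p (of_nat p * s n)) \<longlonglongrightarrow> 0"
    using cls_eq_iff[OF const_in_Cau[OF zero_in_R] mult_nat_in_Cau[OF s(1)]] by simp
  from tendsto_mult_left[OF this, of "real p"]
  have "(\<lambda>n. padic_abs p (s n)) \<longlonglongrightarrow> 0"
    using p0 by (simp flip: padic_abs_divide_p[OF p])
  then have "cls s = cls (\<lambda>n. 0)"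
    using cls_eq_iff[OF const_in_Cau[OF zero_in_R] s(1)] by simp
  then show ?thesis using s one_Com by simp
qed

lemma Qp_nontrivial:
  assumes p: "prime p"
  shows "\<exists>A\<in>carrier (Qp p). A \<noteq> \<one>\<^bsub>Qp p\<^esub>"
proof -
  interpret padic_group p UNIV using padic_group_rat[OF p] .
  have c: "(\<lambda>n. 1) \<in> carrier Cau" by (intro const_in_Cau) simp
  have "padic_abs p 1 > 0" by (rule padic_abs_pos[OF p]) simp
  then have "\<not> (\<lambda>n::nat. padic_abs p 1) \<longlonglongrightarrow> 0" by (simp add: tendsto_const_iff)
  then have "cls (\<lambda>n. 1) \<noteq> cls (\<lambda>n. 0)"
    using cls_eq_iff[OF const_in_Cau[OF zero_in_R] c] by simp
  then show ?thesis using cls_in_Com[OF c] one_Com by auto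
qed

text \<open>The scalar action is defined through the integers \<open>\<lfloor>s n\<rfloor>\<close>; these facts translate the \<open>p\<close>-adic
  metric into divisibility of such integers by powers of \<open>p\<close>.\<close>

lemma Zp_representatives:
  assumes p: "prime p" and a: "a \<in> carrier (Zp p)"
  shows "a \<noteq> {}"
    and "\<And>s j. s \<in> a \<Longrightarrow> \<exists>N. \<forall>m\<ge>N. \<forall>n\<ge>N. int p ^ j dvd \<lfloor>s m\<rfloor> - \<lfloor>s n\<rfloor>"
    and "\<And>s t j. s \<in> a \<Longrightarrow> t \<in> a \<Longrightarrow> \<exists>N. \<forall>n\<ge>N. int p ^ j dvd \<lfloor>s n\<rfloor> - \<lfloor>t n\<rfloor>"
    and "\<And>s. s \<in> a \<Longrightarrow> (\<And>j. \<exists>N. \<forall>n\<ge>N. int p ^ j dvd \<lfloor>s n\<rfloor>) \<Longrightarrow> a = \<one>\<^bsub>Zp p\<^esub>"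
proof -
  interpret padic_group p \<int> using padic_group_int[OF p] .
  have p0: "real p ^ j > 0" for j using prime_gt_0_nat[OF p] by simp
  obtain s0 where s0: "s0 \<in> carrier Cau" "a = cls s0" using a Com_cases by metis
  show "a \<noteq> {}" using s0 mem_cls_self by blast
  have ac: "s \<in> carrier Cau" "s n \<in> \<int>" if "s \<in> a" for s n
    using that s0 by (auto simp: mem_cls_iff Cau_carrier)
  have fl: "padic_abs p (x - y) \<le> 1 / real p ^ j \<longleftrightarrow> int p ^ j dvd \<lfloor>x\<rfloor> - \<lfloor>y\<rfloor>"
    if "x \<in> \<int>" "y \<in> \<int>" for x y j
    using padic_abs_int_le_iff[OF p, of "\<lfloor>x\<rfloor> - \<lfloor>y\<rfloor>" j] that by simp
  show "\<exists>N. \<forall>m\<ge>N. \<forall>n\<ge>N. int p ^ j dvd \<lfloor>s m\<rfloor> - \<lfloor>s n\<rfloor>" if sa: "s \<in> a" for s j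
  proof -
    have "1 / real p ^ j > 0" using p0 by simp
    then obtain N where "\<forall>m\<ge>N. \<forall>n\<ge>N. padic_abs p (s m - s n) < 1 / real p ^ j"
      using ac(1)[OF sa] unfolding Cau_carrier by blast
    then show ?thesis using fl ac(2)[OF sa] less_imp_le by metis
  qed
  show "\<exists>N. \<forall>n\<ge>N. int p ^ j dvd \<lfloor>s n\<rfloor> - \<lfloor>t n\<rfloor>" if st: "s \<in> a" "t \<in> a" for s t j
  proof -
    have "cls t = cls s" using cls_eqI[OF s0(1)] st s0(2) by metis
    then have "(\<lambda>n. padic_abs p (s n - t n)) \<longlonglongrightarrow> 0"
      using cls_eq_iff[OF ac(1)[OF st(2)] ac(1)[OF st(1)]] by simp
    moreover have "1 / real p ^ j > 0" using p0 by simp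
    ultimately have "eventually (\<lambda>n. padic_abs p (s n - t n) < 1 / real p ^ j) sequentially"
      by (rule order_tendstoD)
    then show ?thesis
      unfolding eventually_sequentially using fl ac(2) st less_imp_le by metis
  qed
  show "a = \<one>\<^bsub>Zp p\<^esub>" if s: "s \<in> a" and dv: "\<And>j. \<exists>N. \<forall>n\<ge>N. int p ^ j dvd \<lfloor>s n\<rfloor>" for s
  proof -
    have "(\<lambda>n. padic_abs p (s n)) \<longlonglongrightarrow> 0"
      unfolding lim_sequentially
    proof (intro allI impI)
      fix e :: real assume "e > 0"
      then obtain j where j: "1 / real p ^ j < e" using ex_small_prime_power[OF p] by blast
      obtain N where "\<forall>n\<ge>N. int p ^ j dvd \<lfloor>s n\<rfloor>" using dv by blast
      then have "\<forall>n\<ge>N. padic_abs p (s n) \<le> 1 / real p ^ j"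
        using fl[OF ac(2)[OF s] Ints_0] by simp
      then show "\<exists>N. \<forall>n\<ge>N. dist (padic_abs p (s n)) 0 < e"
        using j padic_abs_nonneg[OF p] by (auto simp: dist_real_def intro: le_less_trans)
    qed
    then have "cls s = cls (\<lambda>n. 0)"
      using cls_eq_iff[OF const_in_Cau[OF zero_in_R] ac(1)[OF s]] by simp
    moreover have "cls s = a" using cls_eqI[OF s0(1)] s s0(2) by metis
    ultimately show ?thesis using one_Com by simp
  qed
qed

section \<open>Powers and finite covers of subsets of an abelian group\<close>

context comm_group
begin

definition pows :: "nat \<Rightarrow> 'a set \<Rightarrow> 'a set" where
  "pows n A = (\<lambda>x. x [^] n) ` A"

text \<open>A substitute for finite index which also makes sense when \<open>A\<close> is not a subgroup containing \<open>H\<close>.\<close>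

definition finitely_covered :: "'a set \<Rightarrow> 'a set \<Rightarrow> bool" where
  "finitely_covered A H \<longleftrightarrow> (\<exists>F. finite F \<and> F \<subseteq> carrier G \<and> A \<subseteq> F <#> H)"

lemma pows_carrier: "A \<subseteq> carrier G \<Longrightarrow> pows n A \<subseteq> carrier G"
  by (auto simp: pows_def)

lemma pows_mono: "A \<subseteq> B \<Longrightarrow> pows n A \<subseteq> pows n B"
  by (auto simp: pows_def)

lemma pows_pows: "A \<subseteq> carrier G \<Longrightarrow> pows m (pows n A) = pows (n * m) A"
  by (force simp: pows_def image_image nat_pow_pow)

lemma pows_1: "A \<subseteq> carrier G \<Longrightarrow> pows (Suc 0) A = A"
  by (force simp: pows_def image_iff)

lemma subgroup_nat_pow_closed: "subgroup H G \<Longrightarrow> x \<in> H \<Longrightarrow> x [^] (n::nat) \<in> H"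
  by (induction n) (auto simp: subgroup.one_closed subgroup.m_closed)

lemma pows_subset: "subgroup H G \<Longrightarrow> pows n H \<subseteq> H"
  by (auto simp: pows_def subgroup_nat_pow_closed)

lemma pows_subgroup:
  assumes H: "subgroup H G"
  shows "subgroup (pows n H) G"
proof (rule subgroupI)
  note c = subgroup.mem_carrier[OF H]
  show "pows n H \<subseteq> carrier G" using c by (auto simp: pows_def)
  show "pows n H \<noteq> {}" using subgroup.one_closed[OF H] by (auto simp: pows_def)
  show "inv x \<in> pows n H" if "x \<in> pows n H" for x
    using that c subgroup.m_inv_closed[OF H] by (force simp: pows_def nat_pow_inv[symmetric])
  show "x \<otimes> y \<in> pows n H" if "x \<in> pows n H" "y \<in> pows n H" for x y
    using that c subgroup.m_closed[OF H] by (force simp: pows_def nat_pow_distrib[symmetric])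
qed

lemma pows_dvd_subset:
  assumes H: "subgroup H G" and "m dvd n"
  shows "pows n H \<subseteq> pows m H"
proof
  fix x assume "x \<in> pows n H"
  then obtain h where h: "h \<in> H" "x = h [^] n" by (auto simp: pows_def)
  obtain k where k: "n = k * m" using assms(2) by (metis dvdE mult.commute)
  have "x = (h [^] k) [^] m"
    using h subgroup.mem_carrier[OF H] by (simp add: k nat_pow_pow)
  then show "x \<in> pows m H"
    using subgroup_nat_pow_closed[OF H h(1), of k] by (auto simp: pows_def)
qed

lemma pows_set_mult:
  assumes "A \<subseteq> carrier G" "B \<subseteq> carrier G"
  shows "pows n (A <#> B) = pows n A <#> pows n B"
proof
  show "pows n (A <#> B) \<subseteq> pows n A <#> pows n B"
  proof
    fix x assume "x \<in> pows n (A <#> B)"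
    then obtain a b where ab: "a \<in> A" "b \<in> B" "x = (a \<otimes> b) [^] n"
      by (auto simp: pows_def set_mult_def)
    then have "x = a [^] n \<otimes> b [^] n" using assms nat_pow_distrib by blast
    then show "x \<in> pows n A <#> pows n B"
      using ab by (intro set_mult_memI[of "a [^] n" _ "b [^] n"]) (auto simp: pows_def)
  qed
  show "pows n A <#> pows n B \<subseteq> pows n (A <#> B)"
  proof
    fix x assume "x \<in> pows n A <#> pows n B"
    then obtain a b where ab: "a \<in> A" "b \<in> B" "x = a [^] n \<otimes> b [^] n"
      by (auto simp: pows_def set_mult_def)
    then have "x = (a \<otimes> b) [^] n" using assms nat_pow_distrib[of a b n] by (auto simp: subset_iff)
    moreover have "a \<otimes> b \<in> A <#> B" using ab by (intro set_mult_memI) auto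
    ultimately show "x \<in> pows n (A <#> B)" by (auto simp: pows_def)
  qed
qed

lemma finitely_coveredI: "finite F \<Longrightarrow> F \<subseteq> carrier G \<Longrightarrow> A \<subseteq> F <#> H \<Longrightarrow> finitely_covered A H"
  by (auto simp: finitely_covered_def)

lemma finitely_coveredE:
  assumes "finitely_covered A H"
  obtains F where "finite F" "F \<subseteq> carrier G" "A \<subseteq> F <#> H"
  using assms by (auto simp: finitely_covered_def)

lemma set_mult_mono: "A \<subseteq> A' \<Longrightarrow> B \<subseteq> B' \<Longrightarrow> A <#> B \<subseteq> A' <#> B'"
  unfolding set_mult_def by blast

lemma subset_one_mult: "A \<subseteq> carrier G \<Longrightarrow> A \<subseteq> {\<one>} <#> A"
  by (auto simp: set_mult_def subset_iff)

lemma finite_set_mult: "finite A \<Longrightarrow> finite B \<Longrightarrow> finite (A <#> B)"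
  by (auto simp: set_mult_def)

lemma finitely_covered_subset:
  "A \<subseteq> carrier G \<Longrightarrow> A \<subseteq> H \<Longrightarrow> finitely_covered A H"
  using subset_one_mult[of A] set_mult_mono[of "{\<one>}" "{\<one>}" A H]
  by (intro finitely_coveredI[of "{\<one>}"]) auto

lemma finitely_covered_trans:
  assumes "finitely_covered A B" "finitely_covered B C" "B \<subseteq> carrier G" "C \<subseteq> carrier G"
  shows "finitely_covered A C"
proof -
  obtain E where E: "finite E" "E \<subseteq> carrier G" "A \<subseteq> E <#> B"
    using assms(1) finitely_coveredE by blast
  obtain F where F: "finite F" "F \<subseteq> carrier G" "B \<subseteq> F <#> C"
    using assms(2) finitely_coveredE by blast
  have "A \<subseteq> E <#> (F <#> C)" using E(3) set_mult_mono[OF order_refl F(3)] by blast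
  also have "E <#> (F <#> C) = (E <#> F) <#> C"
    using E F assms by (simp add: set_mult_assoc)
  finally show ?thesis
    using E F by (intro finitely_coveredI[of "E <#> F"] finite_set_mult setmult_subset_G)
qed

lemma finitely_covered_pows:
  assumes "finitely_covered A H" "H \<subseteq> carrier G"
  shows "finitely_covered (pows n A) (pows n H)"
proof -
  obtain F where F: "finite F" "F \<subseteq> carrier G" "A \<subseteq> F <#> H"
    using assms(1) finitely_coveredE by blast
  have "pows n A \<subseteq> pows n F <#> pows n H"
    using pows_mono[OF F(3)] pows_set_mult F assms by auto
  then show ?thesis
    using F pows_carrier by (intro finitely_coveredI[of "pows n F"]) (auto simp: pows_def)
qed

text \<open>Two elements of \<open>S\<close> whose \<open>q\<close>-th powers lie in the same translate of \<open>N\<^sup>q\<close> differ by an element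
  of \<open>N\<close> and one of the finite kernel.  So one representative in \<open>S\<close> for each translate, multiplied by
  the kernel, gives a cover.\<close>

lemma finitely_covered_power_preimage:
  assumes S: "S \<subseteq> carrier G" and N: "subgroup N G"
    and tor: "finite {t \<in> carrier G. t [^] (q::nat) = \<one>}"
    and cov: "finitely_covered (pows q S) (pows q N)"
  shows "finitely_covered S N"
proof -
  note Nc = subgroup.mem_carrier[OF N]
  obtain F where F: "finite F" "F \<subseteq> carrier G" "pows q S \<subseteq> F <#> pows q N"
    using cov finitely_coveredE by blast
  define P where "P f a \<longleftrightarrow> a \<in> S \<and> (\<exists>n\<in>N. a [^] q = f \<otimes> n [^] q)" for f a
  define r where "r f = (SOME a. P f a)" for f
  let ?E = "{r f |f. f \<in> F \<and> (\<exists>a. P f a)}"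
  let ?T = "{t \<in> carrier G. t [^] q = \<one>}"
  have r: "P f (r f)" if "\<exists>a. P f a" for f
    unfolding r_def using someI_ex[OF that] .
  have Ec: "?E \<subseteq> carrier G" using r S unfolding P_def by blast
  show ?thesis
  proof (rule finitely_coveredI)
    show "finite (?E <#> ?T)" using F(1) tor by (intro finite_set_mult) auto
    show "?E <#> ?T \<subseteq> carrier G" using Ec by (intro setmult_subset_G) auto
    show "S \<subseteq> ?E <#> ?T <#> N"
    proof
      fix x assume x: "x \<in> S"
      then have xc: "x \<in> carrier G" using S by auto
      have "x [^] q \<in> F <#> pows q N" using F(3) x by (auto simp: pows_def)
      then obtain f n where fn: "f \<in> F" "n \<in> N" "x [^] q = f \<otimes> n [^] q"
        by (auto simp: set_mult_def pows_def)
      then have P: "P f x" using x by (auto simp: P_def)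
      then have "P f (r f)" using r by blast
      then obtain m where m: "r f \<in> S" "m \<in> N" "r f [^] q = f \<otimes> m [^] q" by (auto simp: P_def)
      have c: "r f \<in> carrier G" "m \<in> carrier G" "n \<in> carrier G" "f \<in> carrier G"
        using m fn S Nc F(2) by auto
      define t where "t = x \<otimes> inv (r f) \<otimes> (m \<otimes> inv n)"
      have "t [^] q = x [^] q \<otimes> inv (r f [^] q) \<otimes> (m [^] q \<otimes> inv (n [^] q))"
        unfolding t_def using c xc by (simp add: nat_pow_distrib nat_pow_inv)
      also have "\<dots> = \<one>"
      proof -
        have "f \<otimes> n [^] q \<otimes> inv (f \<otimes> m [^] q) \<otimes> (m [^] q \<otimes> inv (n [^] q)) =
            (f \<otimes> inv f) \<otimes> (m [^] q \<otimes> inv (m [^] q)) \<otimes> (n [^] q \<otimes> inv (n [^] q))"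
          using c by (simp add: inv_mult m_ac del: r_inv l_inv Units_r_inv Units_l_inv)
        then show ?thesis unfolding fn(3) m(3) using c by simp
      qed
      finally have "t \<in> ?T" using c xc by (simp add: t_def)
      moreover have "r f \<in> ?E" using P fn(1) by blast
      moreover have "n \<otimes> inv m \<in> N"
        by (intro subgroup.m_closed[OF N] subgroup.m_inv_closed[OF N] m fn)
      moreover have "x = r f \<otimes> t \<otimes> (n \<otimes> inv m)"
      proof -
        have "r f \<otimes> t \<otimes> (n \<otimes> inv m) = (r f \<otimes> inv (r f)) \<otimes> (m \<otimes> inv m) \<otimes> (n \<otimes> inv n) \<otimes> x"
          unfolding t_def using c xc by (simp add: m_ac del: r_inv l_inv Units_r_inv Units_l_inv)
        then show ?thesis using c xc by simp
      qed
      ultimately show "x \<in> ?E <#> ?T <#> N" by (intro set_mult_memI) auto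
    qed
  qed
qed

lemma finite_torsion_power:
  assumes "finite {t \<in> carrier G. t [^] (p::nat) = \<one>}"
  shows "finite {t \<in> carrier G. t [^] (p ^ n) = \<one>}"
proof (induction n)
  case 0
  have "{t \<in> carrier G. t [^] (p ^ 0) = \<one>} = {\<one>}" by auto
  then show ?case by simp
next
  case (Suc n)
  let ?T = "\<lambda>n. {t \<in> carrier G. t [^] (p ^ n) = \<one>}"
  have "pows p (?T (Suc n)) \<subseteq> ?T n" by (auto simp: pows_def nat_pow_pow mult.commute)
  moreover have "pows p {\<one>} = {\<one>}" by (simp add: pows_def)
  ultimately have "pows p (?T (Suc n)) \<subseteq> ?T n <#> pows p {\<one>}"
    by (auto simp: set_mult_def)
  then have cov: "finitely_covered (pows p (?T (Suc n))) (pows p {\<one>})"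
    using Suc by (intro finitely_coveredI[of "?T n"]) simp_all
  have "finitely_covered (?T (Suc n)) {\<one>}"
    by (rule finitely_covered_power_preimage[OF _ triv_subgroup assms cov]) blast
  then obtain F where F: "finite F" "?T (Suc n) \<subseteq> F <#> {\<one>}"
    by (rule finitely_coveredE)
  show ?case by (rule finite_subset[OF F(2) finite_set_mult[OF F(1)]]) simp
qed

section \<open>Independence modulo a subgroup\<close>

text \<open>For a subgroup \<open>N\<close> containing the \<open>p\<close>-th powers of the elements of \<open>S\<close> this is linear
  independence over \<open>\<int>/p\<int>\<close> of the cosets of \<open>N\<close>.\<close>

definition independent_modulo :: "nat \<Rightarrow> 'a set \<Rightarrow> 'a set \<Rightarrow> bool" where
  "independent_modulo p N S \<longleftrightarrow>
     (\<forall>A e. finite A \<and> A \<subseteq> S \<and> (\<Otimes>x\<in>A. x [^] (e x :: int)) \<in> N \<longrightarrow> (\<forall>x\<in>A. int p dvd e x))"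

lemma finprod_in_subgroup:
  assumes H: "subgroup H G" and "finite A" "\<And>x. x \<in> A \<Longrightarrow> f x \<in> H"
  shows "(\<Otimes>x\<in>A. f x) \<in> H"
  using assms(2,3)
proof (induction rule: finite_induct)
  case empty
  then show ?case using subgroup.one_closed[OF H] by simp
next
  case (insert a A)
  have "f \<in> A \<rightarrow> carrier G" "f a \<in> carrier G"
    using insert subgroup.mem_carrier[OF H] by auto
  then show ?case using insert subgroup.m_closed[OF H] by simp
qed

lemma finprod_pow:
  assumes "finite A" "\<And>x. x \<in> A \<Longrightarrow> f x \<in> carrier G"
  shows "(\<Otimes>x\<in>A. f x) [^] (n::nat) = (\<Otimes>x\<in>A. f x [^] n)"
  using assms
proof (induction rule: finite_induct)
  case (insert a A)
  have "f \<in> A \<rightarrow> carrier G" "f a \<in> carrier G" "(\<lambda>x. f x [^] n) \<in> A \<rightarrow> carrier G"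
    using insert by auto
  then show ?case using insert by (simp add: nat_pow_distrib)
qed simp

text \<open>An element outside a subgroup \<open>H \<supseteq> N\<close> is independent of \<open>H\<close> modulo \<open>N\<close>, and adjoining it to
  \<open>H\<close> multiplies the index over \<open>N\<close> by \<open>p\<close> at most.  So the greedy choice only stops at a
  subgroup which is finite modulo \<open>N\<close>.\<close>

lemma ex_large_independent_set:
  fixes p :: nat
  assumes p: "prime p" and M: "subgroup M G" and N: "subgroup N G" and NM: "N \<subseteq> M"
    and pM: "\<forall>x\<in>M. x [^] p \<in> N" and inf: "\<not> finitely_covered M N"
  shows "\<exists>S. finite S \<and> S \<subseteq> M \<and> card S = m \<and> independent_modulo p N S"
proof -
  have Mc: "M \<subseteq> carrier G" using subgroup.subset[OF M] .
  have "\<exists>S H. finite S \<and> S \<subseteq> H \<and> card S = m \<and> independent_modulo p N S \<and>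
      subgroup H G \<and> N \<subseteq> H \<and> H \<subseteq> M \<and> finitely_covered H N"
  proof (induction m)
    case 0
    have "independent_modulo p N {}" by (auto simp: independent_modulo_def)
    moreover have "finitely_covered N N" using NM Mc by (intro finitely_covered_subset) auto
    ultimately show ?case using N NM by (intro exI[of _ "{}"] exI[of _ N]) auto
  next
    case (Suc m)
    then obtain S H where S: "finite S" "S \<subseteq> H" "card S = m" "independent_modulo p N S"
      and H: "subgroup H G" "N \<subseteq> H" "H \<subseteq> M" "finitely_covered H N" by blast
    have "\<not> M \<subseteq> H" using inf H by auto
    then obtain y where y: "y \<in> M" "y \<notin> H" by blast
    have yc: "y \<in> carrier G" using y Mc by auto
    have Hc: "H \<subseteq> carrier G" using H Mc by auto
    have ypH: "y [^] p \<in> H" using bspec[OF pM y(1)] H by auto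
    define H' where "H' = generate G {y} <#> H"
    have H': "subgroup H' G"
      unfolding H'_def by (intro mult_subgroups generate_is_subgroup H) (simp add: yc)
    have gen: "generate G {y} = range (\<lambda>k::int. y [^] k)" using generate_pow[OF yc] by auto
    have HH': "H \<subseteq> H'"
    proof
      fix h assume h: "h \<in> H"
      have "\<one> \<in> generate G {y}" by (rule generate.one)
      moreover have "h = \<one> \<otimes> h" using h Hc by auto
      ultimately show "h \<in> H'" unfolding H'_def using h by (intro set_mult_memI)
    qed
    have yH': "y \<in> H'"
      unfolding H'_def using yc subgroup.one_closed[OF H(1)]
      by (intro set_mult_memI[of y _ \<one>]) (auto intro: generate.incl)
    have "generate G {y} \<subseteq> M"
      using generate_subgroup_incl[OF _ M] y(1) by simp
    then have H'M: "H' \<subseteq> M"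
      unfolding H'_def set_mult_def using H(3) subgroup.m_closed[OF M] by blast
    have "H' \<subseteq> ((\<lambda>k. y [^] k) ` {..<p}) <#> H"
    proof
      fix x assume "x \<in> H'"
      then obtain k h where kh: "h \<in> H" "x = y [^] (k::int) \<otimes> h"
        unfolding H'_def set_mult_def gen by blast
      have p0: "int p > 0" using prime_gt_0_nat[OF p] by simp
      define a where "a = nat (k mod int p)"
      have a: "int a = k mod int p" using p0 by (simp add: a_def)
      have "y [^] k = y [^] (int a + int p * (k div int p))" unfolding a by simp
      also have "\<dots> = y [^] a \<otimes> (y [^] p) [^] (k div int p)"
        using yc by (simp add: int_pow_mult int_pow_pow[symmetric] int_pow_int)
      finally have "x = y [^] a \<otimes> ((y [^] p) [^] (k div int p) \<otimes> h)"
        using kh yc Hc by (auto simp: m_assoc)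
      moreover have "(y [^] p) [^] (k div int p) \<otimes> h \<in> H"
        using subgroup.m_closed[OF H(1)] subgroup_int_pow_closed[OF H(1) ypH] kh(1) by blast
      moreover have "a < p" using p0 a by (metis of_nat_less_iff pos_mod_bound)
      ultimately show "x \<in> ((\<lambda>k. y [^] k) ` {..<p}) <#> H"
        by (intro set_mult_memI) auto
    qed
    then have "finitely_covered H' H"
      using yc by (intro finitely_coveredI) auto
    then have cov: "finitely_covered H' N"
      using finitely_covered_trans H(4) Hc NM Mc by blast
    have "independent_modulo p N (insert y S)"
      unfolding independent_modulo_def
    proof (intro allI impI, elim conjE)
      fix A and e :: "'a \<Rightarrow> int"
      assume A: "finite A" "A \<subseteq> insert y S" "(\<Otimes>x\<in>A. x [^] e x) \<in> N"
      show "\<forall>x\<in>A. int p dvd e x"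
      proof (cases "y \<in> A")
        case False
        then have "A \<subseteq> S" using A by blast
        then show ?thesis using S(4) A unfolding independent_modulo_def by blast
      next
        case True
        define B where "B = A - {y}"
        have B: "finite B" "B \<subseteq> S" "y \<notin> B" "A = insert y B" using A True by (auto simp: B_def)
        have BH: "x [^] e x \<in> H" if "x \<in> B" for x
          using that B S(2) subgroup_int_pow_closed[OF H(1)] by blast
        have prodB: "(\<Otimes>x\<in>B. x [^] e x) \<in> H" by (intro finprod_in_subgroup H B BH)
        then have Pc: "(\<Otimes>x\<in>B. x [^] e x) \<in> carrier G" using Hc by blast
        have "(\<lambda>x. x [^] e x) \<in> B \<rightarrow> carrier G" using BH Hc by auto
        then have eq: "(\<Otimes>x\<in>A. x [^] e x) = y [^] e y \<otimes> (\<Otimes>x\<in>B. x [^] e x)"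
          unfolding B(4) using B yc by simp
        have "y [^] e y = (\<Otimes>x\<in>A. x [^] e x) \<otimes> inv (\<Otimes>x\<in>B. x [^] e x)"
          unfolding eq using Pc yc by (simp add: m_assoc)
        then have yeH: "y [^] e y \<in> H"
          using A(3) H(2) prodB subgroup.m_closed[OF H(1)] subgroup.m_inv_closed[OF H(1)] by auto
        have py: "int p dvd e y"
        proof (rule ccontr)
          assume "\<not> int p dvd e y"
          then have "coprime (int p) (e y)" using p by (simp add: prime_imp_coprime)
          then obtain u v where uv: "u * int p + v * e y = 1"
            using bezout_int[of "int p" "e y"] by auto
          have "y = y [^] (int p * u + e y * v)" using uv yc by (simp add: mult.commute int_pow_1)
          also have "\<dots> = (y [^] p) [^] u \<otimes> (y [^] e y) [^] v"
            using yc by (simp add: int_pow_mult int_pow_pow[symmetric] int_pow_int)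
          also have "\<dots> \<in> H"
            by (intro subgroup.m_closed[OF H(1)] subgroup_int_pow_closed[OF H(1)] ypH yeH)
          finally show False using y by simp
        qed
        then obtain c where c: "e y = int p * c" by auto
        have "y [^] e y = (y [^] p) [^] c"
          unfolding c using yc by (simp add: int_pow_pow[symmetric] int_pow_int)
        then have "y [^] e y \<in> N" using subgroup_int_pow_closed[OF N bspec[OF pM y(1)]] by simp
        moreover have "(\<Otimes>x\<in>B. x [^] e x) = inv (y [^] e y) \<otimes> (\<Otimes>x\<in>A. x [^] e x)"
          unfolding eq using Pc yc by (simp add: m_assoc[symmetric])
        ultimately have "(\<Otimes>x\<in>B. x [^] e x) \<in> N"
          using A(3) subgroup.m_closed[OF N] subgroup.m_inv_closed[OF N] by auto
        then have "\<forall>x\<in>B. int p dvd e x" using S(4) B unfolding independent_modulo_def by blast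
        then show ?thesis using py B(4) by blast
      qed
    qed
    moreover have "card (insert y S) = Suc m"
      using S y by (metis card_insert_disjoint subsetD)
    moreover have "insert y S \<subseteq> H'" using S(2) HH' yH' by auto
    ultimately show ?case
      using S(1) H' H(2) HH' H'M cov by (intro exI[of _ "insert y S"] exI[of _ H']) auto
  qed
  then show ?thesis by blast
qed

end

section \<open>Finite rank: the powers of a compact open subgroup form a neighbourhood base\<close>

lemma rank_over_infinite:
  assumes "\<And>m. \<exists>S. finite S \<and> S \<subseteq> V \<and> card S = m \<and> independent_over G K z act S"
  shows "rank_over G K z act V = \<infinity>"
proof (rule ccontr)
  assume "rank_over G K z act V \<noteq> \<infinity>"
  then obtain k where k: "rank_over G K z act V = enat k" by auto
  obtain S where "finite S" "S \<subseteq> V" "card S = Suc k" "independent_over G K z act S"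
    using assms[of "Suc k"] by blast
  then have "enat (Suc k) \<le> rank_over G K z act V"
    unfolding rank_over_def by (intro SUP_upper2[of S]) auto
  then show False using k by simp
qed

lemma (in comm_group) independent_moduloD:
  assumes "independent_modulo p N S" "finite A" "A \<subseteq> S" "(\<Otimes>x\<in>A. x [^] (e x :: int)) \<in> N" "x \<in> A"
  shows "int p dvd e x"
  using assms unfolding independent_modulo_def by blast

context prime_lca_p_group
begin

lemma compact_closed: "compactin T K \<Longrightarrow> closedin T K"
  using compactin_imp_closedin Hausdorff by blast

lemma compact_pows: "compactin T K \<Longrightarrow> compactin T (pows n K)"
  unfolding pows_def by (rule compact_powers)

lemma prime_pows_small:
  assumes "compactin T K" "openin T W" "\<one> \<in> W"
  shows "\<exists>n. \<forall>m\<ge>n. pows (p ^ m) K \<subseteq> W"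
  using prime_powers_uniformly_small[OF assms] by (auto simp: pows_def)

text \<open>The elements of order \<open>p\<close> form a vector space over \<open>\<int>/p\<int>\<close> whose dimension is \<open>r_p\<close>.\<close>

lemma finite_p_torsion:
  assumes "r_p p G < \<infinity>"
  shows "finite {x \<in> carrier G. x [^] p = \<one>}"
proof (rule ccontr)
  let ?M = "{x \<in> carrier G. x [^] p = \<one>}"
  assume inf: "\<not> finite ?M"
  have M: "subgroup ?M G"
    by (rule subgroupI) (auto simp: nat_pow_inv nat_pow_distrib intro: one_closed)
  have nc: "\<not> finitely_covered ?M {\<one>}"
  proof
    assume "finitely_covered ?M {\<one>}"
    then obtain F where F: "finite F" "?M \<subseteq> F <#> {\<one>}" by (rule finitely_coveredE)
    have "finite ?M" by (rule finite_subset[OF F(2) finite_set_mult[OF F(1)]]) simp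
    then show False using inf by simp
  qed
  have "r_p p G = \<infinity>"
    unfolding r_p_def
  proof (rule rank_over_infinite)
    fix m
    have 1: "{\<one>} \<subseteq> ?M" by simp
    have 2: "\<forall>x\<in>?M. x [^] p \<in> {\<one>}" by simp
    from ex_large_independent_set[OF prime_p M triv_subgroup 1 2 nc, of m]
    obtain S where S: "finite S" "S \<subseteq> ?M" "card S = m" "independent_modulo p {\<one>} S"
      by (elim exE conjE)
    have "independent_over G {0..<p} 0 (\<lambda>k x. x [^] k) S"
      unfolding independent_over_def
    proof (intro allI impI ballI, elim conjE)
      fix A and c :: "'a \<Rightarrow> nat" and x
      assume A: "x \<in> A" "finite A" "A \<subseteq> S" "c \<in> A \<rightarrow> {0..<p}" "(\<Otimes>x\<in>A. x [^] c x) = \<one>"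
      then have "(\<Otimes>x\<in>A. x [^] int (c x)) \<in> {\<one>}" by (simp add: int_pow_int)
      then have "int p dvd int (c x)"
        by (rule independent_moduloD[OF S(4) A(2,3) _ A(1), of "\<lambda>x. int (c x)"])
      then have "p dvd c x" by simp
      moreover have "c x < p" using A(1,4) by auto
      ultimately show "c x = 0" using nat_dvd_not_less by blast
    qed
    then show "\<exists>S. finite S \<and> S \<subseteq> ?M \<and> card S = m \<and> independent_over G {0..<p} 0 (\<lambda>k x. x [^] k) S"
      using S by blast
  qed
  then show False using assms by simp
qed

text \<open>For \<open>x\<close> in a compact subgroup \<open>U\<close>, the powers of \<open>x\<close> along integers converging \<open>p\<close>-adically
  to \<open>a\<close> converge, by compactness and because the subgroups \<open>U\<^bsup>p^j\<^esup>\<close> shrink to the identity; so the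
  scalar action is given by genuine limits.\<close>

lemma Zp_action_approximation:
  assumes U: "subgroup U G" "compactin T U" and x: "x \<in> U"
    and a: "a \<in> carrier (Zp p)" and s: "s \<in> a"
  shows "Zp_action G T a x \<in> U"
    and "\<exists>N. \<forall>n\<ge>N. \<exists>u\<in>pows (p ^ j) U. x [^] \<lfloor>s n\<rfloor> = Zp_action G T a x \<otimes> u"
proof -
  have Uc: "U \<subseteq> carrier G" using subgroup.subset[OF U(1)] .
  have xc: "x \<in> carrier G" using x Uc by auto
  let ?U = "\<lambda>j. pows (p ^ j) U"
  have sub: "subgroup (?U j) G" for j using pows_subgroup[OF U(1)] .
  have Ujc: "?U j \<subseteq> carrier G" for j using subgroup.subset[OF sub] .
  have shift: "\<exists>u\<in>?U j. x [^] k = x [^] l \<otimes> u" if dv: "int p ^ j dvd k - l" for j and k l :: int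
  proof -
    obtain c0 where "k - l = int p ^ j * c0" using dv by (rule dvdE)
    then obtain c where c: "k = l + c * int (p ^ j)"
      by (metis add.commute diff_add_cancel mult.commute of_nat_power)
    have "x [^] k = x [^] l \<otimes> (x [^] c) [^] (p ^ j)"
      unfolding c using xc by (simp add: int_pow_mult int_pow_pow[symmetric] int_pow_int del: of_nat_power)
    moreover have "x [^] c \<in> U" using subgroup_int_pow_closed[OF U(1) x] .
    ultimately show ?thesis by (auto simp: pows_def)
  qed
  define Q where "Q y t \<longleftrightarrow> (\<forall>j. \<exists>N. \<forall>n\<ge>N. \<exists>u\<in>?U j. x [^] \<lfloor>t n\<rfloor> = y \<otimes> u)"
    for y and t :: "nat \<Rightarrow> rat"
  have "\<forall>j. \<exists>N. \<forall>m\<ge>N. \<forall>n\<ge>N. int p ^ j dvd \<lfloor>s m\<rfloor> - \<lfloor>s n\<rfloor>"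
    using Zp_representatives(2)[OF prime_p a s] by blast
  then obtain N where N: "\<And>j m n. m \<ge> N j \<Longrightarrow> n \<ge> N j \<Longrightarrow> int p ^ j dvd \<lfloor>s m\<rfloor> - \<lfloor>s n\<rfloor>"
    by metis
  define C where "C j = x [^] \<lfloor>s (N j)\<rfloor> <# ?U j" for j
  have inC: "x [^] \<lfloor>s n\<rfloor> \<in> C j" if "n \<ge> N j" for n j
    using shift[OF N[OF that order_refl]] unfolding C_def l_coset_def by auto
  have clC: "closedin T (C j)" for j
    unfolding C_def using xc by (intro compact_closed compact_l_coset compact_pows U) auto
  have "U \<inter> \<Inter>(range C) \<noteq> {}"
  proof -
    have "\<forall>\<F>. finite \<F> \<and> \<F> \<subseteq> range C \<longrightarrow> U \<inter> \<Inter>\<F> \<noteq> {}"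
    proof (intro allI impI, elim conjE)
      fix \<F> assume "finite \<F>" "\<F> \<subseteq> range C"
      then obtain J where J: "finite J" "\<F> = C ` J" using finite_subset_image[of \<F> C UNIV] by auto
      let ?n = "Max (insert 0 (N ` J))"
      have "x [^] \<lfloor>s ?n\<rfloor> \<in> C j" if "j \<in> J" for j
        using that J(1) by (intro inC Max_ge) auto
      moreover have "x [^] \<lfloor>s ?n\<rfloor> \<in> U" using subgroup_int_pow_closed[OF U(1) x] .
      ultimately show "U \<inter> \<Inter>\<F> \<noteq> {}" unfolding J(2) by blast
    qed
    moreover have "\<forall>K\<in>range C. closedin T K" using clC by blast
    ultimately show ?thesis using U(2) unfolding compactin_fip by blast
  qed
  then obtain y where y: "y \<in> U" "\<And>j. y \<in> C j" by blast
  have yc: "y \<in> carrier G" using y Uc by auto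
  have Qs: "Q y s"
    unfolding Q_def
  proof (intro allI exI impI)
    fix j n assume n: "n \<ge> N j"
    obtain u where u: "u \<in> ?U j" "y = x [^] \<lfloor>s (N j)\<rfloor> \<otimes> u"
      using y(2)[of j] unfolding C_def l_coset_def by auto
    obtain v where v: "v \<in> ?U j" "x [^] \<lfloor>s n\<rfloor> = x [^] \<lfloor>s (N j)\<rfloor> \<otimes> v"
      using inC[OF n] unfolding C_def l_coset_def by auto
    have c: "u \<in> carrier G" "v \<in> carrier G" using u v Ujc by auto
    have "x [^] \<lfloor>s n\<rfloor> = y \<otimes> (inv u \<otimes> v)"
    proof -
      have "y \<otimes> (inv u \<otimes> v) = x [^] \<lfloor>s (N j)\<rfloor> \<otimes> ((u \<otimes> inv u) \<otimes> v)"
        unfolding u(2) using c xc by (simp add: m_assoc del: r_inv Units_r_inv)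
      then show ?thesis unfolding v(2) using c by simp
    qed
    moreover have "inv u \<otimes> v \<in> ?U j"
      by (intro subgroup.m_closed[OF sub] subgroup.m_inv_closed[OF sub] u v)
    ultimately show "\<exists>u\<in>?U j. x [^] \<lfloor>s n\<rfloor> = y \<otimes> u" by blast
  qed
  have Qt: "Q y t" if t: "t \<in> a" for t
    unfolding Q_def
  proof
    fix j
    obtain N1 where N1: "\<And>n. n \<ge> N1 \<Longrightarrow> \<exists>u\<in>?U j. x [^] \<lfloor>s n\<rfloor> = y \<otimes> u"
      using Qs unfolding Q_def by blast
    obtain N2 where N2: "\<And>n. n \<ge> N2 \<Longrightarrow> int p ^ j dvd \<lfloor>t n\<rfloor> - \<lfloor>s n\<rfloor>"
      using Zp_representatives(3)[OF prime_p a t s, of j] by blast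
    have "\<exists>u\<in>?U j. x [^] \<lfloor>t n\<rfloor> = y \<otimes> u" if n: "n \<ge> max N1 N2" for n
    proof -
      obtain u where u: "u \<in> ?U j" "x [^] \<lfloor>s n\<rfloor> = y \<otimes> u" using N1 n by auto
      obtain v where v: "v \<in> ?U j" "x [^] \<lfloor>t n\<rfloor> = x [^] \<lfloor>s n\<rfloor> \<otimes> v"
        using shift[OF N2[of n]] n by auto
      have "x [^] \<lfloor>t n\<rfloor> = y \<otimes> (u \<otimes> v)"
        unfolding v(2) u(2) using yc u(1) v(1) Ujc m_assoc by blast
      moreover have "u \<otimes> v \<in> ?U j" by (intro subgroup.m_closed[OF sub] u v)
      ultimately show ?thesis by blast
    qed
    then show "\<exists>N. \<forall>n\<ge>N. \<exists>u\<in>?U j. x [^] \<lfloor>t n\<rfloor> = y \<otimes> u" by blast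
  qed
  have lim: "limitin T (\<lambda>n. x [^] \<lfloor>t n\<rfloor>) y sequentially" if t: "t \<in> a" for t
    unfolding limitin_def
  proof (intro conjI allI impI, goal_cases)
    case 1
    show ?case using yc topspace_eq by simp
  next
    case (2 W)
    then have W: "openin T W" "y \<in> W" by auto
    have W1: "openin T (inv y <# W)" by (intro open_l_coset W) (simp add: yc)
    have W2: "\<one> \<in> inv y <# W"
      using W yc unfolding l_coset_def by (auto intro!: bexI[of _ y])
    obtain j where j: "?U j \<subseteq> inv y <# W"
      using prime_pows_small[OF U(2) W1 W2] by auto
    have yW: "y \<otimes> u \<in> W" if u: "u \<in> ?U j" for u
    proof -
      obtain w where w: "w \<in> W" "u = inv y \<otimes> w" using u j unfolding l_coset_def by blast
      then have "w \<in> carrier G" using open_subset_carrier[OF W(1)] by auto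
      then have "y \<otimes> u = w" using w yc by (simp add: m_assoc[symmetric])
      then show ?thesis using w by simp
    qed
    obtain N1 where N1: "\<And>n. n \<ge> N1 \<Longrightarrow> \<exists>u\<in>?U j. x [^] \<lfloor>t n\<rfloor> = y \<otimes> u"
      using Qt[OF t] unfolding Q_def by blast
    show ?case unfolding eventually_sequentially
    proof (intro exI allI impI)
      fix n assume "n \<ge> N1"
      then obtain u where "u \<in> ?U j" "x [^] \<lfloor>t n\<rfloor> = y \<otimes> u" using N1 by blast
      then show "x [^] \<lfloor>t n\<rfloor> \<in> W" using yW by simp
    qed
  qed
  have act: "Zp_action G T a x = y"
    unfolding Zp_action_def
  proof (rule the_equality)
    show "\<forall>s\<in>a. limitin T (\<lambda>n. x [^] \<lfloor>s n\<rfloor>) y sequentially" using lim by blast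
  next
    fix z assume "\<forall>s\<in>a. limitin T (\<lambda>n. x [^] \<lfloor>s n\<rfloor>) z sequentially"
    then have z: "limitin T (\<lambda>n. x [^] \<lfloor>s n\<rfloor>) z sequentially" using s by blast
    show "z = y"
      by (rule limitin_Hausdorff_unique[OF z lim[OF s] _ Hausdorff]) simp
  qed
  show "Zp_action G T a x \<in> U" using y(1) act by simp
  show "\<exists>N. \<forall>n\<ge>N. \<exists>u\<in>pows (p ^ j) U. x [^] \<lfloor>s n\<rfloor> = Zp_action G T a x \<otimes> u"
    using Qs unfolding act Q_def by blast
qed

text \<open>By independence all exponents of a relation modulo \<open>U\<^bsup>p^(j+1)\<^esup>\<close> are divisible by \<open>p\<close>; as \<open>U\<close> has
  no \<open>p\<close>-torsion, dividing them by \<open>p\<close> leaves a relation modulo \<open>U\<^bsup>p^j\<^esup>\<close>.\<close>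

lemma independent_modulo_prime_power:
  assumes U: "subgroup U G" and tf: "\<And>x. x \<in> U \<Longrightarrow> x [^] p = \<one> \<Longrightarrow> x = \<one>"
    and S: "independent_modulo p (pows p U) S" "S \<subseteq> U"
    and A: "finite A" "A \<subseteq> S"
  shows "(\<Otimes>x\<in>A. x [^] (e x :: int)) \<in> pows (p ^ j) U \<Longrightarrow> \<forall>x\<in>A. int p ^ j dvd e x"
proof (induction j arbitrary: e)
  case 0
  then show ?case by simp
next
  case (Suc j)
  have Uc: "U \<subseteq> carrier G" using subgroup.subset[OF U] .
  have AU: "x \<in> U" if "x \<in> A" for x using that A S by auto
  have "pows (p ^ Suc j) U \<subseteq> pows p U" by (rule pows_dvd_subset[OF U]) simp
  then have "int p dvd e x" if "x \<in> A" for x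
    by (intro independent_moduloD[OF S(1) A _ that] subsetD[OF _ Suc.prems])
  then have e: "e x = (e x div int p) * int p" if "x \<in> A" for x using that by simp
  define P where "P = (\<Otimes>x\<in>A. x [^] (e x div int p))"
  have PU: "P \<in> U"
    unfolding P_def by (intro finprod_in_subgroup[OF U A(1)] subgroup_int_pow_closed[OF U] AU)
  have "P [^] p = (\<Otimes>x\<in>A. (x [^] (e x div int p)) [^] p)"
    unfolding P_def using AU Uc by (intro finprod_pow[OF A(1)]) auto
  also have "\<dots> = (\<Otimes>x\<in>A. x [^] e x)"
  proof (rule finprod_cong')
    show "(\<lambda>x. x [^] e x) \<in> A \<rightarrow> carrier G" using AU Uc by auto
    fix x assume x: "x \<in> A"
    then have "x \<in> carrier G" using AU Uc by auto
    then have "(x [^] (e x div int p)) [^] int p = x [^] (e x div int p * int p)"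
      by (simp add: int_pow_pow)
    then show "(x [^] (e x div int p)) [^] p = x [^] e x"
      using e[OF x] by (simp add: int_pow_int)
  qed simp
  finally obtain w where w: "w \<in> U" "P [^] p = w [^] (p ^ Suc j)"
    using Suc.prems unfolding pows_def by auto
  have c: "P \<in> carrier G" "w \<in> carrier G" using PU w Uc by auto
  let ?d = "P \<otimes> inv (w [^] (p ^ j))"
  have "w [^] (p ^ Suc j) = (w [^] (p ^ j)) [^] p" using c by (simp add: nat_pow_pow mult.commute)
  then have "?d [^] p = \<one>" using w(2) c by (simp add: nat_pow_distrib nat_pow_inv)
  moreover have "?d \<in> U"
    by (intro subgroup.m_closed[OF U] PU subgroup.m_inv_closed[OF U] subgroup_nat_pow_closed[OF U] w)
  ultimately have "?d = \<one>" using tf by blast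
  then have "P = w [^] (p ^ j)"
    using c by (metis inv_closed inv_equality inv_inv nat_pow_closed)
  then have "P \<in> pows (p ^ j) U" using w(1) by (auto simp: pows_def)
  then have "\<forall>x\<in>A. int p ^ j dvd e x div int p" unfolding P_def by (rule Suc.IH)
  then show ?case using e by (metis dvd_refl mult_dvd_mono power_Suc2)
qed

text \<open>A set which is independent modulo \<open>U\<^sup>p\<close> is independent over \<open>\<int>\<^sub>p\<close>: replacing the coefficients of a
  relation by late members of representing integer sequences gives relations modulo \<open>U\<^bsup>p^j\<^esup>\<close> for every \<open>j\<close>,
  so the integers are eventually divisible by \<open>p\<^sup>j\<close> and the coefficients vanish.  If \<open>U\<^sup>p\<close> had infinite index,
  arbitrarily large such sets would exist.\<close>

lemma torsion_free_finitely_covered: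
  assumes rk: "rk_Zp p G T < \<infinity>"
    and U: "subgroup U G" "compactin T U" and tf: "\<And>x. x \<in> U \<Longrightarrow> x [^] p = \<one> \<Longrightarrow> x = \<one>"
  shows "finitely_covered U (pows p U)"
proof (rule ccontr)
  assume nc: "\<not> ?thesis"
  have Uc: "U \<subseteq> carrier G" using subgroup.subset[OF U(1)] .
  have "rk_Zp p G T = \<infinity>"
    unfolding rk_Zp_def
  proof (rule rank_over_infinite)
    fix m
    have pU: "\<forall>x\<in>U. x [^] p \<in> pows p U" by (auto simp: pows_def)
    from ex_large_independent_set[OF prime_p U(1) pows_subgroup[OF U(1)] pows_subset[OF U(1)] pU nc,
          of m]
    obtain S where S: "finite S" "S \<subseteq> U" "card S = m" "independent_modulo p (pows p U) S"
      by (elim exE conjE)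
    have "independent_over G (carrier (Zp p)) \<one>\<^bsub>Zp p\<^esub> (Zp_action G T) S"
      unfolding independent_over_def
    proof (intro allI impI, elim conjE)
      fix A c
      assume A: "finite A" "A \<subseteq> S" "c \<in> A \<rightarrow> carrier (Zp p)"
        "(\<Otimes>x\<in>A. Zp_action G T (c x) x) = \<one>"
      have AU: "x \<in> U" if "x \<in> A" for x using that A S by auto
      have cZ: "c x \<in> carrier (Zp p)" if "x \<in> A" for x using that A by auto
      have "\<forall>x\<in>A. \<exists>s. s \<in> c x" using Zp_representatives(1)[OF prime_p cZ] by blast
      then obtain s where s: "\<And>x. x \<in> A \<Longrightarrow> s x \<in> c x" by metis
      have "\<exists>N. \<forall>n\<ge>N. \<forall>x\<in>A. int p ^ j dvd \<lfloor>s x n\<rfloor>" for j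
      proof -
        note approx = Zp_action_approximation[OF U AU cZ s]
        have "\<forall>x\<in>A. eventually (\<lambda>n. \<exists>u\<in>pows (p ^ j) U.
            x [^] \<lfloor>s x n\<rfloor> = Zp_action G T (c x) x \<otimes> u) sequentially"
          unfolding eventually_sequentially using approx(2) by blast
        then have "eventually (\<lambda>n. \<forall>x\<in>A. \<exists>u\<in>pows (p ^ j) U.
            x [^] \<lfloor>s x n\<rfloor> = Zp_action G T (c x) x \<otimes> u) sequentially"
          using A(1) by (rule eventually_ball_finite[rotated])
        then obtain N where N: "\<And>n x. n \<ge> N \<Longrightarrow> x \<in> A \<Longrightarrow>
            \<exists>u\<in>pows (p ^ j) U. x [^] \<lfloor>s x n\<rfloor> = Zp_action G T (c x) x \<otimes> u"
          unfolding eventually_sequentially by blast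
        have "\<forall>x\<in>A. int p ^ j dvd \<lfloor>s x n\<rfloor>" if n: "n \<ge> N" for n
        proof (rule independent_modulo_prime_power[OF U(1) tf S(4,2) A(1,2)])
          have "\<forall>x\<in>A. \<exists>u. u \<in> pows (p ^ j) U \<and> x [^] \<lfloor>s x n\<rfloor> = Zp_action G T (c x) x \<otimes> u"
            using N[OF n] by blast
          then obtain u where u: "\<And>x. x \<in> A \<Longrightarrow> u x \<in> pows (p ^ j) U"
            "\<And>x. x \<in> A \<Longrightarrow> x [^] \<lfloor>s x n\<rfloor> = Zp_action G T (c x) x \<otimes> u x" by metis
          have uc: "u \<in> A \<rightarrow> carrier G"
            using u(1) pows_carrier[OF Uc] by blast
          have ac: "(\<lambda>x. Zp_action G T (c x) x) \<in> A \<rightarrow> carrier G"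
            using approx(1) Uc by blast
          have "(\<Otimes>x\<in>A. x [^] \<lfloor>s x n\<rfloor>) = (\<Otimes>x\<in>A. Zp_action G T (c x) x \<otimes> u x)"
            using u(2) uc ac by (intro finprod_cong') auto
          also have "\<dots> = (\<Otimes>x\<in>A. u x)"
            using finprod_multf[OF ac uc] A(4) uc by simp
          also have "\<dots> \<in> pows (p ^ j) U"
            by (intro finprod_in_subgroup[OF pows_subgroup[OF U(1)] A(1)] u(1))
          finally show "(\<Otimes>x\<in>A. x [^] \<lfloor>s x n\<rfloor>) \<in> pows (p ^ j) U" .
        qed
        then show ?thesis by blast
      qed
      then show "\<forall>x\<in>A. c x = \<one>\<^bsub>Zp p\<^esub>"
        using Zp_representatives(4)[OF prime_p cZ s] by blast
    qed
    then show "\<exists>S. finite S \<and> S \<subseteq> carrier G \<and> card S = m \<and>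
        independent_over G (carrier (Zp p)) \<one>\<^bsub>Zp p\<^esub> (Zp_action G T) S"
      using S Uc by blast
  qed
  then show False using rk by simp
qed

text \<open>Inside \<open>L\<close>, the complement of \<open>H\<close> is a finite union of compact, hence closed, cosets.\<close>

lemma finitely_covered_compact_subgroup_open:
  assumes H: "subgroup H G" "compactin T H" "H \<subseteq> L" and L: "openin T L" "finitely_covered L H"
  shows "openin T H"
proof -
  obtain F where F: "finite F" "F \<subseteq> carrier G" "L \<subseteq> F <#> H"
    using L(2) by (rule finitely_coveredE)
  have "closedin T (\<Union>f\<in>F - H. f <# H)"
    using F by (intro closedin_Union) (auto intro!: compact_closed compact_l_coset H)
  moreover have "H = L - (\<Union>f\<in>F - H. f <# H)"
  proof (intro equalityI subsetI DiffI notI)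
    fix x assume x: "x \<in> H"
    then show "x \<in> L" using H(3) by blast
    assume "x \<in> (\<Union>f\<in>F - H. f <# H)"
    then obtain f h where f: "f \<in> F" "f \<notin> H" "h \<in> H" "x = f \<otimes> h" by (auto simp: l_coset_def)
    then have c: "f \<in> carrier G" "h \<in> carrier G" using F(2) subgroup.mem_carrier[OF H(1)] by auto
    then have "f = x \<otimes> inv h" using f(4) by (simp add: m_assoc)
    then show False
      using f x subgroup.m_closed[OF H(1)] subgroup.m_inv_closed[OF H(1)] by metis
  next
    fix x assume x: "x \<in> L - (\<Union>f\<in>F - H. f <# H)"
    then obtain f h where f: "f \<in> F" "h \<in> H" "x = f \<otimes> h"
      using F(3) unfolding set_mult_def by blast
    then have "f \<in> H" using x unfolding l_coset_def by blast
    then show "x \<in> H" using f subgroup.m_closed[OF H(1)] by simp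
  qed
  ultimately show ?thesis using L(1) openin_diff by metis
qed

end

locale finite_rank_p_group = prime_lca_p_group +
  assumes finite_rank: "rank_p p G T < \<infinity>"
begin

lemma finite_ranks: "rk_Zp p G T < \<infinity>" "r_p p G < \<infinity>"
  using finite_rank unfolding rank_p_def
  by (metis add.commute enat_ord_simps(4) plus_eq_infty_iff_enat)+

lemma finite_prime_power_torsion: "finite {x \<in> carrier G. x [^] (p ^ n) = \<one>}"
  by (rule finite_torsion_power[OF finite_p_torsion[OF finite_ranks(2)]])

text \<open>A small subgroup \<open>L\<^bsup>p^n\<^esup>\<close> avoids the finitely many elements of order \<open>p\<close>, so it has finite index over
  its \<open>p\<close>-th powers.  The \<open>p\<^sup>n\<close>-th power map, whose kernel is finite, carries this back to \<open>L\<close>.\<close>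

lemma compact_open_finitely_covered:
  assumes L: "subgroup L G" "compactin T L" "openin T L"
  shows "finitely_covered L (pows p L)"
proof -
  have Lc: "L \<subseteq> carrier G" using subgroup.subset[OF L(1)] .
  let ?T = "{x \<in> carrier G. x [^] p = \<one>}"
  have "finite (?T - {\<one>})" using finite_prime_power_torsion[of 1] by simp
  then have "compactin T (?T - {\<one>})" by (intro finite_imp_compactin) (auto simp: topspace_eq)
  then have "closedin T (?T - {\<one>})" by (rule compact_closed)
  then have "openin T (carrier G - (?T - {\<one>}))" by (simp add: closedin_def topspace_eq)
  from prime_pows_small[OF L(2) this]
  obtain n where n: "pows (p ^ n) L \<subseteq> carrier G - (?T - {\<one>})" by auto
  let ?U = "pows (p ^ n) L"
  have "finitely_covered ?U (pows p ?U)"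
  proof (rule torsion_free_finitely_covered[OF finite_ranks(1)])
    show "subgroup ?U G" by (rule pows_subgroup[OF L(1)])
    show "compactin T ?U" by (rule compact_pows[OF L(2)])
    show "x = \<one>" if "x \<in> ?U" "x [^] p = \<one>" for x using that n by blast
  qed
  also have "pows p ?U = pows (p ^ n) (pows p L)"
    using pows_pows[OF Lc] by (simp add: mult.commute)
  finally show ?thesis
    by (rule finitely_covered_power_preimage[OF Lc pows_subgroup[OF L(1)] finite_prime_power_torsion])
qed

lemma finitely_covered_prime_pows:
  assumes L: "subgroup L G" "compactin T L" "openin T L"
  shows "finitely_covered L (pows (p ^ j) L)"
proof (induction j)
  case 0
  have Lc: "L \<subseteq> carrier G" using subgroup.subset[OF L(1)] .
  then show ?case using pows_1[OF Lc] by (simp add: finitely_covered_subset)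
next
  case (Suc j)
  have Lc: "L \<subseteq> carrier G" using subgroup.subset[OF L(1)] .
  have pLc: "pows n L \<subseteq> carrier G" for n using pows_carrier[OF Lc] .
  have "finitely_covered (pows (p ^ j) L) (pows (p ^ j) (pows p L))"
    by (rule finitely_covered_pows[OF compact_open_finitely_covered[OF L] pLc])
  also have "pows (p ^ j) (pows p L) = pows (p ^ Suc j) L" using pows_pows[OF Lc] by simp
  finally show ?case by (rule finitely_covered_trans[OF Suc _ pLc pLc])
qed

lemma open_prime_pows:
  assumes L: "subgroup L G" "compactin T L" "openin T L"
  shows "openin T (pows (p ^ j) L)"
  by (rule finitely_covered_compact_subgroup_open[OF pows_subgroup[OF L(1)] compact_pows[OF L(2)]
        pows_subset[OF L(1)] L(3) finitely_covered_prime_pows[OF L]])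

end

section \<open>Haar measure of a group filtered by compact open subgroups\<close>

text \<open>Caratheodory's extension theorem with the extension named: that it is the outer measure is what
  gives outer regularity and invariance of the Haar measure below.\<close>

lemma (in ring_of_sets) measure_space_outer_measure:
  assumes f: "positive M f" "countably_additive M f"
  shows "measure_space \<Omega> (sigma_sets \<Omega> M) (outer_measure M f)"
proof -
  have add: "additive M f" using countably_additive_additive f by blast
  then have inc: "increasing M f" using additive_increasing f(1) by blast
  let ?L = "lambda_system \<Omega> (Pow \<Omega>) (outer_measure M f)"
  have ms: "measure_space \<Omega> ?L (outer_measure M f)"
    by (rule sigma_algebra.caratheodory_lemma[OF sigma_algebra_Pow
          outer_measure_space_outer_measure[OF f(1) inc]])
  then have "sigma_algebra \<Omega> ?L" by (simp add: measure_space_def)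
  then have sub: "sigma_sets \<Omega> M \<subseteq> ?L"
    by (rule sigma_algebra.sigma_sets_subset) (rule algebra_subset_lambda_system[OF f(1) inc add])
  show ?thesis
    by (rule measure_down[OF ms sigma_algebra_sigma_sets sub]) (rule space_closed)
qed

text \<open>Cosets of a shrinking sequence of compact open subgroups play the role of dyadic intervals: they
  form a base, and the Haar measure is built by counting them.\<close>

locale filtered_group = topological_group + comm_group G +
  fixes B :: "nat \<Rightarrow> 'a set"
  assumes B_subgroup: "subgroup (B j) G"
    and B_open: "openin T (B j)"
    and B_compact: "compactin T (B 0)"
    and B_decreasing: "B (Suc j) \<subseteq> B j"
    and B_base: "openin T W \<Longrightarrow> \<one> \<in> W \<Longrightarrow> \<exists>j. B j \<subseteq> W"
    and countable_cosets: "\<exists>C. countable C \<and> C \<subseteq> carrier G \<and> carrier G = C <#> B 0"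
begin

lemma B_carrier: "B j \<subseteq> carrier G"
  using subgroup.subset[OF B_subgroup] .

lemma B_antimono: "i \<le> j \<Longrightarrow> B j \<subseteq> B i"
  by (rule lift_Suc_antimono_le[of B]) (use B_decreasing in auto)

lemma B_compact': "compactin T (B j)"
  using closed_compactin[OF B_compact B_antimono[of 0 j] open_subgroup_closed[OF B_subgroup B_open]]
  by simp

lemma in_own_coset: "a \<in> carrier G \<Longrightarrow> a \<in> a <# B j"
  using subgroup.one_closed[OF B_subgroup, of j] unfolding l_coset_def by (force intro: bexI[of _ \<one>])

lemma coset_eqI: "b \<in> a <# B j \<Longrightarrow> a \<in> carrier G \<Longrightarrow> b <# B j = a <# B j"
  using l_repr_independence[OF _ _ B_subgroup] by simp

definition cosets :: "nat \<Rightarrow> 'a set \<Rightarrow> 'a set set" where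
  "cosets j A = (\<lambda>a. a <# B j) ` A"

text \<open>\<open>A\<close> is a union of finitely many cosets of \<open>B j\<close>.  Stability of \<open>A\<close> under \<open>B j\<close> is used in place of a
  list of cosets because it passes to unions, differences and translates at once.\<close>

definition level :: "nat \<Rightarrow> 'a set \<Rightarrow> bool" where
  "level j A \<longleftrightarrow> A \<subseteq> carrier G \<and> (\<forall>a\<in>A. a <# B j \<subseteq> A) \<and> finite (cosets j A)"

lemma levelD:
  assumes "level j A"
  shows "A \<subseteq> carrier G" "\<And>a x. a \<in> A \<Longrightarrow> x \<in> a <# B j \<Longrightarrow> x \<in> A" "finite (cosets j A)"
  using assms by (auto simp: level_def)

lemma level_eq_Union:
  assumes "level j A"
  shows "A = \<Union>(cosets j A)"
proof
  show "A \<subseteq> \<Union>(cosets j A)" using levelD(1)[OF assms] in_own_coset by (auto simp: cosets_def)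
  show "\<Union>(cosets j A) \<subseteq> A" using levelD(2)[OF assms] by (auto simp: cosets_def)
qed

lemma level_empty: "level j {}"
  by (simp add: level_def cosets_def)

lemma level_Un: "level j A \<Longrightarrow> level j A' \<Longrightarrow> level j (A \<union> A')"
  by (auto simp: level_def cosets_def image_Un)

lemma level_Diff:
  assumes "level j A" "level j A'"
  shows "level j (A - A')"
  unfolding level_def
proof (intro conjI ballI subsetI)
  show "x \<in> carrier G" if "x \<in> A - A'" for x using that levelD(1)[OF assms(1)] by auto
  have "cosets j (A - A') \<subseteq> cosets j A" by (auto simp: cosets_def)
  then show "finite (cosets j (A - A'))" using levelD(3)[OF assms(1)] finite_subset by blast
  fix a x assume a: "a \<in> A - A'" and x: "x \<in> a <# B j"
  have ac: "a \<in> carrier G" using a levelD(1)[OF assms(1)] by auto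
  have "x \<in> A" using a x levelD(2)[OF assms(1)] by blast
  moreover have "x \<notin> A'"
  proof
    assume "x \<in> A'"
    moreover have "a \<in> x <# B j" using coset_eqI[OF x ac] in_own_coset[OF ac, of j] by simp
    ultimately show False using levelD(2)[OF assms(2)] a by blast
  qed
  ultimately show "x \<in> A - A'" by simp
qed

lemma level_coset:
  assumes "a \<in> carrier G"
  shows "level j (a <# B j)"
proof -
  have eq: "b <# B j = a <# B j" if "b \<in> a <# B j" for b using coset_eqI[OF that assms] .
  then have "cosets j (a <# B j) \<subseteq> {a <# B j}" by (auto simp: cosets_def)
  then have "finite (cosets j (a <# B j))" by (rule finite_subset) simp
  then show ?thesis
    using l_coset_subset_G[OF B_carrier assms, of j] eq unfolding level_def by auto
qed

lemma card_cosets_disjoint_Un: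
  assumes "level j A" "level j A'" "A \<inter> A' = {}"
  shows "card (cosets j (A \<union> A')) = card (cosets j A) + card (cosets j A')"
proof -
  have "cosets j A \<inter> cosets j A' = {}"
  proof (rule ccontr)
    assume "cosets j A \<inter> cosets j A' \<noteq> {}"
    then obtain a b where ab: "a \<in> A" "b \<in> A'" "a <# B j = b <# B j" by (auto simp: cosets_def)
    then have "b \<in> a <# B j" using in_own_coset levelD(1)[OF assms(2)] by blast
    then have "b \<in> A" using levelD(2)[OF assms(1)] ab(1) by blast
    then show False using ab assms(3) by blast
  qed
  then show ?thesis
    using card_Un_disjoint[OF levelD(3)[OF assms(1)] levelD(3)[OF assms(2)]]
    by (simp add: cosets_def image_Un)
qed

lemma cosets_translate:
  assumes "A \<subseteq> carrier G" "g \<in> carrier G"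
  shows "cosets j (g <# A) = (\<lambda>C. g <# C) ` cosets j A"
  using assms lcos_m_assoc[OF B_carrier]
  unfolding cosets_def l_coset_eq_image[of g A] image_image
  by (intro image_cong) (auto simp: subset_iff)

lemma inj_translate: "g \<in> carrier G \<Longrightarrow> inj_on (\<lambda>C. g <# C) (Pow (carrier G))"
  by (rule inj_on_inverseI[of _ "\<lambda>C. inv g <# C"]) (simp add: lcos_m_assoc lcos_mult_one)

lemma card_cosets_translate:
  assumes "A \<subseteq> carrier G" "g \<in> carrier G"
  shows "card (cosets j (g <# A)) = card (cosets j A)"
proof -
  have "cosets j A \<subseteq> Pow (carrier G)"
    using l_coset_subset_G[OF B_carrier] assms(1) by (auto simp: cosets_def subset_iff)
  then show ?thesis
    unfolding cosets_translate[OF assms]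
    by (intro card_image inj_on_subset[OF inj_translate[OF assms(2)]])
qed

lemma level_translate:
  assumes "level j A" "g \<in> carrier G"
  shows "level j (g <# A)"
  unfolding level_def
proof (intro conjI ballI subsetI)
  note A = levelD[OF assms(1)]
  show "x \<in> carrier G" if "x \<in> g <# A" for x using l_coset_subset_G[OF A(1) assms(2)] that by blast
  show "finite (cosets j (g <# A))" using A(3) by (simp add: cosets_translate[OF A(1) assms(2)])
  fix a x assume "a \<in> g <# A" "x \<in> a <# B j"
  then obtain b h where b: "b \<in> A" "a = g \<otimes> b" "h \<in> B j" "x = a \<otimes> h" by (auto simp: l_coset_def)
  have "b \<otimes> h \<in> A" using A(2)[OF b(1)] b(3) by (auto simp: l_coset_def)
  moreover have "x = g \<otimes> (b \<otimes> h)"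
    using b A(1) B_carrier[of j] assms(2) by (auto simp: m_assoc subset_iff)
  ultimately show "x \<in> g <# A" by (auto simp: l_coset_def)
qed

lemma finite_cosets_compact:
  assumes "compactin T K"
  shows "finite (cosets j K)"
proof -
  obtain F where F: "finite F" "F \<subseteq> K" "K \<subseteq> F <#> B j"
    by (rule compact_finite_cover[OF assms B_open subgroup.one_closed[OF B_subgroup]])
  have "cosets j K \<subseteq> (\<lambda>a. a <# B j) ` F"
  proof
    fix C assume "C \<in> cosets j K"
    then obtain a where a: "a \<in> K" "C = a <# B j" by (auto simp: cosets_def)
    then obtain f where f: "f \<in> F" "a \<in> f <# B j"
      using F(3) unfolding set_mult_def l_coset_def by blast
    then have "C = f <# B j"
      using coset_eqI f(2) a(2) F(2) compact_subset_carrier[OF assms] by auto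
    then show "C \<in> (\<lambda>a. a <# B j) ` F" using f(1) by blast
  qed
  then show ?thesis using F(1) finite_surj by blast
qed

definition index :: "nat \<Rightarrow> nat" where
  "index j = card (cosets (Suc j) (B j))"

lemma index_pos: "index j > 0"
  unfolding index_def card_gt_0_iff
  using finite_cosets_compact[OF B_compact'] subgroup.one_closed[OF B_subgroup, of j]
  by (auto simp: cosets_def)

text \<open>Every coset of \<open>B j\<close> is a translate of \<open>B j\<close>, so it splits into \<open>index j\<close> cosets of \<open>B (Suc j)\<close>.\<close>

lemma level_Suc:
  assumes "level j A"
  shows "level (Suc j) A" "card (cosets (Suc j) A) = index j * card (cosets j A)"
proof -
  note A = levelD[OF assms]
  let ?P = "\<lambda>C. cosets (Suc j) C"
  have U: "cosets (Suc j) A = (\<Union>C\<in>cosets j A. ?P C)"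
  proof -
    have "cosets (Suc j) A = cosets (Suc j) (\<Union>(cosets j A))" using level_eq_Union[OF assms] by simp
    also have "\<dots> = (\<Union>C\<in>cosets j A. ?P C)" unfolding cosets_def[of "Suc j"] by blast
    finally show ?thesis .
  qed
  have fin: "finite (?P C)" and card: "card (?P C) = index j" if C: "C \<in> cosets j A" for C
  proof -
    obtain a where a: "a \<in> carrier G" "C = a <# B j" using C A(1) by (auto simp: cosets_def)
    show "finite (?P C)"
      unfolding a(2) by (rule finite_cosets_compact[OF compact_l_coset[OF B_compact' a(1)]])
    show "card (?P C) = index j"
      unfolding a(2) index_def by (rule card_cosets_translate[OF B_carrier a(1)])
  qed
  have sub: "a <# B (Suc j) \<subseteq> a <# B j" for a
    using B_decreasing[of j] by (auto simp: l_coset_def)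
  have disj: "?P C \<inter> ?P D = {}" if CD: "C \<in> cosets j A" "D \<in> cosets j A" "C \<noteq> D" for C D
  proof (rule ccontr)
    assume "?P C \<inter> ?P D \<noteq> {}"
    then obtain c d where cd: "c \<in> C" "d \<in> D" "c <# B (Suc j) = d <# B (Suc j)"
      by (auto simp: cosets_def)
    obtain a b where ab: "a \<in> carrier G" "C = a <# B j" "b \<in> carrier G" "D = b <# B j"
      using CD A(1) by (auto simp: cosets_def)
    have "d \<in> carrier G" using cd(2) ab l_coset_subset_G[OF B_carrier] by blast
    then have "d \<in> c <# B j" using in_own_coset[of d "Suc j"] cd(3) sub[of c] by auto
    moreover have "c <# B j = C" using coset_eqI cd(1) ab by simp
    ultimately have "d \<in> C" by simp
    then have "d <# B j = C" using coset_eqI[of d a j] ab by simp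
    moreover have "d <# B j = D" using coset_eqI[of d b j] cd(2) ab by simp
    ultimately show False using CD(3) by simp
  qed
  show "level (Suc j) A"
    using A sub fin unfolding level_def U by blast
  have "card (cosets (Suc j) A) = (\<Sum>C\<in>cosets j A. card (?P C))"
    unfolding U using A(3) fin disj by (intro card_UN_disjoint) auto
  then show "card (cosets (Suc j) A) = index j * card (cosets j A)" using card by simp
qed

text \<open>The measure of a coset of \<open>B j\<close>, normalised by \<open>\<mu> (B 0) = 1\<close>.\<close>

definition weight :: "nat \<Rightarrow> real" where
  "weight j = 1 / (\<Prod>i<j. real (index i))"

lemma weight_pos: "weight j > 0"
  unfolding weight_def using index_pos by (auto intro!: prod_pos)

lemma weight_Suc: "weight (Suc j) * real (index j) = weight j"
  using index_pos[of j] by (simp add: weight_def)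

lemma level_mono:
  assumes "level j A" "j \<le> k"
  shows "level k A \<and> weight k * real (card (cosets k A)) = weight j * real (card (cosets j A))"
  using assms(2)
proof (induction k rule: dec_induct)
  case base
  then show ?case using assms(1) by simp
next
  case (step k)
  then have "level k A" by simp
  from level_Suc[OF this] have "level (Suc k) A"
    "weight (Suc k) * real (card (cosets (Suc k) A)) =
      (weight (Suc k) * real (index k)) * real (card (cosets k A))" by simp_all
  then show ?case using step weight_Suc by simp
qed

definition clopen_ring :: "'a set set" where
  "clopen_ring = {A. \<exists>j. level j A}"

text \<open>The level at which cosets are counted does not matter, by \<open>level_mono\<close>.\<close>

definition clopen_content :: "'a set \<Rightarrow> ennreal" where
  "clopen_content A = (let j = (SOME j. level j A) in ennreal (weight j * real (card (cosets j A))))"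

lemma content_eq:
  assumes "level j A"
  shows "clopen_content A = ennreal (weight j * real (card (cosets j A)))"
proof -
  define k where "k = (SOME j. level j A)"
  have k: "level k A" unfolding k_def using assms by (rule someI)
  have "weight k * real (card (cosets k A)) = weight j * real (card (cosets j A))"
    using level_mono[OF k, of "max j k"] level_mono[OF assms, of "max j k"] by simp
  then show ?thesis unfolding clopen_content_def k_def[symmetric] by (simp add: Let_def)
qed

lemma common_level:
  assumes "A \<in> clopen_ring" "A' \<in> clopen_ring"
  obtains j where "level j A" "level j A'"
proof -
  obtain i k where "level i A" "level k A'" using assms by (auto simp: clopen_ring_def)
  then show thesis using that[of "max i k"] level_mono by simp
qed

lemma clopen_ring: "ring_of_sets (carrier G) clopen_ring"
proof (rule ring_of_setsI)
  show "clopen_ring \<subseteq> Pow (carrier G)" using levelD(1) by (auto simp: clopen_ring_def)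
  show "{} \<in> clopen_ring" using level_empty by (auto simp: clopen_ring_def)
  show "A \<union> A' \<in> clopen_ring" "A - A' \<in> clopen_ring"
    if A: "A \<in> clopen_ring" "A' \<in> clopen_ring" for A A'
  proof -
    obtain j where j: "level j A" "level j A'" by (rule common_level[OF A])
    show "A \<union> A' \<in> clopen_ring" "A - A' \<in> clopen_ring"
      using level_Un[OF j] level_Diff[OF j] unfolding clopen_ring_def by blast+
  qed
qed

lemma clopen_ring_compact_open:
  assumes "A \<in> clopen_ring"
  shows "compactin T A" "openin T A"
proof -
  obtain j where j: "level j A" using assms by (auto simp: clopen_ring_def)
  note A = levelD[OF j]
  have c: "compactin T C" "openin T C" if "C \<in> cosets j A" for C
    using that A(1) compact_l_coset[OF B_compact'] open_l_coset[OF B_open] by (auto simp: cosets_def)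
  have "compactin T (\<Union>(cosets j A))" using A(3) c(1) by (intro compactin_Union) auto
  then show "compactin T A" using level_eq_Union[OF j] by simp
  have "openin T (\<Union>(cosets j A))" using c(2) by (intro openin_Union) auto
  then show "openin T A" using level_eq_Union[OF j] by simp
qed

lemma content_finite: "A \<in> clopen_ring \<Longrightarrow> clopen_content A \<noteq> \<infinity>"
  using content_eq by (auto simp: clopen_ring_def)

lemma content_positive: "positive clopen_ring clopen_content"
  using content_eq[OF level_empty] by (simp add: positive_def cosets_def)

lemma content_additive: "additive clopen_ring clopen_content"
  unfolding additive_def
proof (intro ballI impI)
  fix A A' assume A: "A \<in> clopen_ring" "A' \<in> clopen_ring" "A \<inter> A' = {}"
  obtain j where j: "level j A" "level j A'" by (rule common_level[OF A(1,2)])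
  show "clopen_content (A \<union> A') = clopen_content A + clopen_content A'"
    unfolding content_eq[OF j(1)] content_eq[OF j(2)] content_eq[OF level_Un[OF j]]
      card_cosets_disjoint_Un[OF j A(3)]
    using weight_pos[of j] by (simp add: ennreal_plus[symmetric] distrib_left del: ennreal_plus)
qed

text \<open>A decreasing sequence of compact clopen sets with empty intersection is eventually empty.\<close>

lemma content_countably_additive: "countably_additive clopen_ring clopen_content"
proof (rule ring_of_sets.empty_continuous_imp_countably_additive[OF clopen_ring content_positive
      content_additive])
  show "\<forall>A\<in>clopen_ring. clopen_content A \<noteq> \<infinity>" using content_finite by blast
  fix A :: "nat \<Rightarrow> 'a set"
  assume A: "range A \<subseteq> clopen_ring" "decseq A" "(\<Inter>i. A i) = {}"
  have co: "compactin T (A i)" "openin T (A i)" for i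
    using A(1) clopen_ring_compact_open by auto
  have op: "\<forall>U\<in>range (\<lambda>i. A 0 - A i). openin T U"
  proof
    fix U assume "U \<in> range (\<lambda>i. A 0 - A i)"
    then obtain i where i: "U = A 0 - A i" by blast
    have "A 0 - A i \<in> clopen_ring"
      using A(1) by (intro ring_of_sets.Diff[OF clopen_ring]) auto
    then show "openin T U" unfolding i using clopen_ring_compact_open by blast
  qed
  have "A 0 \<subseteq> \<Union>(range (\<lambda>i. A 0 - A i))" using A(3) by blast
  with op have "\<exists>\<F>. finite \<F> \<and> \<F> \<subseteq> range (\<lambda>i. A 0 - A i) \<and> A 0 \<subseteq> \<Union>\<F>"
    using co(1)[of 0] unfolding compactin_def by simp
  then obtain \<F> where F: "finite \<F>" "\<F> \<subseteq> range (\<lambda>i. A 0 - A i)" "A 0 \<subseteq> \<Union>\<F>" by blast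
  obtain J where J: "finite J" "\<F> = (\<lambda>i. A 0 - A i) ` J"
    using finite_subset_image[OF F(1,2)] by blast
  \<comment> \<open>The \<open>0\<close> makes the maximum meaningful for an empty cover.\<close>
  let ?n = "Max (insert 0 J)"
  have "A ?n = {}"
  proof (rule ccontr)
    assume "A ?n \<noteq> {}"
    then obtain x where x: "x \<in> A ?n" by blast
    have sub: "A ?n \<subseteq> A i" if "i \<in> insert 0 J" for i
      using A(2) that J(1) unfolding decseq_def by (meson Max_ge finite_insert)
    then have "x \<in> A 0" using x by blast
    then obtain i where "i \<in> J" "x \<notin> A i" using F(3) J(2) by blast
    then show False using sub[of i] x by blast
  qed
  then have "A i = {}" if "i \<ge> ?n" for i using A(2) that unfolding decseq_def by blast
  then have "clopen_content (A i) = 0" if "i \<ge> ?n" for i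
    using that content_positive by (simp add: positive_def)
  then show "(\<lambda>i. clopen_content (A i)) \<longlonglongrightarrow> 0"
    using tendsto_eventually[of "\<lambda>i. clopen_content (A i)"] eventually_sequentially by blast
qed

lemma open_eq_countable_Union:
  assumes U: "openin T U"
  obtains D :: "nat \<Rightarrow> 'a set" where "range D \<subseteq> clopen_ring" "U = (\<Union>i. D i)"
proof -
  obtain C where C: "countable C" "C \<subseteq> carrier G" "carrier G = C <#> B 0"
    using countable_cosets by blast
  have "\<exists>F. finite F \<and> F \<subseteq> B 0 \<and> B 0 \<subseteq> F <#> B j" for j
    using compact_finite_cover[OF B_compact B_open subgroup.one_closed[OF B_subgroup]] by metis
  then obtain F where F: "\<And>j. finite (F j)" "\<And>j. F j \<subseteq> B 0" "\<And>j. B 0 \<subseteq> F j <#> B j" by metis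
  define \<D> where "\<D> = insert {} {D \<in> (\<lambda>(c, j, f). c \<otimes> f <# B j) `
      (SIGMA c:C. SIGMA j:UNIV. F j). D \<subseteq> U}"
  have "countable \<D>"
    unfolding \<D>_def using C(1) F(1)
    by (intro countable_insert countable_Collect countable_image countable_SIGMA)
      (auto intro: countable_finite)
  moreover have "\<D> \<noteq> {}" by (simp add: \<D>_def)
  ultimately obtain D :: "nat \<Rightarrow> 'a set" where D: "range D = \<D>"
    using range_from_nat_into by metis
  have Fc: "f \<in> carrier G" if "f \<in> F j" for f j using that F(2) B_carrier by blast
  show thesis
  proof (rule that)
    show "range D \<subseteq> clopen_ring"
    proof
      fix E assume "E \<in> range D"
      then consider "E = {}" | c j f where "c \<in> C" "f \<in> F j" "E = c \<otimes> f <# B j"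
        unfolding D \<D>_def by auto
      then show "E \<in> clopen_ring"
      proof cases
        case 1
        then show ?thesis using level_empty by (auto simp: clopen_ring_def)
      next
        case 2
        then have "level j E" using C(2) Fc by (auto intro!: level_coset)
        then show ?thesis by (auto simp: clopen_ring_def)
      qed
    qed
    have "x \<in> \<Union>\<D>" if x: "x \<in> U" for x
    proof -
      have xc: "x \<in> carrier G" using x open_subset_carrier[OF U] by blast
      have "openin T (inv x <# U)" by (intro open_l_coset U) (simp add: xc)
      moreover have "\<one> \<in> inv x <# U"
        using x xc unfolding l_coset_def by (auto intro!: bexI[of _ x])
      ultimately obtain j where j: "B j \<subseteq> inv x <# U" using B_base by blast
      have xB: "x <# B j \<subseteq> U"
      proof
        fix y assume "y \<in> x <# B j"
        then obtain h where h: "h \<in> B j" "y = x \<otimes> h" by (auto simp: l_coset_def)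
        then obtain u where u: "u \<in> U" "h = inv x \<otimes> u" using j unfolding l_coset_def by blast
        then have "u \<in> carrier G" using open_subset_carrier[OF U] by blast
        then have "y = u" using h(2) u(2) xc by (simp add: m_assoc[symmetric])
        then show "y \<in> U" using u(1) by simp
      qed
      obtain c b where cb: "c \<in> C" "b \<in> B 0" "x = c \<otimes> b"
        using xc C(3) unfolding set_mult_def by blast
      obtain f h where fh: "f \<in> F j" "h \<in> B j" "b = f \<otimes> h"
        using cb(2) F(3)[of j] unfolding set_mult_def by blast
      have c: "c \<in> carrier G" "f \<in> carrier G" "h \<in> carrier G"
        using cb(1) C(2) Fc[OF fh(1)] fh(2) B_carrier by auto
      have "x \<in> c \<otimes> f <# B j"
        unfolding l_coset_def using c fh cb(3) by (auto simp: m_assoc intro!: bexI[of _ h])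
      then have eq: "c \<otimes> f <# B j = x <# B j" using coset_eqI c by simp
      have "c \<otimes> f <# B j \<in> \<D>"
        unfolding \<D>_def using cb(1) fh(1) xB eq
        by (intro insertI2 CollectI conjI image_eqI[of _ _ "(c, j, f)"]) auto
      then show ?thesis using eq in_own_coset[OF xc, of j] by blast
    qed
    moreover have "\<Union>\<D> \<subseteq> U" by (auto simp: \<D>_def)
    ultimately show "U = (\<Union>i. D i)" using D by blast
  qed
qed

lemma sigma_clopen_ring:
  "sigma_sets (carrier G) clopen_ring = sigma_sets (carrier G) {U. openin T U}"
proof
  have "clopen_ring \<subseteq> sigma_sets (carrier G) {U. openin T U}"
    using clopen_ring_compact_open(2) by (auto intro: sigma_sets.Basic)
  then show "sigma_sets (carrier G) clopen_ring \<subseteq> sigma_sets (carrier G) {U. openin T U}"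
    by (rule sigma_sets_mono)
  have "U \<in> sigma_sets (carrier G) clopen_ring" if U: "openin T U" for U
  proof -
    obtain D :: "nat \<Rightarrow> 'a set" where "range D \<subseteq> clopen_ring" "U = (\<Union>i. D i)"
      by (rule open_eq_countable_Union[OF U])
    moreover have "(\<Union>i. D i) \<in> sigma_sets (carrier G) clopen_ring"
      using \<open>range D \<subseteq> clopen_ring\<close> by (intro sigma_sets.Union sigma_sets.Basic) auto
    ultimately show ?thesis by simp
  qed
  then show "sigma_sets (carrier G) {U. openin T U} \<subseteq> sigma_sets (carrier G) clopen_ring"
    by (intro sigma_sets_mono) auto
qed

text \<open>Translating a cover by sets of the ring gives a cover of the same total content.\<close>

lemma outer_measure_translate_le:
  assumes A: "A \<subseteq> carrier G" and g: "g \<in> carrier G"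
  shows "outer_measure clopen_ring clopen_content (g <# A) \<le> outer_measure clopen_ring clopen_content A"
  unfolding outer_measure_def[of _ _ A]
proof (rule INF_greatest)
  fix D :: "nat \<Rightarrow> 'a set"
  assume "D \<in> {D. range D \<subseteq> clopen_ring \<and> disjoint_family D \<and> A \<subseteq> (\<Union>i. D i)}"
  then have D: "\<And>i. D i \<in> clopen_ring" "disjoint_family D" "A \<subseteq> (\<Union>i. D i)" by auto
  have Dc: "D i \<subseteq> carrier G" for i
    using D(1)[of i] levelD(1) by (auto simp: clopen_ring_def)
  have Dg: "g <# D i \<in> clopen_ring" "clopen_content (g <# D i) = clopen_content (D i)" for i
  proof -
    obtain j where j: "level j (D i)" using D(1)[of i] by (auto simp: clopen_ring_def)
    show "g <# D i \<in> clopen_ring" using level_translate[OF j g] by (auto simp: clopen_ring_def)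
    show "clopen_content (g <# D i) = clopen_content (D i)"
      using content_eq[OF j] content_eq[OF level_translate[OF j g]]
        card_cosets_translate[OF Dc g] by simp
  qed
  have "disjoint_family (\<lambda>i. g <# D i)"
    unfolding disjoint_family_on_def
  proof (intro ballI impI)
    fix i k :: nat assume "i \<noteq> k"
    then have "D i \<inter> D k = {}" using D(2) by (auto simp: disjoint_family_on_def)
    moreover have "inj_on (\<lambda>x. g \<otimes> x) (carrier G)" using g by (rule inj_on_cmult)
    ultimately show "(g <# D i) \<inter> (g <# D k) = {}"
      unfolding l_coset_eq_image using Dc by (simp add: inj_on_image_Int[symmetric])
  qed
  moreover have "g <# A \<subseteq> (\<Union>i. g <# D i)" using D(3) unfolding l_coset_def by blast
  ultimately have "outer_measure clopen_ring clopen_content (g <# A) \<le> (\<Sum>i. clopen_content (g <# D i))"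
    unfolding outer_measure_def using Dg(1) by (intro INF_lower) auto
  then show "outer_measure clopen_ring clopen_content (g <# A) \<le> (\<Sum>i. clopen_content (D i))"
    by (simp add: Dg(2))
qed

text \<open>The ring consists of open sets, so the outer measure of \<open>A\<close> is approximated by open sets
  containing \<open>A\<close>; its sets are also compact, and every open set is a countable union of them, which gives inner
  regularity on open sets.\<close>

theorem ex_left_haar_measure: "\<exists>\<mu>. left_haar_measure G T \<mu>"
proof -
  interpret R: ring_of_sets "carrier G" clopen_ring by (rule clopen_ring)
  let ?O = "outer_measure clopen_ring clopen_content"
  define \<mu> where "\<mu> = measure_of (carrier G) clopen_ring ?O"
  have sp: "space \<mu> = carrier G" and se: "sets \<mu> = sigma_sets (carrier G) clopen_ring"
    unfolding \<mu>_def using R.space_closed by (auto simp: space_measure_of sets_measure_of)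
  have ms: "measure_space (carrier G) (sigma_sets (carrier G) clopen_ring) ?O"
    by (rule R.measure_space_outer_measure[OF content_positive content_countably_additive])
  have em: "emeasure \<mu> A = ?O A" if "A \<in> sets \<mu>" for A
    unfolding \<mu>_def
  proof (rule emeasure_measure_of[OF refl R.space_closed])
    show "A \<in> sets (measure_of (carrier G) clopen_ring ?O)" using that unfolding \<mu>_def .
  qed (use ms in \<open>simp_all add: measure_space_def \<mu>_def[symmetric] se\<close>)
  have ring_sets: "A \<in> sets \<mu>" and ring_em: "emeasure \<mu> A = clopen_content A" if "A \<in> clopen_ring" for A
  proof -
    show *: "A \<in> sets \<mu>" unfolding se using that by (rule sigma_sets.Basic)
    show "emeasure \<mu> A = clopen_content A"
      using em[OF *] R.outer_measure_agrees[OF content_positive content_countably_additive that] by simp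
  qed
  have open_sets: "U \<in> sets \<mu>" if "openin T U" for U
    unfolding se sigma_clopen_ring using that by (intro sigma_sets.Basic) simp
  have B0: "B 0 \<in> clopen_ring" "clopen_content (B 0) \<noteq> 0"
  proof -
    have "\<one> <# B 0 = B 0" by (rule lcos_mult_one[OF B_carrier])
    then have l: "level 0 (B 0)" using level_coset[OF one_closed, of 0] by simp
    then show "B 0 \<in> clopen_ring" by (auto simp: clopen_ring_def)
    have "cosets 0 (B 0) \<noteq> {}" using subgroup.one_closed[OF B_subgroup] by (auto simp: cosets_def)
    then have "card (cosets 0 (B 0)) > 0" using levelD(3)[OF l] by (simp add: card_gt_0_iff)
    then show "clopen_content (B 0) \<noteq> 0"
      using weight_pos[of 0] by (simp add: content_eq[OF l])
  qed
  have "left_haar_measure G T \<mu>"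
    unfolding left_haar_measure_def
  proof (intro conjI ballI allI impI)
    show "sets \<mu> = sets (sigma (topspace T) {U. openin T U})"
    proof -
      have "{U. openin T U} \<subseteq> Pow (topspace T)" using openin_subset by auto
      then show ?thesis by (simp add: sets_measure_of se sigma_clopen_ring topspace_eq)
    qed
  next
    have "emeasure \<mu> (B 0) \<le> emeasure \<mu> (space \<mu>)" by (rule emeasure_space)
    then show "emeasure \<mu> (space \<mu>) \<noteq> 0" using B0 ring_em[OF B0(1)] by auto
  next
    fix K assume K: "compactin T K"
    obtain F where F: "finite F" "F \<subseteq> K" "K \<subseteq> F <#> B 0"
      by (rule compact_finite_cover[OF K B_open subgroup.one_closed[OF B_subgroup]])
    have "(\<Union>f\<in>F. f <# B 0) \<in> clopen_ring"
    proof (intro R.finite_UN F(1))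
      fix f assume "f \<in> F"
      then have "f \<in> carrier G" using F(2) compact_subset_carrier[OF K] by blast
      then have "level 0 (f <# B 0)" by (rule level_coset)
      then show "f <# B 0 \<in> clopen_ring" unfolding clopen_ring_def by blast
    qed
    then have r: "F <#> B 0 \<in> clopen_ring" by (simp add: set_mult_def l_coset_def)
    have "emeasure \<mu> K \<le> emeasure \<mu> (F <#> B 0)"
      by (rule emeasure_mono[OF F(3) ring_sets[OF r]])
    then show "emeasure \<mu> K < \<infinity>"
      using ring_em[OF r] content_finite[OF r] by (auto simp: less_top[symmetric] top_unique)
  next
    fix A assume A: "A \<in> sets \<mu>"
    show "emeasure \<mu> A = (INF U\<in>{U. openin T U \<and> A \<subseteq> U}. emeasure \<mu> U)"
    proof (rule antisym)
      show "emeasure \<mu> A \<le> (INF U\<in>{U. openin T U \<and> A \<subseteq> U}. emeasure \<mu> U)"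
        by (intro INF_greatest emeasure_mono) (auto simp: open_sets)
      show "(INF U\<in>{U. openin T U \<and> A \<subseteq> U}. emeasure \<mu> U) \<le> emeasure \<mu> A"
        unfolding em[OF A] outer_measure_def
      proof (rule INF_greatest)
        fix D :: "nat \<Rightarrow> 'a set"
        assume "D \<in> {D. range D \<subseteq> clopen_ring \<and> disjoint_family D \<and> A \<subseteq> (\<Union>i. D i)}"
        then have D: "\<And>i. D i \<in> clopen_ring" "disjoint_family D" "A \<subseteq> (\<Union>i. D i)" by auto
        have "openin T (\<Union>i. D i)" using clopen_ring_compact_open(2)[OF D(1)] by auto
        then have "(INF U\<in>{U. openin T U \<and> A \<subseteq> U}. emeasure \<mu> U) \<le> emeasure \<mu> (\<Union>i. D i)"
          using D(3) by (intro INF_lower) auto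
        also have "\<dots> = (\<Sum>i. clopen_content (D i))"
          using suminf_emeasure[of D \<mu>] D(1,2) ring_sets ring_em by (simp add: image_subset_iff)
        finally show "(INF U\<in>{U. openin T U \<and> A \<subseteq> U}. emeasure \<mu> U) \<le> (\<Sum>i. clopen_content (D i))" .
      qed
    qed
  next
    fix U assume U: "openin T U"
    obtain D :: "nat \<Rightarrow> 'a set" where D: "range D \<subseteq> clopen_ring" "U = (\<Union>i. D i)"
      by (rule open_eq_countable_Union[OF U])
    define E where "E n = (\<Union>i\<le>n. D i)" for n
    have E: "E n \<in> clopen_ring" for n
      unfolding E_def using D(1) by (intro R.finite_UN) auto
    have UE: "(\<Union>n. E n) = U" unfolding E_def D(2) by auto
    have inc: "incseq E" unfolding E_def incseq_def by force
    show "emeasure \<mu> U = (SUP K\<in>{K. compactin T K \<and> K \<subseteq> U}. emeasure \<mu> K)"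
    proof (rule antisym)
      have "emeasure \<mu> U = (SUP n. emeasure \<mu> (E n))"
        using SUP_emeasure_incseq[OF _ inc, of \<mu>] E ring_sets UE by (simp add: image_subset_iff)
      also have "\<dots> \<le> (SUP K\<in>{K. compactin T K \<and> K \<subseteq> U}. emeasure \<mu> K)"
        using clopen_ring_compact_open(1)[OF E] UE by (intro SUP_mono) auto
      finally show "emeasure \<mu> U \<le> (SUP K\<in>{K. compactin T K \<and> K \<subseteq> U}. emeasure \<mu> K)" .
      show "(SUP K\<in>{K. compactin T K \<and> K \<subseteq> U}. emeasure \<mu> K) \<le> emeasure \<mu> U"
        by (intro SUP_least emeasure_mono) (auto simp: open_sets U)
    qed
  next
    fix g A assume g: "g \<in> carrier G" and A: "A \<in> sets \<mu>"
    have Ac: "A \<subseteq> carrier G" using A sets.sets_into_space sp by metis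
    have "(\<lambda>x. inv g \<otimes> x) \<in> measurable \<mu> \<mu>"
    proof (rule measurable_sigma_sets[OF se[unfolded sigma_clopen_ring]])
      show "{U. openin T U} \<subseteq> Pow (carrier G)" using open_subset_carrier by auto
      show "(\<lambda>x. inv g \<otimes> x) \<in> space \<mu> \<rightarrow> carrier G" using g sp by auto
      fix U assume "U \<in> {U. openin T U}"
      then have U: "openin T U" by simp
      have "continuous_map T T (\<lambda>x. inv g \<otimes> x)"
        using g by (intro continuous_map_mult continuous_map_constI) auto
      from openin_continuous_map_preimage[OF this U]
      have "openin T {x \<in> carrier G. inv g \<otimes> x \<in> U}" by (simp add: topspace_eq)
      moreover have "{x \<in> carrier G. inv g \<otimes> x \<in> U} = (\<lambda>x. inv g \<otimes> x) -` U \<inter> space \<mu>"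
        using sp by auto
      ultimately show "(\<lambda>x. inv g \<otimes> x) -` U \<inter> space \<mu> \<in> sets \<mu>" using open_sets by simp
    qed
    from measurable_sets[OF this A]
    have "(\<lambda>x. inv g \<otimes> x) -` A \<inter> space \<mu> \<in> sets \<mu>" .
    moreover have "(\<lambda>x. inv g \<otimes> x) -` A \<inter> space \<mu> = g <# A"
      using mem_l_coset_iff[OF g Ac] l_coset_subset_G[OF Ac g] sp by auto
    ultimately have gA: "g <# A \<in> sets \<mu>" by simp
    have gAc: "g <# A \<subseteq> carrier G" using l_coset_subset_G[OF Ac g] .
    have "A = inv g <# (g <# A)" using g Ac by (simp add: lcos_m_assoc lcos_mult_one)
    then have "?O A \<le> ?O (g <# A)"
      using outer_measure_translate_le[OF gAc inv_closed[OF g]] by simp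
    then show "emeasure \<mu> (g <# A) = emeasure \<mu> A"
      unfolding em[OF A] em[OF gA] using outer_measure_translate_le[OF Ac g] by (rule antisym[rotated])
  qed
  then show ?thesis by blast
qed

end

section \<open>Cotrajectories and their Haar measure\<close>

context finite_rank_p_group
begin

text \<open>The subgroups \<open>M n\<close> exhaust \<open>G\<close> and each consists of finitely many cosets of \<open>L\<close>, so \<open>G\<close> is a countable union of cosets of \<open>L\<close>, and any finite set lies in a
  compact open subgroup.\<close>

lemma power_preimage_compact_open:
  assumes L: "subgroup L G" "compactin T L" "openin T L"
  defines "M n \<equiv> {x \<in> carrier G. x [^] (p ^ n) \<in> L}"
  shows "subgroup (M n) G" "compactin T (M n)" "openin T (M n)" "finitely_covered (M n) L" "L \<subseteq> M n"
    and "m \<le> n \<Longrightarrow> M m \<subseteq> M n"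
proof -
  have Lc: "L \<subseteq> carrier G" using subgroup.subset[OF L(1)] .
  have M: "subgroup (M n) G" for n
  proof (rule subgroupI)
    show "M n \<subseteq> carrier G" by (auto simp: M_def)
    have "\<one> \<in> M n" using subgroup.one_closed[OF L(1)] by (simp add: M_def)
    then show "M n \<noteq> {}" by blast
    show "inv x \<in> M n" if "x \<in> M n" for x
      using that subgroup.m_inv_closed[OF L(1)] by (simp add: M_def nat_pow_inv)
    show "x \<otimes> y \<in> M n" if "x \<in> M n" "y \<in> M n" for x y
      using that subgroup.m_closed[OF L(1)] by (simp add: M_def nat_pow_distrib)
  qed
  have LM: "L \<subseteq> M n" for n
    using Lc subgroup_nat_pow_closed[OF L(1)] by (auto simp: M_def)
  have Mo: "openin T (M n)" for n
    by (rule open_subgroupI[OF M L(3) subgroup.one_closed[OF L(1)] LM])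
  show "subgroup (M n) G" "openin T (M n)" "L \<subseteq> M n" by (fact M Mo LM)+
  have "pows (p ^ n) (M n) \<subseteq> L" by (auto simp: M_def pows_def)
  then have "finitely_covered (pows (p ^ n) (M n)) L"
    using Lc by (intro finitely_covered_subset) auto
  then have "finitely_covered (pows (p ^ n) (M n)) (pows (p ^ n) L)"
    by (rule finitely_covered_trans[OF _ finitely_covered_prime_pows[OF L] Lc pows_carrier[OF Lc]])
  then show cov: "finitely_covered (M n) L"
    by (rule finitely_covered_power_preimage[OF subgroup.subset[OF M] L(1) finite_prime_power_torsion])
  then obtain F where F: "finite F" "F \<subseteq> carrier G" "M n \<subseteq> F <#> L" by (rule finitely_coveredE)
  have "compactin T (F <#> L)"
    using F(1,2) by (intro compact_set_mult L finite_imp_compactin) (auto simp: topspace_eq)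
  then show "compactin T (M n)"
    by (rule closed_compactin[OF _ F(3) open_subgroup_closed[OF M Mo]])
  show "M m \<subseteq> M n" if "m \<le> n"
  proof
    fix x assume x: "x \<in> M m"
    then have "x [^] (p ^ n) = (x [^] (p ^ m)) [^] (p ^ (n - m))"
      using that by (simp add: M_def nat_pow_pow power_add[symmetric])
    then show "x \<in> M n"
      using x subgroup_nat_pow_closed[OF L(1)] by (simp add: M_def)
  qed
qed

lemma Union_power_preimages:
  assumes L: "subgroup L G" "openin T L" and x: "x \<in> carrier G"
  shows "\<exists>n. x [^] (p ^ n) \<in> L"
proof -
  have "eventually (\<lambda>n. x [^] (p ^ n) \<in> L) sequentially"
    using pow_tendsto_one[OF x] L(2) subgroup.one_closed[OF L(1)] unfolding limitin_def by simp
  then show ?thesis unfolding eventually_sequentially by auto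
qed

lemma filtered_by_prime_pows:
  assumes L: "subgroup L G" "compactin T L" "openin T L"
  shows "filtered_group G T (\<lambda>j. pows (p ^ j) L)"
proof (intro filtered_group.intro filtered_group_axioms.intro)
  show "topological_group G T" "comm_group G" by unfold_locales
  have Lc: "L \<subseteq> carrier G" using subgroup.subset[OF L(1)] .
  have p0: "pows (p ^ 0) L = L" using pows_1[OF Lc] by simp
  show "subgroup (pows (p ^ j) L) G" for j by (rule pows_subgroup[OF L(1)])
  show "openin T (pows (p ^ j) L)" for j by (rule open_prime_pows[OF L])
  show "compactin T (pows (p ^ 0) L)" unfolding p0 by (rule L(2))
  show "pows (p ^ Suc j) L \<subseteq> pows (p ^ j) L" for j by (rule pows_dvd_subset[OF L(1)]) simp
  show "\<exists>j. pows (p ^ j) L \<subseteq> W" if "openin T W" "\<one> \<in> W" for W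
    using prime_pows_small[OF L(2) that] by auto
  let ?M = "\<lambda>n. {x \<in> carrier G. x [^] (p ^ n) \<in> L}"
  have "\<exists>F. finite F \<and> F \<subseteq> carrier G \<and> ?M n \<subseteq> F <#> L" for n
    using power_preimage_compact_open(4)[OF L] unfolding finitely_covered_def .
  then have "\<forall>n. \<exists>F. finite F \<and> F \<subseteq> carrier G \<and> ?M n \<subseteq> F <#> L" by (rule allI)
  from choice[OF this] obtain F where "\<forall>n. finite (F n) \<and> F n \<subseteq> carrier G \<and> ?M n \<subseteq> F n <#> L"
    by (rule exE)
  then have F: "\<And>n. finite (F n)" "\<And>n. F n \<subseteq> carrier G" "\<And>n. ?M n \<subseteq> F n <#> L"
    by simp_all
  have "carrier G \<subseteq> (\<Union>n. F n) <#> L"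
  proof
    fix x assume x: "x \<in> carrier G"
    then obtain n where "x \<in> ?M n" using Union_power_preimages[OF L(1,3) x] by blast
    then have "x \<in> F n <#> L" using F(3) by blast
    then show "x \<in> (\<Union>n. F n) <#> L" unfolding set_mult_def by blast
  qed
  moreover have "(\<Union>n. F n) <#> L \<subseteq> carrier G"
    using F(2) Lc by (intro setmult_subset_G) auto
  moreover have "countable (\<Union>n. F n)" using F(1) by (auto intro: countable_finite)
  ultimately show "\<exists>C. countable C \<and> C \<subseteq> carrier G \<and> carrier G = C <#> pows (p ^ 0) L"
    unfolding p0 using F(2) by (intro exI[of _ "\<Union>n. F n"]) auto
qed

lemma haar_left_haar_measure: "left_haar_measure G T (haar G T)"
proof -
  obtain L where L: "subgroup L G" "compactin T L" "openin T L" using ex_compact_open_subgroup by blast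
  have "\<exists>\<mu>. left_haar_measure G T \<mu>"
    by (rule filtered_group.ex_left_haar_measure[OF filtered_by_prime_pows[OF L]])
  then show ?thesis unfolding haar_def by (rule someI_ex)
qed

abbreviation "\<mu> \<equiv> haar G T"

lemma
  shows haar_sets: "sets \<mu> = sets (sigma (topspace T) {U. openin T U})"
    and haar_space_nonzero: "emeasure \<mu> (space \<mu>) \<noteq> 0"
    and haar_compact_finite: "compactin T K \<Longrightarrow> emeasure \<mu> K < \<infinity>"
    and haar_invariant: "g \<in> carrier G \<Longrightarrow> A \<in> sets \<mu> \<Longrightarrow> emeasure \<mu> (g <# A) = emeasure \<mu> A"
proof -
  note h = haar_left_haar_measure[unfolded left_haar_measure_def]
  show "sets \<mu> = sets (sigma (topspace T) {U. openin T U})" by (rule conjunct1[OF h])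
  show "emeasure \<mu> (space \<mu>) \<noteq> 0" by (rule conjunct1[OF conjunct2[OF h]])
  show "emeasure \<mu> K < \<infinity>" if "compactin T K"
    using conjunct1[OF conjunct2[OF conjunct2[OF h]]] that by simp
  show "emeasure \<mu> (g <# A) = emeasure \<mu> A" if "g \<in> carrier G" "A \<in> sets \<mu>"
    using conjunct2[OF conjunct2[OF conjunct2[OF conjunct2[OF conjunct2[OF h]]]]] that by simp
qed

lemma haar_sets_open:
  assumes U: "openin T U"
  shows "U \<in> sets \<mu>"
proof -
  have "{U. openin T U} \<subseteq> Pow (topspace T)" using openin_subset by auto
  then have "sets \<mu> = sigma_sets (topspace T) {U. openin T U}"
    using haar_sets by (simp add: sets_measure_of)
  then show "U \<in> sets \<mu>" using U by (auto intro: sigma_sets.Basic)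
qed

lemma haar_space: "space \<mu> = carrier G"
proof -
  have "{U. openin T U} \<subseteq> Pow (topspace T)" using openin_subset by auto
  then show ?thesis
    using sets_eq_imp_space_eq[OF haar_sets] by (simp add: space_measure_of topspace_eq)
qed

lemma haar_sets_closed:
  assumes "closedin T C"
  shows "C \<in> sets \<mu>"
proof -
  have "space \<mu> - (topspace T - C) \<in> sets \<mu>"
    using assms by (intro sets.compl_sets haar_sets_open) (simp add: closedin_def)
  moreover have "space \<mu> - (topspace T - C) = C"
    using closedin_subset[OF assms] unfolding haar_space topspace_eq by auto
  ultimately show ?thesis by simp
qed

lemma haar_compact_fmeasurable: "compactin T K \<Longrightarrow> K \<in> fmeasurable \<mu>"
  by (intro fmeasurableI haar_sets_closed compact_closed haar_compact_finite)

lemma haar_translate: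
  assumes "A \<in> sets \<mu>" "g \<in> carrier G"
  shows "measure \<mu> (g <# A) = measure \<mu> A"
  using haar_invariant[OF assms(2,1)] by (simp add: measure_def)

lemma haar_cover_le:
  assumes "A \<in> fmeasurable \<mu>" "compactin T H" "finite F" "F \<subseteq> carrier G" "A \<subseteq> F <#> H"
  shows "measure \<mu> A \<le> real (card F) * measure \<mu> H"
proof -
  have fm: "f <# H \<in> fmeasurable \<mu>" if "f \<in> F" for f
    using that assms by (intro haar_compact_fmeasurable compact_l_coset) auto
  have eq: "F <#> H = (\<Union>f\<in>F. f <# H)" by (auto simp: set_mult_def l_coset_def)
  have "measure \<mu> A \<le> measure \<mu> (\<Union>f\<in>F. f <# H)"
    using assms(5) unfolding eq
    by (intro measure_mono_fmeasurable fmeasurable.finite_UN assms(3) fm fmeasurableD[OF assms(1)])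
  also have "\<dots> \<le> (\<Sum>f\<in>F. measure \<mu> (f <# H))"
    by (intro measure_UNION_le assms(3) fmeasurableD fm)
  also have "\<dots> = (\<Sum>f\<in>F. measure \<mu> H)"
    using assms(4) haar_sets_closed[OF compact_closed[OF assms(2)]]
    by (intro sum.cong refl haar_translate) auto
  finally show ?thesis by simp
qed

text \<open>Countably many translates of a compact open subgroup cover the group.\<close>

lemma haar_compact_open_pos:
  assumes L: "subgroup L G" "compactin T L" "openin T L"
  shows "measure \<mu> L > 0"
proof (rule ccontr)
  assume "\<not> measure \<mu> L > 0"
  then have m0: "measure \<mu> L = 0" by (simp add: not_less measure_le_0_iff)
  interpret fil: filtered_group G T "\<lambda>j. pows (p ^ j) L" by (rule filtered_by_prime_pows[OF L])
  have Lc: "L \<subseteq> carrier G" using subgroup.subset[OF L(1)] .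
  obtain C where C: "countable C" "C \<subseteq> carrier G" "carrier G = C <#> L"
    using fil.countable_cosets pows_1[OF Lc] by auto
  have "c <# L \<in> null_sets \<mu>" if c: "c \<in> C" for c
  proof -
    have cc: "c \<in> carrier G" using c C by auto
    have "measure \<mu> (c <# L) = 0" using haar_translate[OF haar_sets_open[OF L(3)] cc] m0 by simp
    then have "emeasure \<mu> (c <# L) = 0"
      using emeasure_eq_measure2[OF haar_compact_fmeasurable[OF compact_l_coset[OF L(2) cc]]]
      by simp
    then show ?thesis using haar_sets_open[OF open_l_coset[OF L(3) cc]] by auto
  qed
  then have "(\<Union>c\<in>C. c <# L) \<in> null_sets \<mu>" using C(1) by (intro null_sets_UN') auto
  moreover have "(\<Union>c\<in>C. c <# L) = space \<mu>"
    unfolding haar_space using C(3) by (auto simp: set_mult_def l_coset_def)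
  ultimately have "emeasure \<mu> (space \<mu>) = 0" by auto
  then show False using haar_space_nonzero by simp
qed

lemma open_contains_compact_open_subgroup:
  assumes L: "subgroup L G" "compactin T L" "openin T L" and U: "U \<in> compact_nhds G T"
  obtains j where "j \<ge> k" "pows (p ^ j) L \<subseteq> U"
proof -
  have "openin T (T interior_of U)" "\<one> \<in> T interior_of U"
    using U by (auto simp: compact_nhds_def)
  then obtain n where "\<forall>m\<ge>n. pows (p ^ m) L \<subseteq> T interior_of U"
    using prime_pows_small[OF L(2)] by blast
  then show thesis using that[of "max n k"] interior_of_subset[of T U] by (meson max.cobounded1 max.cobounded2 order_trans)
qed

lemma
  assumes "\<phi> \<in> continuous_end G T"
  shows continuous_end_closed: "x \<in> carrier G \<Longrightarrow> (\<phi> ^^ k) x \<in> carrier G"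
    and continuous_end_mult: "x \<in> carrier G \<Longrightarrow> y \<in> carrier G \<Longrightarrow>
      (\<phi> ^^ k) (x \<otimes> y) = (\<phi> ^^ k) x \<otimes> (\<phi> ^^ k) y"
    and continuous_end_continuous: "continuous_map T T (\<phi> ^^ k)"
proof -
  have h: "\<phi> \<in> hom G G" "continuous_map T T \<phi>" using assms by (auto simp: continuous_end_def)
  show c: "x \<in> carrier G \<Longrightarrow> (\<phi> ^^ k) x \<in> carrier G" for x k
    by (induction k) (use hom_in_carrier[OF h(1)] in auto)
  show "x \<in> carrier G \<Longrightarrow> y \<in> carrier G \<Longrightarrow> (\<phi> ^^ k) (x \<otimes> y) = (\<phi> ^^ k) x \<otimes> (\<phi> ^^ k) y"
    by (induction k) (use hom_mult[OF h(1)] c in auto)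
  show "continuous_map T T (\<phi> ^^ k)"
  proof (induction k)
    case (Suc k)
    from continuous_map_compose[OF Suc h(2)] show ?case by (simp add: comp_def)
  qed simp
qed

lemma continuous_end_group_hom: "\<phi> \<in> continuous_end G T \<Longrightarrow> (\<phi> ^^ k) \<in> hom G G"
  by (intro homI) (use continuous_end_closed continuous_end_mult in auto)

lemma cotrajectory_mono: "U \<subseteq> V \<Longrightarrow> cotrajectory G \<phi> U n \<subseteq> cotrajectory G \<phi> V n"
  by (auto simp: cotrajectory_def)

lemma cotrajectory_Suc:
  "cotrajectory G \<phi> U (Suc n) = cotrajectory G \<phi> U n \<inter> {x \<in> carrier G. (\<phi> ^^ n) x \<in> U}"
  by (auto simp: cotrajectory_def less_Suc_eq)

lemma cotrajectory_subset: "n \<ge> 1 \<Longrightarrow> cotrajectory G \<phi> U n \<subseteq> U"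
  by (force simp: cotrajectory_def)

lemma cotrajectory_1: "U \<subseteq> carrier G \<Longrightarrow> cotrajectory G \<phi> U (Suc 0) = U"
  by (auto simp: cotrajectory_def)

lemma cotrajectory_closed:
  assumes "\<phi> \<in> continuous_end G T" "closedin T U"
  shows "closedin T (cotrajectory G \<phi> U n)"
proof (induction n)
  case 0
  have "cotrajectory G \<phi> U 0 = topspace T" by (simp add: cotrajectory_def topspace_eq)
  then show ?case by simp
next
  case (Suc n)
  have "closedin T {x \<in> topspace T. (\<phi> ^^ n) x \<in> U}"
    by (rule closedin_continuous_map_preimage[OF continuous_end_continuous[OF assms(1)] assms(2)])
  then show ?case using Suc unfolding cotrajectory_Suc topspace_eq by (rule closedin_Int[rotated])
qed

lemma cotrajectory_compact:
  assumes "\<phi> \<in> continuous_end G T" "compactin T U" "n \<ge> 1"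
  shows "compactin T (cotrajectory G \<phi> U n)"
  by (rule closed_compactin[OF assms(2) cotrajectory_subset[OF assms(3)]
        cotrajectory_closed[OF assms(1) compact_closed[OF assms(2)]]])

lemma cotrajectory_subgroup:
  assumes "\<phi> \<in> continuous_end G T" "subgroup H G"
  shows "subgroup (cotrajectory G \<phi> H n) G"
proof (rule subgroupI)
  interpret hom: group_hom G G "\<phi> ^^ k" for k
    using continuous_end_group_hom[OF assms(1)] by unfold_locales
  show "cotrajectory G \<phi> H n \<subseteq> carrier G" by (auto simp: cotrajectory_def)
  have "\<one> \<in> cotrajectory G \<phi> H n"
    using subgroup.one_closed[OF assms(2)] by (simp add: cotrajectory_def)
  then show "cotrajectory G \<phi> H n \<noteq> {}" by blast
  show "inv x \<in> cotrajectory G \<phi> H n" if "x \<in> cotrajectory G \<phi> H n" for x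
    using that subgroup.m_inv_closed[OF assms(2)] by (simp add: cotrajectory_def)
  show "x \<otimes> y \<in> cotrajectory G \<phi> H n" if "x \<in> cotrajectory G \<phi> H n" "y \<in> cotrajectory G \<phi> H n" for x y
    using that subgroup.m_closed[OF assms(2)] by (simp add: cotrajectory_def)
qed

text \<open>If \<open>\<phi> (H)\<close> meets at most \<open>N\<close> cosets of the subgroup \<open>H\<close>, then each step of the cotrajectory
  of \<open>H\<close> has index at most \<open>N\<close>: the \<open>n\<close>-th iterate sends \<open>C\<^sub>n\<close> into \<open>\<phi> (H)\<close>, and two points of
  \<open>C\<^sub>n\<close> whose images lie in the same coset of \<open>H\<close> differ by an element of \<open>C\<^sub>n\<^sub>+\<^sub>1\<close>.\<close>

lemma measure_cotrajectory_Suc_ge: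
  assumes \<phi>: "\<phi> \<in> continuous_end G T" and H: "subgroup H G" "compactin T H"
    and F: "finite F" "card F \<le> N" "F \<subseteq> carrier G" "\<phi> ` H \<subseteq> F <#> H"
  shows "measure \<mu> H \<le> real N ^ n * measure \<mu> (cotrajectory G \<phi> H (Suc n))"
proof (induction n)
  case 0
  then show ?case using cotrajectory_1[OF subgroup.subset[OF H(1)]] by simp
next
  case (Suc n)
  let ?C = "\<lambda>n. cotrajectory G \<phi> H n"
  interpret hom: group_hom G G "\<phi> ^^ k" for k
    using continuous_end_group_hom[OF \<phi>] by unfold_locales
  define P where "P f x \<longleftrightarrow> x \<in> ?C (Suc n) \<and> (\<phi> ^^ Suc n) x \<in> f <# H" for f x
  define r where "r f = (SOME x. P f x)" for f
  let ?E = "r ` {f \<in> F. \<exists>x. P f x}"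
  have r: "P f (r f)" if "P f x" for f x unfolding r_def using that by (rule someI)
  have Cc: "?C m \<subseteq> carrier G" for m by (auto simp: cotrajectory_def)
  have Csub: "subgroup (?C m) G" for m by (rule cotrajectory_subgroup[OF \<phi> H(1)])
  have Ec: "?E \<subseteq> carrier G" using r Cc unfolding P_def by blast
  have "?C (Suc n) \<subseteq> ?E <#> ?C (Suc (Suc n))"
  proof
    fix x assume x: "x \<in> ?C (Suc n)"
    then have xc: "x \<in> carrier G" using Cc by blast
    have "(\<phi> ^^ n) x \<in> H" using x by (auto simp: cotrajectory_def)
    then have "(\<phi> ^^ Suc n) x \<in> F <#> H" using F(4) by auto
    then obtain f where f: "f \<in> F" "(\<phi> ^^ Suc n) x \<in> f <# H"
      unfolding set_mult_def l_coset_def by blast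
    then have P: "P f x" using x by (simp add: P_def)
    then have Pr: "P f (r f)" by (rule r)
    then have rc: "r f \<in> carrier G" "r f \<in> ?C (Suc n)" using Cc unfolding P_def by blast+
    obtain h h' where h: "h \<in> H" "(\<phi> ^^ Suc n) x = f \<otimes> h" "h' \<in> H" "(\<phi> ^^ Suc n) (r f) = f \<otimes> h'"
      using f(2) Pr unfolding P_def l_coset_def by blast
    define y where "y = inv (r f) \<otimes> x"
    have yc: "y \<in> carrier G" using rc xc by (simp add: y_def)
    have hc: "h \<in> carrier G" "h' \<in> carrier G" "f \<in> carrier G"
      using h subgroup.mem_carrier[OF H(1)] f(1) F(3) by auto
    have "(\<phi> ^^ Suc n) y = inv (f \<otimes> h') \<otimes> (f \<otimes> h)"
      unfolding y_def using rc xc h(2,4) by (simp only: hom.hom_mult hom.hom_inv inv_closed)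
    also have "\<dots> = inv h' \<otimes> (inv f \<otimes> f) \<otimes> h"
      using hc by (simp add: inv_mult_group m_assoc del: l_inv Units_l_inv)
    also have "\<dots> = inv h' \<otimes> h" using hc by simp
    also have "\<dots> \<in> H" by (intro subgroup.m_closed[OF H(1)] subgroup.m_inv_closed[OF H(1)] h)
    finally have "(\<phi> ^^ Suc n) y \<in> H" .
    moreover have "y \<in> ?C (Suc n)"
      unfolding y_def by (intro subgroup.m_closed[OF Csub] subgroup.m_inv_closed[OF Csub] rc x)
    ultimately have "y \<in> ?C (Suc (Suc n))" using yc by (simp only: cotrajectory_Suc[of _ _ "Suc n"]) simp
    moreover have "x = r f \<otimes> y" unfolding y_def using rc xc by (simp add: m_assoc[symmetric])
    moreover have "r f \<in> ?E" using f(1) P by blast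
    ultimately show "x \<in> ?E <#> ?C (Suc (Suc n))" by (intro set_mult_memI)
  qed
  then have "measure \<mu> (?C (Suc n)) \<le> real (card ?E) * measure \<mu> (?C (Suc (Suc n)))"
    using F(1) Ec
    by (intro haar_cover_le haar_compact_fmeasurable cotrajectory_compact[OF \<phi> H(2)]) auto
  also have "card ?E \<le> N"
  proof -
    have "card ?E \<le> card {f \<in> F. \<exists>x. P f x}" using F(1) by (intro card_image_le) auto
    also have "\<dots> \<le> card F" using F(1) by (intro card_mono) auto
    finally show ?thesis using F(2) by simp
  qed
  then have "real (card ?E) * measure \<mu> (?C (Suc (Suc n))) \<le> real N * measure \<mu> (?C (Suc (Suc n)))"
    by (intro mult_right_mono) auto
  finally have "measure \<mu> (?C (Suc n)) \<le> real N * measure \<mu> (?C (Suc (Suc n)))" .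
  then have "real N ^ n * measure \<mu> (?C (Suc n)) \<le> real N ^ n * (real N * measure \<mu> (?C (Suc (Suc n))))"
    by (rule mult_left_mono) simp
  then show ?case using Suc by (simp add: mult_ac)
qed

end

section \<open>Bounds for the entropy\<close>

context finite_rank_p_group
begin

lemma continuous_end_image_pows:
  assumes "\<phi> \<in> continuous_end G T" "A \<subseteq> carrier G"
  shows "\<phi> ` pows n A = pows n (\<phi> ` A)"
proof -
  interpret hom: group_hom G G \<phi>
    using assms(1) by unfold_locales (auto simp: continuous_end_def)
  have "\<phi> (x [^] n) = \<phi> x [^] n" if "x \<in> A" for x
    using assms(2) that by (intro hom.hom_nat_pow) auto
  then show ?thesis by (force simp: pows_def image_image)
qed

lemma continuous_end_image_cover:
  assumes \<phi>: "\<phi> \<in> continuous_end G T" and L: "subgroup L G" "compactin T L" "openin T L"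
  obtains F where "finite F" "F \<subseteq> carrier G" "\<phi> ` L \<subseteq> F <#> L" "F \<noteq> {}"
proof -
  have h: "continuous_map T T \<phi>" using \<phi> by (auto simp: continuous_end_def)
  obtain F where F: "finite F" "F \<subseteq> \<phi> ` L" "\<phi> ` L \<subseteq> F <#> L"
    by (rule compact_finite_cover[OF image_compactin[OF L(2) h] L(3) subgroup.one_closed[OF L(1)]])
  moreover have "F \<noteq> {}"
    using F(3) subgroup.one_closed[OF L(1)] by (auto simp: set_mult_def)
  moreover have "F \<subseteq> carrier G"
    using F(2) compact_subset_carrier[OF image_compactin[OF L(2) h]] by blast
  ultimately show thesis using that by blast
qed

lemma image_pows_cover:
  assumes \<phi>: "\<phi> \<in> continuous_end G T" and L: "L \<subseteq> carrier G"
    and F: "F \<subseteq> carrier G" "\<phi> ` L \<subseteq> F <#> L"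
  shows "\<phi> ` pows n L \<subseteq> pows n F <#> pows n L"
  using pows_mono[OF F(2), of n] unfolding continuous_end_image_pows[OF \<phi> L] pows_set_mult[OF F(1) L] .

lemma cotrajectory_measure_ge:
  assumes \<phi>: "\<phi> \<in> continuous_end G T" and H: "subgroup H G" "compactin T H" "openin T H"
    and F: "finite F" "card F \<le> N" "N > 0" "F \<subseteq> carrier G" "\<phi> ` H \<subseteq> F <#> H"
    and U: "compactin T U" "H \<subseteq> U" and n: "n \<ge> 1"
  shows "measure \<mu> (cotrajectory G \<phi> U n) \<ge> measure \<mu> H / real N ^ n"
    and "measure \<mu> (cotrajectory G \<phi> U n) > 0"
proof -
  obtain m where m: "n = Suc m" using n by (cases n) auto
  have "measure \<mu> H \<le> real N ^ m * measure \<mu> (cotrajectory G \<phi> H n)"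
    unfolding m by (rule measure_cotrajectory_Suc_ge[OF \<phi> H(1,2) F(1,2,4,5)])
  also have "\<dots> \<le> real N ^ n * measure \<mu> (cotrajectory G \<phi> H n)"
    using F(3) m by (intro mult_right_mono power_increasing) auto
  also have "\<dots> \<le> real N ^ n * measure \<mu> (cotrajectory G \<phi> U n)"
    using haar_compact_fmeasurable cotrajectory_compact[OF \<phi>] H(2) U n
    by (intro mult_left_mono measure_mono_fmeasurable cotrajectory_mono fmeasurableD) auto
  finally have "measure \<mu> H \<le> real N ^ n * measure \<mu> (cotrajectory G \<phi> U n)" .
  then show ge: "measure \<mu> (cotrajectory G \<phi> U n) \<ge> measure \<mu> H / real N ^ n"
    using F(3) by (simp add: field_simps)
  have "measure \<mu> H / real N ^ n > 0" using haar_compact_open_pos[OF H] F(3) by simp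
  then show "measure \<mu> (cotrajectory G \<phi> U n) > 0" using ge by linarith
qed

lemma affine_rate_tendsto: "(\<lambda>n. ereal ((a + real n * b) / real n)) \<longlonglongrightarrow> ereal b"
proof -
  have lim: "(\<lambda>n. a / real n + b) \<longlonglongrightarrow> 0 + b"
    by (intro tendsto_intros lim_const_over_n)
  have "eventually (\<lambda>n. a / real n + b = (a + real n * b) / real n) sequentially"
    using eventually_gt_at_top[of 0] by eventually_elim (simp add: field_simps)
  from Lim_transform_eventually[OF lim this]
  have "(\<lambda>n. (a + real n * b) / real n) \<longlonglongrightarrow> b" by simp
  then show ?thesis by (rule tendsto_ereal)
qed

text \<open>Each step shrinks the cotrajectory of \<open>H\<close> by a factor of at most \<open>N\<close>, and the cotrajectory of
  \<open>U\<close> is larger.\<close>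

lemma H_top_le:
  assumes \<phi>: "\<phi> \<in> continuous_end G T" and H: "subgroup H G" "compactin T H" "openin T H"
    and F: "finite F" "card F \<le> N" "N > 0" "F \<subseteq> carrier G" "\<phi> ` H \<subseteq> F <#> H"
    and U: "compactin T U" "H \<subseteq> U"
  shows "H_top G T \<phi> U \<le> ereal (ln (real N))"
proof -
  let ?m = "\<lambda>n. measure \<mu> (cotrajectory G \<phi> U n)"
  let ?b = "\<lambda>n. ereal ((- ln (measure \<mu> H) + real n * ln (real N)) / real n)"
  have "H_top G T \<phi> U \<le> limsup ?b"
    unfolding H_top_def
  proof (rule Limsup_mono, rule eventually_mono[OF eventually_ge_at_top[of 1]])
    fix n :: nat assume n: "n \<ge> 1"
    note m = cotrajectory_measure_ge[OF \<phi> H F U n]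
    have "ln (measure \<mu> H / real N ^ n) \<le> ln (?m n)"
      using m haar_compact_open_pos[OF H] F(3) by (subst ln_le_cancel_iff) auto
    then have "- ln (?m n) \<le> - ln (measure \<mu> H) + real n * ln (real N)"
      using haar_compact_open_pos[OF H] F(3) by (simp add: ln_div ln_realpow)
    then show "ereal (- ln (?m n) / real n) \<le> ?b n"
      unfolding ereal_less_eq by (rule divide_right_mono) simp
  qed
  also have "limsup ?b = ereal (ln (real N))"
    by (rule lim_imp_Limsup[OF _ affine_rate_tendsto]) simp
  finally show ?thesis .
qed

text \<open>Cotrajectories stay inside \<open>U\<close>, so their measure is bounded above; it is positive
  because they contain those of a compact open subgroup inside \<open>U\<close>.\<close>

lemma H_top_nonneg:
  assumes \<phi>: "\<phi> \<in> continuous_end G T" and U: "U \<in> compact_nhds G T"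
  shows "H_top G T \<phi> U \<ge> 0"
proof -
  obtain L where L: "subgroup L G" "compactin T L" "openin T L" using ex_compact_open_subgroup by blast
  obtain j where j: "pows (p ^ j) L \<subseteq> U" by (rule open_contains_compact_open_subgroup[OF L U])
  let ?H = "pows (p ^ j) L"
  have H: "subgroup ?H G" "compactin T ?H" "openin T ?H"
    by (rule pows_subgroup[OF L(1)], rule compact_pows[OF L(2)], rule open_prime_pows[OF L])
  obtain F where F: "finite F" "F \<subseteq> carrier G" "\<phi> ` ?H \<subseteq> F <#> ?H" "F \<noteq> {}"
    by (rule continuous_end_image_cover[OF \<phi> H])
  have N: "card F > 0" using F by (simp add: card_gt_0_iff)
  have Uc: "compactin T U" using U by (simp add: compact_nhds_def)
  let ?m = "\<lambda>n. measure \<mu> (cotrajectory G \<phi> U n)"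
  let ?b = "\<lambda>n. ereal ((- ln (measure \<mu> U) + real n * 0) / real n)"
  have "limsup ?b = 0"
    using lim_imp_Limsup[OF _ affine_rate_tendsto, of "- ln (measure \<mu> U)" 0]
    by (simp add: zero_ereal_def)
  moreover have "limsup ?b \<le> H_top G T \<phi> U"
    unfolding H_top_def
  proof (rule Limsup_mono, rule eventually_mono[OF eventually_ge_at_top[of 1]])
    fix n :: nat assume n: "n \<ge> 1"
    have pos: "?m n > 0"
      by (rule cotrajectory_measure_ge(2)[OF \<phi> H F(1) order_refl N F(2,3) Uc j n])
    have "?m n \<le> measure \<mu> U"
      using haar_compact_fmeasurable Uc cotrajectory_compact[OF \<phi> Uc n] n
      by (intro measure_mono_fmeasurable cotrajectory_subset fmeasurableD) auto
    then have "ln (?m n) \<le> ln (measure \<mu> U)" using pos by simp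
    then have "- ln (measure \<mu> U) + real n * 0 \<le> - ln (?m n)" by simp
    then show "?b n \<le> ereal (- ln (?m n) / real n)"
      unfolding ereal_less_eq by (rule divide_right_mono) simp
  qed
  ultimately show ?thesis by simp
qed

lemma compact_open_subgroup_nhd:
  assumes "subgroup L G" "compactin T L" "openin T L"
  shows "L \<in> compact_nhds G T"
  using assms subgroup.one_closed[OF assms(1)] by (simp add: compact_nhds_def interior_of_openin)

lemma h_top_nonneg:
  assumes "\<phi> \<in> continuous_end G T"
  shows "h_top G T \<phi> \<ge> 0"
proof -
  obtain L where L: "subgroup L G" "compactin T L" "openin T L" using ex_compact_open_subgroup by blast
  have "H_top G T \<phi> L \<le> h_top G T \<phi>"
    unfolding h_top_def by (rule SUP_upper[OF compact_open_subgroup_nhd[OF L]])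
  then show ?thesis
    using H_top_nonneg[OF assms compact_open_subgroup_nhd[OF L]] by (rule order_trans[rotated])
qed

text \<open>\<open>H_top\<close> increases when \<open>U\<close> shrinks, so bounding it on a neighbourhood base by one \<open>N\<close> suffices.\<close>

lemma h_top_le:
  assumes \<phi>: "\<phi> \<in> continuous_end G T" and L: "subgroup L G" "compactin T L" "openin T L"
    and N: "N > 0" and cov: "\<And>j. j \<ge> k \<Longrightarrow> \<exists>F. finite F \<and> card F \<le> N \<and> F \<subseteq> carrier G \<and>
      \<phi> ` pows (p ^ j) L \<subseteq> F <#> pows (p ^ j) L"
  shows "h_top G T \<phi> \<le> ereal (ln (real N))"
  unfolding h_top_def
proof (rule SUP_least)
  fix U assume U: "U \<in> compact_nhds G T"
  obtain j where j: "j \<ge> k" "pows (p ^ j) L \<subseteq> U"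
    by (rule open_contains_compact_open_subgroup[OF L U])
  obtain F where F: "finite F" "card F \<le> N" "F \<subseteq> carrier G"
    "\<phi> ` pows (p ^ j) L \<subseteq> F <#> pows (p ^ j) L" using cov[OF j(1)] by blast
  have Uc: "compactin T U" using U by (simp add: compact_nhds_def)
  show "H_top G T \<phi> U \<le> ereal (ln (real N))"
    by (rule H_top_le[OF \<phi> pows_subgroup[OF L(1)] compact_pows[OF L(2)] open_prime_pows[OF L]
          F(1,2) N F(3,4) Uc j(2)])
qed

text \<open>Taking \<open>p\<^sup>j\<close>-th powers turns a cover of \<open>\<phi> (L)\<close> by \<open>N\<close> cosets of \<open>L\<close> into one of \<open>\<phi> (L\<^bsup>p^j\<^esup>)\<close> by
  \<open>N\<close> cosets of \<open>L\<^bsup>p^j\<^esup>\<close>.\<close>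

theorem finite_entropy: "class_E_finite G T"
  unfolding class_E_finite_def
proof (intro conjI ballI)
  show "locally_compact_group G T" by unfold_locales
  fix \<phi> assume \<phi>: "\<phi> \<in> continuous_end G T"
  obtain L where L: "subgroup L G" "compactin T L" "openin T L" using ex_compact_open_subgroup by blast
  have Lc: "L \<subseteq> carrier G" using subgroup.subset[OF L(1)] .
  obtain F where F: "finite F" "F \<subseteq> carrier G" "\<phi> ` L \<subseteq> F <#> L" "F \<noteq> {}"
    by (rule continuous_end_image_cover[OF \<phi> L])
  have N: "card F > 0" using F by (simp add: card_gt_0_iff)
  have "h_top G T \<phi> \<le> ereal (ln (real (card F)))"
  proof (rule h_top_le[OF \<phi> L N, of 0])
    fix j
    have "card (pows (p ^ j) F) \<le> card F" unfolding pows_def by (rule card_image_le[OF F(1)])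
    moreover have "finite (pows (p ^ j) F)" using F(1) by (simp add: pows_def)
    ultimately show "\<exists>E. finite E \<and> card E \<le> card F \<and> E \<subseteq> carrier G \<and>
        \<phi> ` pows (p ^ j) L \<subseteq> E <#> pows (p ^ j) L"
      using image_pows_cover[OF \<phi> Lc F(2,3)] pows_carrier[OF F(2)] by blast
  qed
  also have "\<dots> < \<infinity>" by simp
  finally show "h_top G T \<phi> < \<infinity>" .
qed

text \<open>If \<open>L\<close> and the torsion elements generate \<open>G\<close>, then \<open>\<phi> (L)\<close> is covered by finitely many
  torsion translates of \<open>L\<close>, which disappear after taking \<open>p\<^sup>j\<close>-th powers: \<open>L\<^bsup>p^j\<^esup>\<close> is
  invariant for large \<open>j\<close>.\<close>

lemma zero_entropy:
  assumes \<phi>: "\<phi> \<in> continuous_end G T" and L: "subgroup L G" "compactin T L" "openin T L"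
    and LT: "\<And>x. x \<in> carrier G \<Longrightarrow> \<exists>l\<in>L. \<exists>t\<in>carrier G. x = l \<otimes> t \<and> (\<exists>k. t [^] (p ^ k) = \<one>)"
  shows "h_top G T \<phi> = 0"
proof -
  have Lc: "L \<subseteq> carrier G" using subgroup.subset[OF L(1)] .
  obtain F where F: "finite F" "F \<subseteq> carrier G" "\<phi> ` L \<subseteq> F <#> L" "F \<noteq> {}"
    by (rule continuous_end_image_cover[OF \<phi> L])
  have "\<forall>f\<in>F. \<exists>t. t \<in> carrier G \<and> (\<exists>l\<in>L. f = l \<otimes> t) \<and> (\<exists>k. t [^] (p ^ k) = \<one>)"
    using LT F(2) by blast
  from bchoice[OF this] obtain t where t: "\<And>f. f \<in> F \<Longrightarrow> t f \<in> carrier G"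
    "\<And>f. f \<in> F \<Longrightarrow> \<exists>l\<in>L. f = l \<otimes> t f" "\<And>f. f \<in> F \<Longrightarrow> \<exists>k. t f [^] (p ^ k) = \<one>" by blast
  have "\<forall>f\<in>F. \<exists>k. t f [^] (p ^ k) = \<one>" using t(3) by blast
  from bchoice[OF this] obtain k where k: "\<And>f. f \<in> F \<Longrightarrow> t f [^] (p ^ k f) = \<one>" by blast
  define K where "K = Max (k ` F)"
  have tj: "t f [^] (p ^ j) = \<one>" if f: "f \<in> F" and j: "j \<ge> K" for f j
  proof -
    have "k f \<le> K" unfolding K_def using F(1) f by (intro Max_ge) auto
    then have "p ^ j = p ^ k f * p ^ (j - k f)" using j by (simp add: power_add[symmetric])
    then show ?thesis using k[OF f] t(1)[OF f] by (simp add: nat_pow_pow[symmetric])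
  qed
  have cov: "\<phi> ` L \<subseteq> t ` F <#> L"
  proof
    fix y assume "y \<in> \<phi> ` L"
    then obtain f l where fl: "f \<in> F" "l \<in> L" "y = f \<otimes> l" using F(3) unfolding set_mult_def by blast
    obtain l' where l': "l' \<in> L" "f = l' \<otimes> t f" using t(2)[OF fl(1)] by blast
    have c: "l \<in> carrier G" "l' \<in> carrier G" "t f \<in> carrier G" using fl l' Lc t(1) by auto
    have "y = (l' \<otimes> t f) \<otimes> l" using fl(3) l'(2) by simp
    also have "\<dots> = t f \<otimes> (l' \<otimes> l)" using c by (simp add: m_ac)
    finally show "y \<in> t ` F <#> L"
      using fl(1) subgroup.m_closed[OF L(1) l'(1) fl(2)] by (intro set_mult_memI) auto
  qed
  have "h_top G T \<phi> \<le> ereal (ln (real 1))"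
  proof (rule h_top_le[OF \<phi> L, of 1 K])
    fix j assume j: "j \<ge> K"
    have "pows (p ^ j) (t ` F) \<subseteq> {\<one>}" using tj[OF _ j] by (auto simp: pows_def)
    moreover have "\<phi> ` pows (p ^ j) L \<subseteq> pows (p ^ j) (t ` F) <#> pows (p ^ j) L"
      using t(1) by (intro image_pows_cover[OF \<phi> Lc _ cov]) auto
    ultimately have "\<phi> ` pows (p ^ j) L \<subseteq> {\<one>} <#> pows (p ^ j) L"
      using set_mult_mono[OF _ order_refl] by blast
    then show "\<exists>E. finite E \<and> card E \<le> 1 \<and> E \<subseteq> carrier G \<and> \<phi> ` pows (p ^ j) L \<subseteq> E <#> pows (p ^ j) L"
      by (intro exI[of _ "{\<one>}"]) auto
  qed simp
  then have "h_top G T \<phi> \<le> 0" by (simp add: zero_ereal_def)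
  then show ?thesis using h_top_nonneg[OF \<phi>] by (rule antisym)
qed

lemma closed_l_coset:
  assumes "closedin T C" "g \<in> carrier G"
  shows "closedin T (g <# C)"
proof -
  have Cc: "C \<subseteq> carrier G" using closedin_subset[OF assms(1)] topspace_eq by simp
  have "continuous_map T T (\<lambda>x. inv g \<otimes> x)"
    using assms by (intro continuous_map_mult continuous_map_constI) auto
  from closedin_continuous_map_preimage[OF this assms(1)]
  have "closedin T {x \<in> carrier G. inv g \<otimes> x \<in> C}" by (simp add: topspace_eq)
  moreover have "{x \<in> carrier G. inv g \<otimes> x \<in> C} = g <# C"
    using mem_l_coset_iff[OF assms(2) Cc] l_coset_subset_G[OF Cc assms(2)] by auto
  ultimately show ?thesis by simp
qed

text \<open>If \<open>G/G\<^sup>p\<close> is finite, some compact open \<open>L\<close> satisfies \<open>G = L \<cdot> G\<^sup>p\<close>, hence \<open>G = L \<cdot> G\<^bsup>p^j\<^esup>\<close> for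
  all \<open>j\<close>.  The subgroups \<open>G\<^bsup>p^j\<^esup>\<close> are open, hence closed, so by compactness of \<open>L\<close> every \<open>x\<close> has an \<open>l \<in> L\<close> that
  works for all \<open>j\<close>.\<close>

lemma compact_times_divisible_part:
  assumes "finitely_covered (carrier G) (pows p (carrier G))"
  obtains L where "subgroup L G" "compactin T L" "openin T L"
    "\<And>x. x \<in> carrier G \<Longrightarrow> \<exists>l\<in>L. \<exists>t. (\<forall>j. t \<in> pows (p ^ j) (carrier G)) \<and> x = l \<otimes> t"
proof -
  obtain A where A: "finite A" "A \<subseteq> carrier G" "carrier G \<subseteq> A <#> pows p (carrier G)"
    using assms by (rule finitely_coveredE)
  obtain L0 where L0: "subgroup L0 G" "compactin T L0" "openin T L0"
    using ex_compact_open_subgroup by blast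
  let ?M = "\<lambda>n. {x \<in> carrier G. x [^] (p ^ n) \<in> L0}"
  note M = power_preimage_compact_open[OF L0]
  have "\<forall>a\<in>A. \<exists>n. a [^] (p ^ n) \<in> L0" using Union_power_preimages[OF L0(1,3)] A(2) by blast
  from bchoice[OF this] obtain k where k: "\<And>a. a \<in> A \<Longrightarrow> a [^] (p ^ k a) \<in> L0" by blast
  define L where "L = ?M (Max (k ` A))"
  have L: "subgroup L G" "compactin T L" "openin T L" unfolding L_def by (rule M)+
  have Lc: "L \<subseteq> carrier G" using subgroup.subset[OF L(1)] .
  have AL: "A \<subseteq> L"
  proof
    fix a assume a: "a \<in> A"
    then have "a \<in> ?M (k a)" using k A(2) by blast
    moreover have "k a \<le> Max (k ` A)" using a A(1) by (intro Max_ge) auto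
    ultimately show "a \<in> L" unfolding L_def using M(6) by blast
  qed
  let ?D = "\<lambda>j. pows (p ^ j) (carrier G)"
  have D: "subgroup (?D j) G" for j by (rule pows_subgroup[OF subgroup_self])
  have Dcl: "closedin T (?D j)" for j
  proof (rule open_subgroup_closed[OF D])
    show "openin T (?D j)"
      using open_prime_pows[OF L, of j] subgroup.one_closed[OF pows_subgroup[OF L(1)]] pows_mono[OF Lc]
      by (intro open_subgroupI[OF D])
  qed
  have LD: "\<exists>l\<in>L. \<exists>y\<in>carrier G. x = l \<otimes> y [^] (p ^ j)" if x: "x \<in> carrier G" for x j
    using x
  proof (induction j arbitrary: x)
    case 0
    then have "x = \<one> \<otimes> x [^] (p ^ 0)" by simp
    then show ?case using subgroup.one_closed[OF L(1)] 0 by blast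
  next
    case (Suc j)
    then obtain l y where l: "l \<in> L" "y \<in> carrier G" "x = l \<otimes> y [^] (p ^ j)" by blast
    obtain a z where a: "a \<in> A" "z \<in> carrier G" "y = a \<otimes> z [^] p"
      using A(3) l(2) unfolding set_mult_def pows_def by blast
    have c: "a \<in> carrier G" "l \<in> carrier G" using a(1) A(2) l(1) Lc by auto
    have "x = l \<otimes> (a [^] (p ^ j) \<otimes> z [^] (p ^ Suc j))"
      using a(2,3) c l(3) by (simp add: nat_pow_distrib nat_pow_pow)
    then have "x = (l \<otimes> a [^] (p ^ j)) \<otimes> z [^] (p ^ Suc j)"
      using a(2) c by (simp add: m_assoc)
    moreover have "l \<otimes> a [^] (p ^ j) \<in> L"
      using a(1) AL by (intro subgroup.m_closed[OF L(1)] l subgroup_nat_pow_closed[OF L(1)]) auto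
    ultimately show ?case using a(2) by blast
  qed
  show thesis
  proof (rule that[OF L])
    fix x assume x: "x \<in> carrier G"
    define C where "C j = x <# ?D j" for j
    have Ccl: "\<forall>K\<in>range C. closedin T K" unfolding C_def using closed_l_coset[OF Dcl x] by blast
    have dec: "C j \<subseteq> C i" if "i \<le> j" for i j
    proof -
      have "?D j \<subseteq> ?D i" by (rule pows_dvd_subset[OF subgroup_self]) (rule le_imp_power_dvd[OF that])
      then show ?thesis unfolding C_def l_coset_def by blast
    qed
    have ne: "L \<inter> C j \<noteq> {}" for j
    proof -
      obtain l y where l: "l \<in> L" "y \<in> carrier G" "x = l \<otimes> y [^] (p ^ j)" using LD[OF x] by blast
      have lc: "l \<in> carrier G" using l(1) Lc by auto
      have "l = x \<otimes> inv (y [^] (p ^ j))" unfolding l(3) using l(2) lc by (simp add: m_assoc)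
      moreover have "inv (y [^] (p ^ j)) \<in> ?D j"
        using l(2) by (intro subgroup.m_inv_closed[OF D]) (auto simp: pows_def)
      ultimately have "l \<in> C j" unfolding C_def l_coset_def by blast
      then show ?thesis using l(1) by blast
    qed
    have "\<forall>\<F>. finite \<F> \<and> \<F> \<subseteq> range C \<longrightarrow> L \<inter> \<Inter>\<F> \<noteq> {}"
    proof (intro allI impI, elim conjE)
      fix \<F> assume "finite \<F>" "\<F> \<subseteq> range C"
      then obtain J where J: "finite J" "\<F> = C ` J" using finite_subset_image[of \<F> C UNIV] by auto
      have "C (Max (insert 0 J)) \<subseteq> C j" if "j \<in> J" for j
        using that J(1) by (intro dec Max_ge) auto
      then have "C (Max (insert 0 J)) \<subseteq> \<Inter>\<F>" unfolding J(2) by blast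
      then show "L \<inter> \<Inter>\<F> \<noteq> {}" using ne[of "Max (insert 0 J)"] by blast
    qed
    with Ccl have "L \<inter> \<Inter>(range C) \<noteq> {}" using L(2) unfolding compactin_fip by blast
    then obtain l where l: "l \<in> L" "\<And>j. l \<in> C j" by blast
    have lc: "l \<in> carrier G" using l(1) Lc by auto
    have "inv l \<otimes> x \<in> ?D j" for j
    proof -
      obtain d where d: "d \<in> ?D j" "l = x \<otimes> d" using l(2)[of j] unfolding C_def l_coset_def by blast
      then have dc: "d \<in> carrier G" using subgroup.mem_carrier[OF D] by blast
      have "inv l \<otimes> x = inv d" unfolding d(2) using x dc by (simp add: inv_mult_group m_assoc)
      then show ?thesis using subgroup.m_inv_closed[OF D d(1)] by simp
    qed
    moreover have "x = l \<otimes> (inv l \<otimes> x)" using lc x by (simp add: m_assoc[symmetric])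
    ultimately show "\<exists>l\<in>L. \<exists>t. (\<forall>j. t \<in> ?D j) \<and> x = l \<otimes> t" using l(1) by blast
  qed
qed

theorem class_E_0I:
  assumes fin: "finitely_covered (carrier G) (pows p (carrier G))"
    and tor: "\<And>x. (\<And>j. x \<in> pows (p ^ j) (carrier G)) \<Longrightarrow> \<exists>k. x [^] (p ^ k) = \<one>"
  shows "class_E_0 G T"
  unfolding class_E_0_def
proof (intro conjI ballI)
  show "locally_compact_group G T" by unfold_locales
  fix \<phi> assume \<phi>: "\<phi> \<in> continuous_end G T"
  obtain L where L: "subgroup L G" "compactin T L" "openin T L"
    "\<And>x. x \<in> carrier G \<Longrightarrow> \<exists>l\<in>L. \<exists>t. (\<forall>j. t \<in> pows (p ^ j) (carrier G)) \<and> x = l \<otimes> t"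
    by (rule compact_times_divisible_part[OF fin]) blast
  show "h_top G T \<phi> = 0"
  proof (rule zero_entropy[OF \<phi> L(1-3)])
    fix x assume "x \<in> carrier G"
    from L(4)[OF this] obtain l t where lt: "l \<in> L" "\<And>j. t \<in> pows (p ^ j) (carrier G)" "x = l \<otimes> t"
      by blast
    have "t \<in> carrier G" using lt(2)[of 0] pows_carrier[of "carrier G"] by blast
    then show "\<exists>l\<in>L. \<exists>t\<in>carrier G. x = l \<otimes> t \<and> (\<exists>k. t [^] (p ^ k) = \<one>)"
      using lt tor[OF lt(2)] by blast
  qed
qed

text \<open>Let \<open>e \<in> L\<close> with \<open>\<phi> (e) \<notin> L\<close>, where \<open>\<phi>\<close> divides by \<open>p\<close> on the orbit of \<open>e\<close>.  For
  \<open>0 < s < p\<^sup>m\<close> some \<open>\<phi>\<^sup>v\<^sup>+\<^sup>1\<close> with \<open>v < m\<close> sends \<open>e\<^sup>s\<close> to a power of \<open>\<phi> (e)\<close> prime to \<open>p\<close>, which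
  is outside \<open>L\<close>.  So the \<open>p\<^sup>m\<close> translates of \<open>C\<^sub>m\<^sub>+\<^sub>1\<close> by \<open>e\<^sup>t\<close>, \<open>t < p\<^sup>m\<close>, are disjoint subsets of \<open>L\<close>.\<close>

lemma measure_cotrajectory_le:
  assumes \<phi>: "\<phi> \<in> continuous_end G T" and L: "subgroup L G" "compactin T L"
    and e: "e \<in> L" "\<phi> e \<notin> L" and div: "\<And>k. (\<phi> ^^ Suc k) e [^] p = (\<phi> ^^ k) e"
  shows "real (p ^ m) * measure \<mu> (cotrajectory G \<phi> L (Suc m)) \<le> measure \<mu> L"
proof -
  let ?C = "cotrajectory G \<phi> L (Suc m)"
  interpret hom: group_hom G G "\<phi> ^^ k" for k
    using continuous_end_group_hom[OF \<phi>] by unfold_locales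
  have Lc: "L \<subseteq> carrier G" using subgroup.subset[OF L(1)] .
  have ec: "e \<in> carrier G" using e(1) Lc by auto
  have pc: "(\<phi> ^^ k) e \<in> carrier G" for k using continuous_end_closed[OF \<phi> ec] .
  have div': "(\<phi> ^^ (v + k)) e [^] (p ^ v) = (\<phi> ^^ k) e" for v k
  proof (induction v)
    case (Suc v)
    have "(\<phi> ^^ (Suc v + k)) e [^] (p ^ Suc v) = ((\<phi> ^^ Suc (v + k)) e [^] p) [^] (p ^ v)"
      using pc[of "Suc (v + k)"] by (simp add: nat_pow_pow)
    then show ?case using Suc div[of "v + k"] by simp
  qed (use pc in simp)
  have \<phi>e: "\<phi> e \<in> carrier G" using pc[of 1] by simp
  have coprime_out: "\<phi> e [^] u \<notin> L" if u: "\<not> p dvd u" for u :: nat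
  proof
    assume uL: "\<phi> e [^] u \<in> L"
    have pL: "\<phi> e [^] p \<in> L" using div[of 0] e(1) by simp
    have "coprime p u" using u prime_p by (rule prime_imp_coprime[rotated])
    then have "coprime (int p) (int u)" by simp
    then obtain a b where ab: "a * int p + b * int u = 1" using bezout_int[of "int p" "int u"] by auto
    have "\<phi> e = \<phi> e [^] (int p * a + int u * b)" using ab \<phi>e by (simp add: mult.commute int_pow_1)
    also have "\<dots> = (\<phi> e [^] p) [^] a \<otimes> (\<phi> e [^] u) [^] b"
      using \<phi>e by (simp add: int_pow_mult int_pow_pow[symmetric] int_pow_int)
    also have "\<dots> \<in> L"
      by (intro subgroup.m_closed[OF L(1)] subgroup_int_pow_closed[OF L(1)] pL uL)
    finally show False using e(2) by simp
  qed
  have out: "e [^] s \<notin> ?C" if s: "0 < s" "s < p ^ m" for s :: nat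
  proof
    assume sC: "e [^] s \<in> ?C"
    obtain v u where vu: "\<not> p dvd u" "s = p ^ v * u"
      using multiplicity_decompose'[of s p] s(1) prime_p by (metis not_prime_unit neq0_conv)
    have "p ^ v \<le> s" using vu s(1) by (cases u) auto
    then have "p ^ v < p ^ m" using s(2) by simp
    then have v: "v < m" using p_gt_1 power_less_imp_less_exp by blast
    have "(\<phi> ^^ Suc v) (e [^] s) = ((\<phi> ^^ (v + 1)) e [^] (p ^ v)) [^] u"
      using hom.hom_nat_pow[OF ec, of "Suc v" s] pc[of "v + 1"] vu(2)
      by (simp add: nat_pow_pow)
    also have "\<dots> = \<phi> e [^] u" using div'[of v 1] by simp
    finally have "(\<phi> ^^ Suc v) (e [^] s) \<notin> L" using coprime_out[OF vu(1)] by simp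
    then show False using sC v unfolding cotrajectory_def by blast
  qed
  have C: "subgroup ?C G" by (rule cotrajectory_subgroup[OF \<phi> L(1)])
  have Ccomp: "compactin T ?C" by (rule cotrajectory_compact[OF \<phi> L(2)]) simp
  have ekc: "e [^] t \<in> carrier G" for t :: nat using ec by simp
  have disj: "(e [^] s <# ?C) \<inter> (e [^] t <# ?C) = {}" if st: "s < t" "t < p ^ m" for s t :: nat
  proof (rule ccontr)
    assume "(e [^] s <# ?C) \<inter> (e [^] t <# ?C) \<noteq> {}"
    then obtain c d where cd: "c \<in> ?C" "d \<in> ?C" "e [^] s \<otimes> c = e [^] t \<otimes> d"
      unfolding l_coset_def by auto
    have c: "c \<in> carrier G" "d \<in> carrier G" using cd subgroup.mem_carrier[OF C] by auto
    have "e [^] t = e [^] s \<otimes> e [^] (t - s)" using st ec by (simp add: nat_pow_mult)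
    then have "e [^] s \<otimes> c = e [^] s \<otimes> (e [^] (t - s) \<otimes> d)"
      using cd(3) c ekc by (simp add: m_assoc)
    then have "c = e [^] (t - s) \<otimes> d" using c ekc by simp
    then have "e [^] (t - s) = c \<otimes> inv d" using c ekc by (simp add: m_assoc)
    also have "\<dots> \<in> ?C" by (intro subgroup.m_closed[OF C] subgroup.m_inv_closed[OF C] cd)
    finally show False using out[of "t - s"] st by simp
  qed
  have sub: "e [^] t <# ?C \<subseteq> L" for t :: nat
  proof
    fix x assume "x \<in> e [^] t <# ?C"
    then obtain c where c: "c \<in> ?C" "x = e [^] t \<otimes> c" unfolding l_coset_def by blast
    have "c \<in> L" using c(1) cotrajectory_subset[of "Suc m" \<phi> L] by auto
    then show "x \<in> L"
      unfolding c(2) by (intro subgroup.m_closed[OF L(1)] subgroup_nat_pow_closed[OF L(1)] e(1))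
  qed
  have fm: "e [^] t <# ?C \<in> fmeasurable \<mu>" for t :: nat
    by (rule haar_compact_fmeasurable[OF compact_l_coset[OF Ccomp ekc]])
  have "measure \<mu> (\<Union>t<p ^ m. e [^] t <# ?C) = (\<Sum>t<p ^ m. measure \<mu> (e [^] t <# ?C))"
  proof (rule measure_UNION')
    show "pairwise (\<lambda>s t. disjnt (e [^] s <# ?C) (e [^] t <# ?C)) {..<p ^ m}"
      unfolding pairwise_def disjnt_def
    proof (intro ballI impI)
      fix s t :: nat assume "s \<in> {..<p ^ m}" "t \<in> {..<p ^ m}" "s \<noteq> t"
      then show "(e [^] s <# ?C) \<inter> (e [^] t <# ?C) = {}"
        using disj[of s t] disj[of t s] by (cases "s < t") (auto simp: Int_commute)
    qed
  qed (use fm in auto)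
  also have "\<dots> = (\<Sum>t<p ^ m. measure \<mu> ?C)"
    by (intro sum.cong refl haar_translate haar_sets_closed compact_closed Ccomp ekc)
  finally have "measure \<mu> (\<Union>t<p ^ m. e [^] t <# ?C) = real (p ^ m) * measure \<mu> ?C" by simp
  moreover have "measure \<mu> (\<Union>t<p ^ m. e [^] t <# ?C) \<le> measure \<mu> L"
    using sub fm haar_compact_fmeasurable[OF L(2)]
    by (intro measure_mono_fmeasurable fmeasurableD fmeasurable.finite_UN) auto
  ultimately show ?thesis by simp
qed

text \<open>The orbit of \<open>e\<close> leaves every compact open subgroup \<open>L\<close>, since \<open>e\<close> is the \<open>p\<^sup>k\<close>-th power of
  \<open>\<phi>\<^sup>k (e)\<close> and these powers of elements of \<open>L\<close> tend to the identity.  The last point of the orbit before it leaves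
  \<open>L\<close> satisfies the assumptions of \<open>measure_cotrajectory_le\<close>.\<close>

lemma positive_entropy:
  assumes \<phi>: "\<phi> \<in> continuous_end G T" and e: "e \<in> carrier G" "e \<noteq> \<one>"
    and div: "\<And>k. (\<phi> ^^ Suc k) e [^] p = (\<phi> ^^ k) e"
  shows "h_top G T \<phi> \<ge> ereal (ln (real p))"
proof -
  have pc: "(\<phi> ^^ k) e \<in> carrier G" for k using continuous_end_closed[OF \<phi> e(1)] .
  obtain L0 where L0: "subgroup L0 G" "compactin T L0" "openin T L0"
    using ex_compact_open_subgroup by blast
  obtain n0 where n0: "e [^] (p ^ n0) \<in> L0" using Union_power_preimages[OF L0(1,3) e(1)] by blast
  define L where "L = {x \<in> carrier G. x [^] (p ^ n0) \<in> L0}"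
  have L: "subgroup L G" "compactin T L" "openin T L"
    unfolding L_def by (rule power_preimage_compact_open[OF L0])+
  have eL: "e \<in> L" using n0 e(1) by (simp add: L_def)
  have "\<exists>k. (\<phi> ^^ k) e \<notin> L"
  proof (rule ccontr)
    assume "\<not> ?thesis"
    then have all: "(\<phi> ^^ k) e \<in> L" for k by blast
    have pk: "(\<phi> ^^ k) e [^] (p ^ k) = e" for k
    proof (induction k)
      case (Suc k)
      have "(\<phi> ^^ Suc k) e [^] (p ^ Suc k) = ((\<phi> ^^ Suc k) e [^] p) [^] (p ^ k)"
        using pc[of "Suc k"] by (simp add: nat_pow_pow del: funpow.simps)
      then show ?case using Suc div[of k] by simp
    qed (use e in simp)
    have "closedin T {e}" using e(1) by (intro compact_closed) (simp add: topspace_eq)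
    then have "openin T (carrier G - {e})" by (simp add: closedin_def topspace_eq)
    from prime_pows_small[OF L(2) this] e(2)
    obtain n where "pows (p ^ n) L \<subseteq> carrier G - {e}" by auto
    moreover have "e \<in> pows (p ^ n) L" using all[of n] pk[of n] unfolding pows_def by (metis imageI)
    ultimately show False by blast
  qed
  then obtain k where k: "(\<phi> ^^ k) e \<notin> L" "\<And>i. i < k \<Longrightarrow> (\<phi> ^^ i) e \<in> L"
    using exists_least_iff[of "\<lambda>k. (\<phi> ^^ k) e \<notin> L"] by auto
  have "k \<noteq> 0" using k(1) eL by (cases k) auto
  then obtain i where i: "k = Suc i" by (cases k) auto
  define d where "d = (\<phi> ^^ i) e"
  have d: "d \<in> L" "\<phi> d \<notin> L" using k i by (auto simp: d_def)
  have iter: "(\<phi> ^^ j) d = (\<phi> ^^ (j + i)) e" for j by (simp add: d_def funpow_add)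
  have ddiv: "(\<phi> ^^ Suc j) d [^] p = (\<phi> ^^ j) d" for j
    using div[of "j + i"] iter[of "Suc j"] iter[of j] by simp
  note le = measure_cotrajectory_le[OF \<phi> L(1,2) d ddiv]
  have p0: "real p > 0" using p_gt_1 by simp
  obtain F where F: "finite F" "F \<subseteq> carrier G" "\<phi> ` L \<subseteq> F <#> L" "F \<noteq> {}"
    by (rule continuous_end_image_cover[OF \<phi> L])
  have N: "card F > 0" using F by (simp add: card_gt_0_iff)
  let ?m = "\<lambda>n. measure \<mu> (cotrajectory G \<phi> L n)"
  let ?a = "- ln (measure \<mu> L) - ln (real p)"
  let ?b = "\<lambda>n. ereal ((?a + real n * ln (real p)) / real n)"
  have "limsup ?b = ereal (ln (real p))" by (rule lim_imp_Limsup[OF _ affine_rate_tendsto]) simp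
  moreover have "limsup ?b \<le> H_top G T \<phi> L"
    unfolding H_top_def
  proof (rule Limsup_mono, rule eventually_mono[OF eventually_ge_at_top[of 1]])
    fix n :: nat assume n: "n \<ge> 1"
    then obtain m where m: "n = Suc m" by (cases n) auto
    have pos: "?m n > 0"
      by (rule cotrajectory_measure_ge(2)[OF \<phi> L F(1) order_refl N F(2,3) L(2) order_refl n])
    have "real p ^ m * ?m n \<le> measure \<mu> L" using le[of m] m by simp
    then have "ln (real p ^ m * ?m n) \<le> ln (measure \<mu> L)"
      using pos p0 haar_compact_open_pos[OF L] by (subst ln_le_cancel_iff) auto
    then have "real m * ln (real p) + ln (?m n) \<le> ln (measure \<mu> L)"
      using pos p0 by (simp add: ln_mult ln_realpow)
    then have "?a + real n * ln (real p) \<le> - ln (?m n)" by (simp add: m algebra_simps)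
    then show "?b n \<le> ereal (- ln (?m n) / real n)"
      unfolding ereal_less_eq by (rule divide_right_mono) simp
  qed
  moreover have "H_top G T \<phi> L \<le> h_top G T \<phi>"
    unfolding h_top_def by (rule SUP_upper[OF compact_open_subgroup_nhd[OF L]])
  ultimately show ?thesis by simp
qed

lemma hom_continuousI:
  assumes \<phi>: "\<phi> \<in> hom G G"
    and one: "\<And>W. openin T W \<Longrightarrow> \<one> \<in> W \<Longrightarrow> \<exists>V. openin T V \<and> \<one> \<in> V \<and> \<phi> ` V \<subseteq> W"
  shows "continuous_map T T \<phi>"
  unfolding continuous_map_def
proof (intro conjI allI impI)
  show "\<phi> \<in> topspace T \<rightarrow> topspace T" using hom_in_carrier[OF \<phi>] by (auto simp: topspace_eq)
  fix W assume W: "openin T W"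
  show "openin T {x \<in> topspace T. \<phi> x \<in> W}"
  proof (subst openin_subopen, intro ballI)
    fix x assume "x \<in> {x \<in> topspace T. \<phi> x \<in> W}"
    then have x: "x \<in> carrier G" "\<phi> x \<in> W" by (auto simp: topspace_eq)
    have \<phi>x: "\<phi> x \<in> carrier G" using hom_in_carrier[OF \<phi> x(1)] .
    have W1: "openin T (inv (\<phi> x) <# W)" by (intro open_l_coset W) (simp add: \<phi>x)
    have W2: "\<one> \<in> inv (\<phi> x) <# W"
      using x(2) \<phi>x unfolding l_coset_def by (auto intro!: bexI[of _ "\<phi> x"])
    from one[OF W1 W2] obtain V where V: "openin T V" "\<one> \<in> V" "\<phi> ` V \<subseteq> inv (\<phi> x) <# W" by blast
    have "\<phi> y \<in> W" if y: "y \<in> x <# V" for y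
    proof -
      obtain v where v: "v \<in> V" "y = x \<otimes> v" using y unfolding l_coset_def by blast
      have vc: "v \<in> carrier G" using v(1) open_subset_carrier[OF V(1)] by auto
      obtain w where w: "w \<in> W" "\<phi> v = inv (\<phi> x) \<otimes> w" using V(3) v(1) unfolding l_coset_def by blast
      have wc: "w \<in> carrier G" using w(1) open_subset_carrier[OF W] by auto
      have "\<phi> y = \<phi> x \<otimes> (inv (\<phi> x) \<otimes> w)" unfolding v(2) hom_mult[OF \<phi> x(1) vc] w(2) ..
      then have "\<phi> y = w" using \<phi>x wc by (simp add: m_assoc[symmetric])
      then show ?thesis using w(1) by simp
    qed
    moreover have "openin T (x <# V)" by (rule open_l_coset[OF V(1) x(1)])
    moreover have "x \<in> x <# V" using V(2) x(1) unfolding l_coset_def by (auto intro!: bexI[of _ "\<one>"])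
    ultimately show "\<exists>Ta. openin T Ta \<and> x \<in> Ta \<and> Ta \<subseteq> {x \<in> topspace T. \<phi> x \<in> W}"
      using open_subset_carrier[of "x <# V"] by (intro exI[of _ "x <# V"]) (auto simp: topspace_eq)
  qed
qed

text \<open>On a topological direct factor \<open>\<pi> (G)\<close> which is uniquely \<open>p\<close>-divisible, division by \<open>p\<close>
  is continuous, because the \<open>p\<close>-th power map of \<open>G\<close> is open: for \<open>\<pi> (x) \<in> L\<^bsup>p^(i+1)\<^esup>\<close>, say
  \<open>\<pi> (x) = l\<^sup>p\<close> with \<open>l \<in> L\<^bsup>p^i\<^esup>\<close>, the \<open>p\<close>-th root of \<open>\<pi> (x)\<close> in the factor is \<open>\<pi> (l)\<close>.\<close>

theorem not_class_E_0I:
  assumes \<pi>: "\<pi> \<in> continuous_end G T" and idem: "\<And>x. x \<in> carrier G \<Longrightarrow> \<pi> (\<pi> x) = \<pi> x"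
    and tf: "\<And>x. x \<in> carrier G \<Longrightarrow> \<pi> x = x \<Longrightarrow> x [^] p = \<one> \<Longrightarrow> x = \<one>"
    and root: "\<And>x. x \<in> carrier G \<Longrightarrow> \<pi> x = x \<Longrightarrow> \<exists>y\<in>carrier G. \<pi> y = y \<and> y [^] p = x"
    and e: "e \<in> carrier G" "\<pi> e = e" "e \<noteq> \<one>"
  shows "\<not> class_E_0 G T"
proof
  assume E0: "class_E_0 G T"
  have \<pi>h: "\<pi> \<in> hom G G" "continuous_map T T \<pi>" using \<pi> by (auto simp: continuous_end_def)
  interpret \<pi>: group_hom G G \<pi> using \<pi>h(1) by unfold_locales
  have uniq: "y = z" if y: "y \<in> carrier G" "\<pi> y = y" and z: "z \<in> carrier G" "\<pi> z = z"
    and eq: "y [^] p = z [^] p" for y z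
  proof -
    have "(y \<otimes> inv z) [^] p = \<one>" using y z eq by (simp add: nat_pow_distrib nat_pow_inv)
    moreover have "\<pi> (y \<otimes> inv z) = y \<otimes> inv z" using y z by simp
    ultimately have yz: "y \<otimes> inv z = \<one>" using tf[of "y \<otimes> inv z"] y z by simp
    have "y = (y \<otimes> inv z) \<otimes> z" using y z by (simp add: m_assoc)
    then show ?thesis using yz z by simp
  qed
  define \<phi> where "\<phi> x = (SOME y. y \<in> carrier G \<and> \<pi> y = y \<and> y [^] p = \<pi> x)" for x
  have \<phi>: "\<phi> x \<in> carrier G" "\<pi> (\<phi> x) = \<phi> x" "\<phi> x [^] p = \<pi> x" if x: "x \<in> carrier G" for x
  proof -
    have "\<exists>y. y \<in> carrier G \<and> \<pi> y = y \<and> y [^] p = \<pi> x"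
      using root[of "\<pi> x"] idem[OF x] x by auto
    from someI_ex[OF this]
    show "\<phi> x \<in> carrier G" "\<pi> (\<phi> x) = \<phi> x" "\<phi> x [^] p = \<pi> x" unfolding \<phi>_def by simp_all
  qed
  have \<phi>_eq: "\<phi> x = y" if "x \<in> carrier G" "y \<in> carrier G" "\<pi> y = y" "y [^] p = \<pi> x" for x y
    using uniq[OF \<phi>(1,2)[OF that(1)] that(2,3)] \<phi>(3)[OF that(1)] that(4) by simp
  have hom: "\<phi> \<in> hom G G"
  proof (rule homI)
    fix x y assume xy: "x \<in> carrier G" "y \<in> carrier G"
    show "\<phi> x \<in> carrier G" using \<phi>(1)[OF xy(1)] .
    show "\<phi> (x \<otimes> y) = \<phi> x \<otimes> \<phi> y"
      using \<phi>[OF xy(1)] \<phi>[OF xy(2)] xy by (intro \<phi>_eq) (simp_all add: nat_pow_distrib)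
  qed
  obtain L where L: "subgroup L G" "compactin T L" "openin T L" using ex_compact_open_subgroup by blast
  have pL: "subgroup (pows (p ^ j) L) G" "openin T (pows (p ^ j) L)" for j
    using pows_subgroup[OF L(1)] open_prime_pows[OF L] by auto
  have Lc: "L \<subseteq> carrier G" using subgroup.subset[OF L(1)] .
  have one_preimage: "\<one> \<in> {x \<in> topspace T. \<pi> x \<in> pows (p ^ j) L}" for j
    using subgroup.one_closed[OF pL(1)] by (simp add: topspace_eq)
  have "continuous_map T T \<phi>"
  proof (rule hom_continuousI[OF hom])
    fix W assume W: "openin T W" "\<one> \<in> W"
    note pre = openin_continuous_map_preimage[OF \<pi>h(2) W(1)]
    have "\<one> \<in> {x \<in> topspace T. \<pi> x \<in> W}" using W(2) by (simp add: topspace_eq)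
    from prime_pows_small[OF L(2) pre this]
    obtain i where i: "pows (p ^ i) L \<subseteq> {x \<in> topspace T. \<pi> x \<in> W}" by auto
    define V where "V = {x \<in> topspace T. \<pi> x \<in> pows (p ^ Suc i) L}"
    have "openin T V" unfolding V_def by (rule openin_continuous_map_preimage[OF \<pi>h(2) pL(2)])
    moreover have "\<one> \<in> V" unfolding V_def by (rule one_preimage)
    moreover have "\<phi> ` V \<subseteq> W"
    proof clarify
      fix x assume "x \<in> V"
      then obtain l where l: "x \<in> carrier G" "l \<in> L" "\<pi> x = l [^] (p ^ Suc i)"
        by (auto simp: V_def topspace_eq pows_def)
      let ?l = "l [^] (p ^ i)"
      have lc: "l \<in> carrier G" using l(2) Lc by auto
      have pl: "?l [^] p = \<pi> x" using lc l(3) by (simp add: nat_pow_pow mult.commute)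
      have "\<phi> x = \<pi> ?l"
      proof (rule \<phi>_eq[OF l(1)])
        have "\<pi> ?l [^] p = \<pi> (?l [^] p)" using \<pi>.hom_nat_pow[of ?l p] lc by simp
        then show "\<pi> ?l [^] p = \<pi> x" using pl idem[OF l(1)] by simp
      qed (use lc idem in auto)
      moreover have "?l \<in> pows (p ^ i) L" using l(2) by (simp add: pows_def)
      ultimately show "\<phi> x \<in> W" using i by auto
    qed
    ultimately show "\<exists>V. openin T V \<and> \<one> \<in> V \<and> \<phi> ` V \<subseteq> W" by blast
  qed
  then have cont: "\<phi> \<in> continuous_end G T" using hom by (simp add: continuous_end_def)
  have orbit: "(\<phi> ^^ k) e \<in> carrier G \<and> \<pi> ((\<phi> ^^ k) e) = (\<phi> ^^ k) e" for k
    by (induction k) (use e \<phi> in auto)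
  have "h_top G T \<phi> \<ge> ereal (ln (real p))"
  proof (rule positive_entropy[OF cont e(1,3)])
    show "(\<phi> ^^ Suc k) e [^] p = (\<phi> ^^ k) e" for k using \<phi>(3) orbit[of k] by simp
  qed
  moreover have "h_top G T \<phi> = 0" using E0 cont by (simp add: class_E_0_def)
  moreover have "ln (real p) > 0" using p_gt_1 by simp
  ultimately show False by (simp add: zero_ereal_def)
qed

end

section \<open>The model groups\<close>

lemma pruefer_carrier: "z \<in> carrier (pruefer p) \<longleftrightarrow> (\<exists>n. z ^ (p ^ n) = 1)"
  by (simp add: pruefer_def)

lemma pruefer_pow: "z [^]\<^bsub>pruefer p\<^esub> (n::nat) = z ^ n"
  by (induction n) (simp_all add: nat_pow_def pruefer_def mult.commute)

lemma pruefer_comm_group: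
  assumes "prime p"
  shows "comm_group (pruefer p)"
proof (rule comm_groupI)
  fix x y assume "x \<in> carrier (pruefer p)" "y \<in> carrier (pruefer p)"
  then obtain m n where mn: "x ^ (p ^ m) = 1" "y ^ (p ^ n) = 1" by (auto simp: pruefer_carrier)
  have "x ^ (p ^ (m + n)) = (x ^ (p ^ m)) ^ (p ^ n)" "y ^ (p ^ (m + n)) = (y ^ (p ^ n)) ^ (p ^ m)"
    by (simp_all add: power_mult[symmetric] power_add mult.commute)
  then have "(x * y) ^ (p ^ (m + n)) = 1" using mn by (simp add: power_mult_distrib)
  then show "x \<otimes>\<^bsub>pruefer p\<^esub> y \<in> carrier (pruefer p)"
    by (auto simp: pruefer_def)
next
  fix x assume "x \<in> carrier (pruefer p)"
  then obtain n where n: "x ^ (p ^ n) = 1" by (auto simp: pruefer_carrier)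
  have "p ^ n \<noteq> 0" using prime_gt_0_nat[OF assms] by simp
  then have "x \<noteq> 0" using n by (auto simp: power_0_left)
  moreover have "inverse x ^ (p ^ n) = 1" using n by (simp add: power_inverse)
  ultimately show "\<exists>y\<in>carrier (pruefer p). y \<otimes>\<^bsub>pruefer p\<^esub> x = \<one>\<^bsub>pruefer p\<^esub>"
    by (intro bexI[of _ "inverse x"]) (auto simp: pruefer_def)
next
  show "\<one>\<^bsub>pruefer p\<^esub> \<in> carrier (pruefer p)" by (auto simp: pruefer_def)
qed (auto simp: pruefer_def)

lemma pruefer_divisible:
  assumes "prime p" "z \<in> carrier (pruefer p)"
  shows "\<exists>y\<in>carrier (pruefer p). y [^]\<^bsub>pruefer p\<^esub> p = z"
proof -
  obtain n where n: "z ^ (p ^ n) = 1" using assms(2) by (auto simp: pruefer_carrier)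
  have "p ^ n \<noteq> 0" "p \<noteq> 0" using prime_gt_0_nat[OF assms(1)] by simp_all
  then have "z \<noteq> 0" using n by (auto simp: power_0_left)
  define y where "y = exp (Ln z / of_nat p)"
  have y: "y ^ p = z"
    using \<open>z \<noteq> 0\<close> \<open>p \<noteq> 0\<close> by (simp add: y_def flip: exp_of_nat_mult)
  have "y ^ (p ^ Suc n) = (y ^ p) ^ (p ^ n)" by (simp add: power_mult[symmetric])
  then have "y \<in> carrier (pruefer p)" using y n unfolding pruefer_carrier by metis
  then show ?thesis using y pruefer_pow by auto
qed

lemma DirProd_pow: "(x, y) [^]\<^bsub>A \<times>\<times> B\<^esub> (n::nat) = (x [^]\<^bsub>A\<^esub> n, y [^]\<^bsub>B\<^esub> n)"
  by (induction n) (simp_all add: nat_pow_def)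

lemma product_group_pow:
  assumes "x \<in> carrier (product_group I A)"
  shows "x [^]\<^bsub>product_group I A\<^esub> (n::nat) = (\<lambda>i\<in>I. x i [^]\<^bsub>A i\<^esub> n)"
  by (induction n) (auto simp: nat_pow_def restrict_def fun_eq_iff)

lemma carrier_model_group:
  "carrier (model_group p n1 n2 n3 F) =
    (\<Pi>\<^sub>E i\<in>{..<n1}. carrier (Zp p)) \<times> (\<Pi>\<^sub>E i\<in>{..<n2}. carrier (Qp p)) \<times>
    (\<Pi>\<^sub>E i\<in>{..<n3}. carrier (pruefer p)) \<times> carrier F"
  by (simp add: model_group_def DirProd_def)

lemma one_model_group:
  "\<one>\<^bsub>model_group p n1 n2 n3 F\<^esub> =
    (\<lambda>i\<in>{..<n1}. \<one>\<^bsub>Zp p\<^esub>, \<lambda>i\<in>{..<n2}. \<one>\<^bsub>Qp p\<^esub>, \<lambda>i\<in>{..<n3}. \<one>\<^bsub>pruefer p\<^esub>, \<one>\<^bsub>F\<^esub>)"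
  by (simp add: model_group_def)

lemma mult_model_group:
  "(a, b, z, w) \<otimes>\<^bsub>model_group p n1 n2 n3 F\<^esub> (a', b', z', w') =
    (\<lambda>i\<in>{..<n1}. a i \<otimes>\<^bsub>Zp p\<^esub> a' i, \<lambda>i\<in>{..<n2}. b i \<otimes>\<^bsub>Qp p\<^esub> b' i,
     \<lambda>i\<in>{..<n3}. z i \<otimes>\<^bsub>pruefer p\<^esub> z' i, w \<otimes>\<^bsub>F\<^esub> w')"
  by (simp add: model_group_def)

lemma pow_model_group:
  assumes "(a, b, z, w) \<in> carrier (model_group p n1 n2 n3 F)"
  shows "(a, b, z, w) [^]\<^bsub>model_group p n1 n2 n3 F\<^esub> (n::nat) =
    (\<lambda>i\<in>{..<n1}. a i [^]\<^bsub>Zp p\<^esub> n, \<lambda>i\<in>{..<n2}. b i [^]\<^bsub>Qp p\<^esub> n,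
     \<lambda>i\<in>{..<n3}. z i [^]\<^bsub>pruefer p\<^esub> n, w [^]\<^bsub>F\<^esub> n)"
  using assms by (simp add: carrier_model_group model_group_def DirProd_pow product_group_pow)

lemma Zp_comm_group: "prime p \<Longrightarrow> comm_group (Zp p)"
  using padic_group.Com_comm_group[OF padic_group_int] .

lemma Qp_comm_group: "prime p \<Longrightarrow> comm_group (Qp p)"
  using padic_group.Com_comm_group[OF padic_group_rat] .

lemma model_group_group:
  assumes "prime p" "group F"
  shows "group (model_group p n1 n2 n3 F)"
  unfolding model_group_def
  using comm_group.axioms(2)[OF Zp_comm_group[OF assms(1)]]
    comm_group.axioms(2)[OF Qp_comm_group[OF assms(1)]]
    comm_group.axioms(2)[OF pruefer_comm_group[OF assms(1)]]
  by (intro DirProd_group product_group assms) auto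

locale modelled_group = finite_rank_p_group G T p
  for G :: "('a, 'm) monoid_scheme" (structure) and T p +
  fixes f n1 n2 n3 and F :: "('b, 'n) monoid_scheme"
  assumes f_iso: "f \<in> iso G (model_group p n1 n2 n3 F)"
    and f_homeo: "homeomorphic_map T (model_top p n1 n2 n3 F) f"
    and F_p_group: "finite_p_group p F"
begin

abbreviation "M \<equiv> model_group p n1 n2 n3 F"

lemma F_group: "group F"
  using F_p_group by (simp add: finite_p_group_def)

sublocale Zp: comm_group "Zp p" by (rule Zp_comm_group[OF prime_p])
sublocale Qp: comm_group "Qp p" by (rule Qp_comm_group[OF prime_p])
sublocale Pr: comm_group "pruefer p" by (rule pruefer_comm_group[OF prime_p])
sublocale F: group F by (rule F_group)
sublocale M: group M by (rule model_group_group[OF prime_p F_group])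
sublocale f: group_hom G M f
  using f_iso by unfold_locales (auto simp: iso_def)

lemma f_bij: "bij_betw f (carrier G) (carrier M)"
  using f_iso by (simp add: iso_def)

lemma f_inj: "x \<in> carrier G \<Longrightarrow> y \<in> carrier G \<Longrightarrow> f x = f y \<Longrightarrow> x = y"
  using bij_betw_imp_inj_on[OF f_bij] by (auto dest: inj_onD)

lemma f_surj:
  assumes "m \<in> carrier M"
  obtains x where "x \<in> carrier G" "f x = m"
  using that assms bij_betw_imp_surj_on[OF f_bij] by (metis imageE)

lemma f_cases:
  assumes "x \<in> carrier G"
  obtains a b z w where "f x = (a, b, z, w)" "a \<in> (\<Pi>\<^sub>E i\<in>{..<n1}. carrier (Zp p))"
    "b \<in> (\<Pi>\<^sub>E i\<in>{..<n2}. carrier (Qp p))" "z \<in> (\<Pi>\<^sub>E i\<in>{..<n3}. carrier (pruefer p))" "w \<in> carrier F"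
proof -
  obtain a b z w where e: "f x = (a, b, z, w)" by (metis surj_pair)
  have "f x \<in> carrier M" using assms by (rule f.hom_closed)
  then show thesis unfolding e carrier_model_group using that[OF e] by simp
qed

text \<open>The Pruefer group is divisible, and every \<open>p\<close>-adic integer is one of \<open>0, \<dots>, p - 1\<close> up to a multiple of \<open>p\<close>.\<close>

lemma finitely_covered_p_pows:
  assumes "n2 = 0"
  shows "finitely_covered (carrier G) (pows p (carrier G))"
proof -
  define c where "c k = padic_group.cls p \<int> (\<lambda>n. of_nat k)" for k :: nat
  have cZ: "c k \<in> carrier (Zp p)" for k
    unfolding c_def
    by (intro padic_group.cls_in_Com padic_group.const_in_Cau padic_group_int prime_p) simp
  define h where "h = (\<lambda>(k, w). (\<lambda>i\<in>{..<n1}. c (k i), \<lambda>i\<in>{..<n2}. \<one>\<^bsub>Qp p\<^esub>,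
    \<lambda>i\<in>{..<n3}. \<one>\<^bsub>pruefer p\<^esub>, w :: 'b))"
  define K where "K = h ` ((\<Pi>\<^sub>E i\<in>{..<n1}. {..<p}) \<times> carrier F)"
  have Kfin: "finite K"
    unfolding K_def using F_p_group by (auto simp: finite_p_group_def intro!: finite_PiE)
  have KM: "K \<subseteq> carrier M"
    unfolding K_def h_def carrier_model_group using cZ by auto
  define g where "g = inv_into (carrier G) f"
  have g: "g m \<in> carrier G" "f (g m) = m" if "m \<in> carrier M" for m
    using that bij_betw_imp_surj_on[OF f_bij] unfolding g_def
    by (auto intro: inv_into_into f_inv_into_f)
  show ?thesis
  proof (rule finitely_coveredI)
    show "finite (g ` K)" using Kfin by simp
    show "g ` K \<subseteq> carrier G" using g(1) KM by auto
    show "carrier G \<subseteq> g ` K <#> pows p (carrier G)"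
    proof
      fix x assume x: "x \<in> carrier G"
      obtain a b z w where fx: "f x = (a, b, z, w)"
        and a: "a \<in> (\<Pi>\<^sub>E i\<in>{..<n1}. carrier (Zp p))" and b: "b \<in> (\<Pi>\<^sub>E i\<in>{..<n2}. carrier (Qp p))"
        and z: "z \<in> (\<Pi>\<^sub>E i\<in>{..<n3}. carrier (pruefer p))" and w: "w \<in> carrier F"
        by (rule f_cases[OF x])
      have "\<forall>i\<in>{..<n1}. \<exists>kB. fst kB < p \<and> snd kB \<in> carrier (Zp p) \<and>
          a i = c (fst kB) \<otimes>\<^bsub>Zp p\<^esub> (snd kB [^]\<^bsub>Zp p\<^esub> p)"
      proof
        fix i assume "i \<in> {..<n1}"
        then have "a i \<in> carrier (Zp p)" using a by auto
        from Zp_decomposition[OF prime_p this] obtain k B where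
          "k < p" "B \<in> carrier (Zp p)" "a i = c k \<otimes>\<^bsub>Zp p\<^esub> (B [^]\<^bsub>Zp p\<^esub> p)"
          unfolding c_def by blast
        then show "\<exists>kB. fst kB < p \<and> snd kB \<in> carrier (Zp p) \<and>
          a i = c (fst kB) \<otimes>\<^bsub>Zp p\<^esub> (snd kB [^]\<^bsub>Zp p\<^esub> p)"
          by (intro exI[of _ "(k, B)"]) simp
      qed
      from bchoice[OF this] obtain kB where kB: "\<And>i. i < n1 \<Longrightarrow> fst (kB i) < p"
        "\<And>i. i < n1 \<Longrightarrow> snd (kB i) \<in> carrier (Zp p)"
        "\<And>i. i < n1 \<Longrightarrow> a i = c (fst (kB i)) \<otimes>\<^bsub>Zp p\<^esub> (snd (kB i) [^]\<^bsub>Zp p\<^esub> p)" by auto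
      have "\<forall>i\<in>{..<n3}. \<exists>y. y \<in> carrier (pruefer p) \<and> y [^]\<^bsub>pruefer p\<^esub> p = z i"
        using pruefer_divisible[OF prime_p] z by (metis PiE_mem)
      from bchoice[OF this] obtain y where y: "\<And>i. i < n3 \<Longrightarrow> y i \<in> carrier (pruefer p)"
        "\<And>i. i < n3 \<Longrightarrow> y i [^]\<^bsub>pruefer p\<^esub> p = z i" by auto
      define k where "k = (\<lambda>i\<in>{..<n1}. fst (kB i))"
      have kin: "k \<in> (\<Pi>\<^sub>E i\<in>{..<n1}. {..<p})" using kB(1) by (auto simp: k_def)
      then have hK: "h (k, w) \<in> K" using w by (auto simp: K_def)
      define u where "u = (\<lambda>i\<in>{..<n1}. snd (kB i), b, \<lambda>i\<in>{..<n3}. y i, \<one>\<^bsub>F\<^esub>)"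
      have u: "u \<in> carrier M"
        unfolding u_def carrier_model_group using kB(2) b y(1) by auto
      have zc: "z i \<in> carrier (pruefer p)" if "i < n3" for i using z that by auto
      have b0: "b = (\<lambda>i. undefined)" using b assms by auto
      have "h (k, w) \<otimes>\<^bsub>M\<^esub> (u [^]\<^bsub>M\<^esub> p) =
          (\<lambda>i\<in>{..<n1}. c (k i) \<otimes>\<^bsub>Zp p\<^esub> (snd (kB i) [^]\<^bsub>Zp p\<^esub> p), b, \<lambda>i\<in>{..<n3}. z i, w)"
        using w y zc b0 assms unfolding u_def h_def pow_model_group[OF u[unfolded u_def]]
        by (auto simp: mult_model_group restrict_def fun_eq_iff)
      also have "\<dots> = f x"
      proof -
        have "(\<lambda>i\<in>{..<n1}. c (k i) \<otimes>\<^bsub>Zp p\<^esub> (snd (kB i) [^]\<^bsub>Zp p\<^esub> p)) = a"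
        proof
          fix i
          show "(\<lambda>i\<in>{..<n1}. c (k i) \<otimes>\<^bsub>Zp p\<^esub> (snd (kB i) [^]\<^bsub>Zp p\<^esub> p)) i = a i"
            using kB(3)[of i] PiE_arb[OF a, of i] by (cases "i < n1") (simp_all add: k_def)
        qed
        moreover have "(\<lambda>i\<in>{..<n3}. z i) = z" using z by (intro PiE_restrict)
        ultimately show ?thesis using fx by simp
      qed
      finally have eq: "f x = h (k, w) \<otimes>\<^bsub>M\<^esub> (u [^]\<^bsub>M\<^esub> p)" by simp
      have hM: "h (k, w) \<in> carrier M" using hK KM by blast
      have "f (g (h (k, w)) \<otimes> g u [^] p) = f x"
        unfolding eq using g[OF hM] g[OF u] f.hom_mult f.hom_nat_pow by simp
      then have "x = g (h (k, w)) \<otimes> g u [^] p"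
        using g(1)[OF hM] g(1)[OF u] x by (intro f_inj) auto
      then show "x \<in> g ` K <#> pows p (carrier G)"
        using hK g(1)[OF u] by (intro set_mult_memI[of "g (h (k, w))" _ "g u [^] p"]) (auto simp: pows_def)
    qed
  qed
qed

text \<open>An element with \<open>p\<^sup>j\<close>-th roots for all \<open>j\<close> has trivial \<open>\<int>\<^sub>p\<close>-coordinates; the Pruefer group and \<open>F\<close>
  are torsion.\<close>

lemma divisible_part_torsion:
  assumes n2: "n2 = 0" and x: "\<And>j. x \<in> pows (p ^ j) (carrier G)"
  shows "\<exists>k. x [^] (p ^ k) = \<one>"
proof -
  have xc: "x \<in> carrier G" using x[of 0] pows_carrier[of "carrier G"] by blast
  obtain a b z w where fx: "f x = (a, b, z, w)"
    and a: "a \<in> (\<Pi>\<^sub>E i\<in>{..<n1}. carrier (Zp p))" and b: "b \<in> (\<Pi>\<^sub>E i\<in>{..<n2}. carrier (Qp p))"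
    and z: "z \<in> (\<Pi>\<^sub>E i\<in>{..<n3}. carrier (pruefer p))" and w: "w \<in> carrier F"
    by (rule f_cases[OF xc])
  have a1: "a i = \<one>\<^bsub>Zp p\<^esub>" if i: "i < n1" for i
  proof (rule Zp_no_divisible_elements[OF prime_p])
    show "a i \<in> carrier (Zp p)" using a i by auto
    fix j
    obtain y where y: "y \<in> carrier G" "x = y [^] (p ^ j)" using x[of j] by (auto simp: pows_def)
    obtain a' b' z' w' where fy: "f y = (a', b', z', w')"
      and a': "a' \<in> (\<Pi>\<^sub>E i\<in>{..<n1}. carrier (Zp p))"
      by (rule f_cases[OF y(1)])
    have "f x = f y [^]\<^bsub>M\<^esub> (p ^ j)" unfolding y(2) by (rule f.hom_nat_pow[OF y(1)])
    moreover have "f y \<in> carrier M" using y(1) by (rule f.hom_closed)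
    ultimately have "a = (\<lambda>i\<in>{..<n1}. a' i [^]\<^bsub>Zp p\<^esub> (p ^ j))"
      unfolding fx fy by (simp add: pow_model_group)
    then have "a i = a' i [^]\<^bsub>Zp p\<^esub> (p ^ j)" using i by simp
    moreover have "a' i \<in> carrier (Zp p)" using a' i by auto
    ultimately show "\<exists>B\<in>carrier (Zp p). a i = B [^]\<^bsub>Zp p\<^esub> (p ^ j)" by blast
  qed
  have "\<forall>i\<in>{..<n3}. \<exists>n. z i ^ (p ^ n) = 1" using z pruefer_carrier by (metis PiE_mem)
  from bchoice[OF this] obtain n where n: "\<And>i. i < n3 \<Longrightarrow> z i ^ (p ^ n i) = 1" by auto
  obtain k where k: "order F = p ^ k" using F_p_group by (auto simp: finite_p_group_def)
  define N where "N = k + (\<Sum>i<n3. n i)"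
  have "z i [^]\<^bsub>pruefer p\<^esub> (p ^ N) = \<one>\<^bsub>pruefer p\<^esub>" if i: "i < n3" for i
  proof -
    have "n i \<le> (\<Sum>i<n3. n i)" using i by (intro member_le_sum) auto
    then have "p ^ N = p ^ n i * p ^ (N - n i)" by (simp add: N_def power_add[symmetric])
    then have "z i ^ (p ^ N) = 1" using n[OF i] by (simp add: power_mult)
    then show ?thesis by (simp add: pruefer_pow) (simp add: pruefer_def)
  qed
  moreover have "w [^]\<^bsub>F\<^esub> (p ^ N) = \<one>\<^bsub>F\<^esub>"
    using F.pow_order_eq_1[OF w] w unfolding N_def power_add k[symmetric]
    by (simp add: F.nat_pow_pow[symmetric])
  ultimately have "f x [^]\<^bsub>M\<^esub> (p ^ N) = \<one>\<^bsub>M\<^esub>"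
    using f.hom_closed[OF xc] a1 n2 unfolding fx
    by (simp add: pow_model_group one_model_group restrict_def fun_eq_iff)
  then have "f (x [^] (p ^ N)) = f \<one>" using f.hom_nat_pow[OF xc] by simp
  then have "x [^] (p ^ N) = \<one>" using xc by (intro f_inj) auto
  then show ?thesis by blast
qed

lemma zero_entropy_model: "n2 = 0 \<Longrightarrow> class_E_0 G T"
  using class_E_0I[OF finitely_covered_p_pows divisible_part_torsion] .

definition proj ::
  "(nat \<Rightarrow> (nat \<Rightarrow> rat) set) \<times> (nat \<Rightarrow> (nat \<Rightarrow> rat) set) \<times> (nat \<Rightarrow> complex) \<times> 'b \<Rightarrow>
   (nat \<Rightarrow> (nat \<Rightarrow> rat) set) \<times> (nat \<Rightarrow> (nat \<Rightarrow> rat) set) \<times> (nat \<Rightarrow> complex) \<times> 'b" where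
  "proj = (\<lambda>(a, b, z, w). (\<lambda>i\<in>{..<n1}. \<one>\<^bsub>Zp p\<^esub>, b, \<lambda>i\<in>{..<n3}. \<one>\<^bsub>pruefer p\<^esub>, \<one>\<^bsub>F\<^esub>))"

lemma proj_closed: "m \<in> carrier M \<Longrightarrow> proj m \<in> carrier M"
  by (auto simp: proj_def carrier_model_group)

lemma proj_proj: "proj (proj m) = proj m"
  by (simp add: proj_def split: prod.splits)

lemma proj_mult: "proj (m \<otimes>\<^bsub>M\<^esub> m') = proj m \<otimes>\<^bsub>M\<^esub> proj m'"
  by (cases m rule: prod_cases4; cases m' rule: prod_cases4)
    (simp add: proj_def mult_model_group cong: restrict_cong)

lemma topspace_model_top: "topspace (model_top p n1 n2 n3 F) = carrier M"
  using homeomorphic_imp_surjective_map[OF f_homeo] bij_betw_imp_surj_on[OF f_bij]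
  by (simp add: topspace_eq)

lemma continuous_proj: "continuous_map (model_top p n1 n2 n3 F) (model_top p n1 n2 n3 F) proj"
proof -
  have one: "\<one>\<^bsub>M\<^esub> \<in> topspace (model_top p n1 n2 n3 F)" by (simp add: topspace_model_top)
  let ?A = "product_topology (\<lambda>_. Zp_top p) {..<n1}"
  let ?B = "product_topology (\<lambda>_. Qp_top p) {..<n2}"
  let ?C = "product_topology (\<lambda>_. pruefer_top p) {..<n3}"
  have ones: "(\<lambda>i\<in>{..<n1}. \<one>\<^bsub>Zp p\<^esub>) \<in> topspace ?A"
    "(\<lambda>i\<in>{..<n3}. \<one>\<^bsub>pruefer p\<^esub>) \<in> topspace ?C"
    using one unfolding model_top_def one_model_group topspace_prod_topology by blast+
  let ?X = "prod_topology ?A (prod_topology ?B (prod_topology ?C (discrete_topology (carrier F))))"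
  have "continuous_map ?X ?B (fst \<circ> snd)"
    by (rule continuous_map_compose[OF continuous_map_snd continuous_map_fst])
  then have "continuous_map ?X ?X
      (\<lambda>m. (\<lambda>i\<in>{..<n1}. \<one>\<^bsub>Zp p\<^esub>, fst (snd m), \<lambda>i\<in>{..<n3}. \<one>\<^bsub>pruefer p\<^esub>, \<one>\<^bsub>F\<^esub>))"
    using ones by (intro continuous_map_pairedI) (simp_all add: comp_def)
  moreover have "proj = (\<lambda>m. (\<lambda>i\<in>{..<n1}. \<one>\<^bsub>Zp p\<^esub>, fst (snd m), \<lambda>i\<in>{..<n3}. \<one>\<^bsub>pruefer p\<^esub>, \<one>\<^bsub>F\<^esub>))"
    by (simp add: proj_def fun_eq_iff)
  ultimately show ?thesis unfolding model_top_def by simp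
qed

text \<open>Conjugating the projection to the factor \<open>\<rat>\<^sub>p\<^bsup>n2\<^esup>\<close> with the isomorphism gives the idempotent
  endomorphism that \<open>not_class_E_0I\<close> asks for.\<close>

lemma positive_entropy_model:
  assumes "n2 \<noteq> 0"
  shows "\<not> class_E_0 G T"
proof -
  obtain g where fg: "homeomorphic_maps T (model_top p n1 n2 n3 F) f g"
    using f_homeo by (auto simp: homeomorphic_map_maps)
  have fc: "continuous_map T (model_top p n1 n2 n3 F) f"
    and gc: "continuous_map (model_top p n1 n2 n3 F) T g"
    and gf: "\<And>x. x \<in> carrier G \<Longrightarrow> g (f x) = x" and fg': "\<And>m. m \<in> carrier M \<Longrightarrow> f (g m) = m"
    using fg topspace_model_top topspace_eq by (auto simp: homeomorphic_maps_def)
  have g: "g m \<in> carrier G" if "m \<in> carrier M" for m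
    using f_surj[OF that] gf by metis
  define \<pi> where "\<pi> x = g (proj (f x))" for x
  have \<pi>: "\<pi> x \<in> carrier G" "f (\<pi> x) = proj (f x)" if "x \<in> carrier G" for x
    using that g fg' proj_closed f.hom_closed by (simp_all add: \<pi>_def)
  have fixed: "\<pi> x = x \<longleftrightarrow> proj (f x) = f x" if "x \<in> carrier G" for x
    using \<pi>[OF that] gf[OF that] by (metis \<pi>_def)
  obtain A where A: "A \<in> carrier (Qp p)" "A \<noteq> \<one>\<^bsub>Qp p\<^esub>" using Qp_nontrivial[OF prime_p] by blast
  define e where "e = (\<lambda>i\<in>{..<n1}. \<one>\<^bsub>Zp p\<^esub>, \<lambda>i\<in>{..<n2}. A, \<lambda>i\<in>{..<n3}. \<one>\<^bsub>pruefer p\<^esub>, \<one>\<^bsub>F\<^esub>)"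
  have e: "e \<in> carrier M" unfolding e_def carrier_model_group using A(1) by auto
  have proj_e: "proj e = e" by (simp add: proj_def e_def)
  show ?thesis
  proof (rule not_class_E_0I)
    have "\<pi> \<in> hom G G"
    proof (rule homI)
      fix x y assume xy: "x \<in> carrier G" "y \<in> carrier G"
      show "\<pi> x \<in> carrier G" using \<pi>(1)[OF xy(1)] .
      show "\<pi> (x \<otimes> y) = \<pi> x \<otimes> \<pi> y"
        using xy \<pi> by (intro f_inj) (simp_all add: proj_mult)
    qed
    moreover have "continuous_map T T \<pi>"
      using continuous_map_compose[OF continuous_map_compose[OF fc continuous_proj] gc]
      by (simp add: \<pi>_def[abs_def] comp_def)
    ultimately show "\<pi> \<in> continuous_end G T" by (simp add: continuous_end_def)
  next
    fix x assume "x \<in> carrier G"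
    then show "\<pi> (\<pi> x) = \<pi> x" using fixed[of "\<pi> x"] \<pi> proj_proj by simp
  next
    fix x assume x: "x \<in> carrier G" "\<pi> x = x" "x [^] p = \<one>"
    obtain a b z w where fx: "f x = (a, b, z, w)" and b: "b \<in> (\<Pi>\<^sub>E i\<in>{..<n2}. carrier (Qp p))"
      by (rule f_cases[OF x(1)])
    have fx': "f x = (\<lambda>i\<in>{..<n1}. \<one>\<^bsub>Zp p\<^esub>, b, \<lambda>i\<in>{..<n3}. \<one>\<^bsub>pruefer p\<^esub>, \<one>\<^bsub>F\<^esub>)"
      using fixed[OF x(1)] x(2) fx by (simp add: proj_def)
    have "f x [^]\<^bsub>M\<^esub> p = \<one>\<^bsub>M\<^esub>" using f.hom_nat_pow[OF x(1), of p] x(3) by simp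
    then have eq: "(\<lambda>i\<in>{..<n2}. b i [^]\<^bsub>Qp p\<^esub> p) = (\<lambda>i\<in>{..<n2}. \<one>\<^bsub>Qp p\<^esub>)"
      using f.hom_closed[OF x(1)] unfolding fx by (simp add: pow_model_group one_model_group)
    have b1: "b i = \<one>\<^bsub>Qp p\<^esub>" if i: "i \<in> {..<n2}" for i
    proof (rule Qp_torsion_free[OF prime_p PiE_mem[OF b i]])
      show "b i [^]\<^bsub>Qp p\<^esub> p = \<one>\<^bsub>Qp p\<^esub>" using fun_cong[OF eq, of i] i by simp
    qed
    have "b = (\<lambda>i\<in>{..<n2}. \<one>\<^bsub>Qp p\<^esub>)"
    proof
      fix i
      show "b i = (\<lambda>i\<in>{..<n2}. \<one>\<^bsub>Qp p\<^esub>) i"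
        using b1[of i] PiE_arb[OF b, of i] by (cases "i \<in> {..<n2}") simp_all
    qed
    then have "f x = f \<one>" unfolding fx' by (simp add: one_model_group)
    then show "x = \<one>" using x(1) by (intro f_inj) auto
  next
    fix x assume x: "x \<in> carrier G" "\<pi> x = x"
    obtain a b z w where fx: "f x = (a, b, z, w)" and b: "b \<in> (\<Pi>\<^sub>E i\<in>{..<n2}. carrier (Qp p))"
      by (rule f_cases[OF x(1)])
    have fx': "f x = (\<lambda>i\<in>{..<n1}. \<one>\<^bsub>Zp p\<^esub>, b, \<lambda>i\<in>{..<n3}. \<one>\<^bsub>pruefer p\<^esub>, \<one>\<^bsub>F\<^esub>)"
      using fixed[OF x(1)] x(2) fx by (simp add: proj_def)
    have "\<forall>i\<in>{..<n2}. \<exists>y. y \<in> carrier (Qp p) \<and> y [^]\<^bsub>Qp p\<^esub> p = b i"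
    proof
      fix i assume "i \<in> {..<n2}"
      then have "b i \<in> carrier (Qp p)" by (rule PiE_mem[OF b])
      from Qp_divisible[OF prime_p this]
      show "\<exists>y. y \<in> carrier (Qp p) \<and> y [^]\<^bsub>Qp p\<^esub> p = b i" by blast
    qed
    from bchoice[OF this] obtain y where y: "\<And>i. i < n2 \<Longrightarrow> y i \<in> carrier (Qp p)"
      "\<And>i. i < n2 \<Longrightarrow> y i [^]\<^bsub>Qp p\<^esub> p = b i" by auto
    define m where "m = (\<lambda>i\<in>{..<n1}. \<one>\<^bsub>Zp p\<^esub>, \<lambda>i\<in>{..<n2}. y i, \<lambda>i\<in>{..<n3}. \<one>\<^bsub>pruefer p\<^esub>, \<one>\<^bsub>F\<^esub>)"
    have m: "m \<in> carrier M" unfolding m_def carrier_model_group using y(1) by auto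
    have pm: "proj m = m" by (simp add: proj_def m_def)
    have "m [^]\<^bsub>M\<^esub> p = f x"
    proof -
      have "(\<lambda>i\<in>{..<n2}. (\<lambda>i\<in>{..<n2}. y i) i [^]\<^bsub>Qp p\<^esub> p) = b"
      proof
        fix i
        show "(\<lambda>i\<in>{..<n2}. (\<lambda>i\<in>{..<n2}. y i) i [^]\<^bsub>Qp p\<^esub> p) i = b i"
          using y(2)[of i] PiE_arb[OF b, of i] by (cases "i \<in> {..<n2}") simp_all
      qed
      then show ?thesis
        unfolding fx' m_def pow_model_group[OF m[unfolded m_def]]
        by (simp add: restrict_def fun_eq_iff)
    qed
    then have "f (g m [^] p) = f x" using f.hom_nat_pow[OF g[OF m], of p] fg'[OF m] by simp
    then have "g m [^] p = x" using g[OF m] x(1) by (intro f_inj) auto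
    moreover have "\<pi> (g m) = g m" using fixed[OF g[OF m]] fg'[OF m] pm by simp
    ultimately show "\<exists>y\<in>carrier G. \<pi> y = y \<and> y [^] p = x" using g[OF m] by blast
  next
    show "g e \<in> carrier G" by (rule g[OF e])
    show "\<pi> (g e) = g e" using fixed[OF g[OF e]] fg'[OF e] proj_e by simp
    show "g e \<noteq> \<one>"
    proof
      assume "g e = \<one>"
      then have "e = \<one>\<^bsub>M\<^esub>" using fg'[OF e] by simp
      then have "(\<lambda>i\<in>{..<n2}. A) = (\<lambda>i\<in>{..<n2}. \<one>\<^bsub>Qp p\<^esub>)" by (simp add: e_def one_model_group)
      then have "(\<lambda>i\<in>{..<n2}. A) 0 = (\<lambda>i\<in>{..<n2}. \<one>\<^bsub>Qp p\<^esub>) 0" by (rule fun_cong)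
      then show False using A(2) assms by simp
    qed
  qed
qed

end

theorem theorem1p5:
  fixes G :: "('a, 'm) monoid_scheme" and T :: "'a topology" and p :: nat
  assumes "prime p"
    and "lca_p_group G T p"
    and "rank_p p G T < \<infinity>"
  shows "class_E_finite G T \<and>
    (\<forall>n1 n2 n3 (F :: ('b, 'n) monoid_scheme).
       finite_p_group p F \<and>
       topologically_isomorphic G T (model_group p n1 n2 n3 F) (model_top p n1 n2 n3 F) \<longrightarrow>
       (class_E_0 G T \<longleftrightarrow> n2 = 0))"
proof -
  interpret finite_rank_p_group G T p
    using assms by (intro finite_rank_p_group.intro prime_lca_p_group.intro
        prime_lca_p_group_axioms.intro finite_rank_p_group_axioms.intro)
  show ?thesis
  proof (intro conjI allI impI)
    show "class_E_finite G T" by (rule finite_entropy)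
    fix n1 n2 n3 and F :: "('b, 'n) monoid_scheme"
    assume F: "finite_p_group p F \<and>
      topologically_isomorphic G T (model_group p n1 n2 n3 F) (model_top p n1 n2 n3 F)"
    then obtain f where f: "f \<in> iso G (model_group p n1 n2 n3 F)"
      "homeomorphic_map T (model_top p n1 n2 n3 F) f"
      unfolding topologically_isomorphic_def by blast
    interpret modelled_group G T p f n1 n2 n3 F
      using F f by unfold_locales auto
    show "class_E_0 G T \<longleftrightarrow> n2 = 0"
      using zero_entropy_model positive_entropy_model by blast
  qed
qed

end
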